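(* Let $G$ be a compact Abelian group, $X,Y$ Banach spaces and $T\in L(X,Y)$. For functions $\overline f\in C(G,X)$ consider the convolution operators $\star\overline f: M(G)\to C(G,X)$. Consider the following assertions: (1) $T$ possesses the property $(\mathfrak l)$. (2) $T\in\Pi_2(X,Y)$, i.e. $T$ is $2$-absolutely summing. (3) If $d\in l_1^{weak}(X)\cap l_2(X)$, then $Td\in l_1(Y)$. Then $(1)\Rightarrow(2)$ and $(3)\Rightarrow(1)$.
   Context: $L(X,Y)$ is the space of bounded linear operators from $X$ to $Y$. $\Gamma$ is the dual group of $G$, $m$ the normalized Haar measure, $M(G)=C(G)^*$ the space of finite regular Borel complex measures on $G$, $C(G,X)$ the space of continuous $X$-valued functions on $G$ with the sup norm. For $\overline f\in C(G,X)$ the convolution operator $\star\overline f: M(G)\to C(G,X)$ is $(\star\overline f)(\mu)(s)=\int_G\overline f(s-t)\,d\mu(t)\in X$, and the Fourier coefficients are $\widehat{\overline f}(\gamma)=\int_G\overline{\gamma(t)}\,\overline f(t)\,dm(t)\in X$, $\gamma\in\Gamma$ (the bar in $\overline f$ is only notation for a vector-valued function). Property $(\mathfrak l)$: $T\in L(X,Y)$ possesses $(\mathfrak l)$ if for every $\overline f\in C(G,X)$ such that $\star\overline f$ can be factored as a product of bounded operators $M(G)\to H\to C(G,X)$ through a Hilbert space $H$, the family $T\widehat{\overline f}=(T\widehat{\overline f}(\gamma))_{\gamma\in\Gamma}$ is absolutely summable, i.e. $\sum_{\gamma}\|T\widehat{\overline f}(\gamma)\|<\infty$. $T\in\Pi_2(X,Y)$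 means there is $C>0$ with $\sum_{n=1}^N\|Tx_n\|^2\le C^2\sup_{\|x'\|\le1}\sum_{n=1}^N|\langle x_n,x'\rangle|^2$ for all finite sequences $(x_n)_{n=1}^N$ in $X$, the supremum being over $x'\in X^*$. A sequence $d=(d_n)$ in $X$ is in $l_1^{weak}(X)$ if $\sum_n|\langle x',d_n\rangle|<\infty$ for all $x'\in X^*$; it is in $l_p(X)$ if $\sum_n\|d_n\|^p<\infty$ (and similarly for $Y$); $Td=(Td_n)$.
   Formalization: The implication (1)⇒(2) is stated for infinite G only: if G is finite, the dual group is finite and every T has property (l), while the identity of an infinite-dimensional Hilbert space is not 2-absolutely summing; (3)⇒(1) is stated for every compact Abelian G. *)

theory Defs
  imports "HOL-Analysis.Analysis"
begin

section \<open>Complex Banach spaces\<close>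

class complex_normed_vector = real_normed_vector +
  fixes scaleC :: "complex \<Rightarrow> 'a \<Rightarrow> 'a" (infixr "*\<^sub>C" 75)
  assumes scaleC_add_right: "c *\<^sub>C (x + y) = c *\<^sub>C x + c *\<^sub>C y"
    and scaleC_add_left: "(c + d) *\<^sub>C x = c *\<^sub>C x + d *\<^sub>C x"
    and scaleC_scaleC: "c *\<^sub>C d *\<^sub>C x = (c * d) *\<^sub>C x"
    and scaleC_of_real: "of_real r *\<^sub>C x = r *\<^sub>R x"
    and norm_scaleC: "norm (c *\<^sub>C x) = cmod c * norm x"

class complex_banach = complex_normed_vector + banach

lemma scaleR_scaleC_commute:
  fixes x :: "'a::complex_normed_vector"
  shows "c *\<^sub>C r *\<^sub>R x = r *\<^sub>R c *\<^sub>C x"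
  by (simp add: scaleC_of_real[symmetric] scaleC_scaleC mult.commute)

lemma bounded_linear_scaleC:
  "bounded_linear (\<lambda>x::'a::complex_normed_vector. c *\<^sub>C x)"
  by (rule bounded_linear_intro[where K = "cmod c"])
    (simp_all add: scaleC_add_right scaleR_scaleC_commute norm_scaleC mult.commute)

lemmas scaleC_zero = bounded_linear.linear[OF bounded_linear_scaleC, THEN linear_0]
  and scaleC_minus = bounded_linear.linear[OF bounded_linear_scaleC, THEN linear_neg]
  and scaleC_diff = bounded_linear.linear[OF bounded_linear_scaleC, THEN linear_diff]

instantiation complex :: complex_banach
begin

definition scaleC_complex :: "complex \<Rightarrow> complex \<Rightarrow> complex"
  where "scaleC_complex c x = c * x"

instance
  by standard (simp_all add: scaleC_complex_def algebra_simps norm_mult scaleR_conv_of_real)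

end

unbundle bcontfun.lifting

instantiation bcontfun :: (topological_space, complex_normed_vector) complex_normed_vector
begin

lift_definition scaleC_bcontfun :: "complex \<Rightarrow> ('a \<Rightarrow>\<^sub>C 'b) \<Rightarrow> ('a \<Rightarrow>\<^sub>C 'b)"
  is "\<lambda>c f x. c *\<^sub>C f x"
proof -
  fix c :: complex and f :: "'a \<Rightarrow> 'b"
  assume f: "f \<in> bcontfun"
  interpret S: bounded_linear "\<lambda>x::'b. c *\<^sub>C x" by (rule bounded_linear_scaleC)
  have "bounded ((\<lambda>x. c *\<^sub>C x) ` range f)"
    using f by (intro bounded_linear_image S.bounded_linear_axioms) (simp add: bcontfun_def)
  then show "(\<lambda>x. c *\<^sub>C f x) \<in> bcontfun"
    using f by (auto simp: bcontfun_def image_image intro!: S.continuous_on)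
qed

instance
proof
  fix c d :: complex and r :: real and f g :: "'a \<Rightarrow>\<^sub>C 'b"
  show "c *\<^sub>C (f + g) = c *\<^sub>C f + c *\<^sub>C g"
    by transfer (simp add: scaleC_add_right)
  show "(c + d) *\<^sub>C f = c *\<^sub>C f + d *\<^sub>C f"
    by transfer (simp add: scaleC_add_left)
  show "c *\<^sub>C d *\<^sub>C f = (c * d) *\<^sub>C f"
    by transfer (simp add: scaleC_scaleC)
  show "of_real r *\<^sub>C f = r *\<^sub>R f"
    by transfer (simp add: scaleC_of_real)
  have le: "norm (a *\<^sub>C h) \<le> cmod a * norm h" for a and h :: "'a \<Rightarrow>\<^sub>C 'b"
    by (rule norm_bound) (simp add: scaleC_bcontfun.rep_eq norm_scaleC mult_left_mono norm_bounded)
  show "norm (c *\<^sub>C f) = cmod c * norm f"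
  proof (cases "c = 0")
    case True
    then show ?thesis using le[of 0 f] by simp
  next
    case False
    have "f = inverse c *\<^sub>C c *\<^sub>C f"
      using False by transfer (simp add: scaleC_scaleC scaleC_of_real[of 1, simplified])
    then have "norm f \<le> cmod (inverse c) * norm (c *\<^sub>C f)"
      using le[of "inverse c" "c *\<^sub>C f"] by simp
    then have "cmod c * norm f \<le> norm (c *\<^sub>C f)"
      using False by (simp add: norm_inverse norm_divide field_simps)
    then show ?thesis using le[of c f] by simp
  qed
qed

end

text \<open>The Banach space of bounded complex-linear operators, with the operator norm.\<close>

typedef (overloaded) ('a, 'b) cblinfun =
  "{f :: 'a::complex_normed_vector \<Rightarrow>\<^sub>L 'b::complex_normed_vector. \<forall>c x. f (c *\<^sub>C x) = c *\<^sub>C f x}"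
  morphisms blinfun_of_cblinfun Abs_cblinfun
  by (rule exI[of _ 0]) (simp add: scaleC_zero)

setup_lifting type_definition_cblinfun

lift_definition cblinfun_apply ::
  "('a::complex_normed_vector, 'b::complex_normed_vector) cblinfun \<Rightarrow> 'a \<Rightarrow> 'b"
  is blinfun_apply .

declare [[coercion cblinfun_apply]]

lemma Blinfun_scaleC_apply:
  "blinfun_apply (Blinfun (\<lambda>x. c *\<^sub>C blinfun_apply f x)) x = c *\<^sub>C blinfun_apply f x"
  for f :: "'c::real_normed_vector \<Rightarrow>\<^sub>L 'b::complex_normed_vector"
  by (simp add: bounded_linear_Blinfun_apply
      bounded_linear_compose[OF bounded_linear_scaleC blinfun.bounded_linear_right])

instantiation cblinfun :: (complex_normed_vector, complex_normed_vector) complex_normed_vector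
begin

lift_definition zero_cblinfun :: "('a, 'b) cblinfun" is 0
  by (simp add: scaleC_zero)

lift_definition plus_cblinfun :: "('a, 'b) cblinfun \<Rightarrow> ('a, 'b) cblinfun \<Rightarrow> ('a, 'b) cblinfun"
  is "(+)"
  by (simp add: blinfun.add_left scaleC_add_right)

lift_definition uminus_cblinfun :: "('a, 'b) cblinfun \<Rightarrow> ('a, 'b) cblinfun" is uminus
  by (simp add: blinfun.minus_left scaleC_minus)

lift_definition minus_cblinfun :: "('a, 'b) cblinfun \<Rightarrow> ('a, 'b) cblinfun \<Rightarrow> ('a, 'b) cblinfun"
  is "(-)"
  by (simp add: blinfun.diff_left scaleC_diff)

lift_definition scaleR_cblinfun :: "real \<Rightarrow> ('a, 'b) cblinfun \<Rightarrow> ('a, 'b) cblinfun" is scaleR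
  by (simp add: blinfun.scaleR_left scaleR_scaleC_commute)

lift_definition scaleC_cblinfun :: "complex \<Rightarrow> ('a, 'b) cblinfun \<Rightarrow> ('a, 'b) cblinfun"
  is "\<lambda>c f. Blinfun (\<lambda>x. c *\<^sub>C blinfun_apply f x)"
  by (simp add: Blinfun_scaleC_apply scaleC_scaleC mult.commute)

lift_definition norm_cblinfun :: "('a, 'b) cblinfun \<Rightarrow> real" is norm .

definition dist_cblinfun :: "('a, 'b) cblinfun \<Rightarrow> ('a, 'b) cblinfun \<Rightarrow> real"
  where "dist_cblinfun f g = norm (f - g)"

definition sgn_cblinfun :: "('a, 'b) cblinfun \<Rightarrow> ('a, 'b) cblinfun"
  where "sgn_cblinfun f = inverse (norm f) *\<^sub>R f"

definition uniformity_cblinfun :: "(('a, 'b) cblinfun \<times> ('a, 'b) cblinfun) filter"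
  where "uniformity_cblinfun = (INF e\<in>{0 <..}. principal {(x, y). dist x y < e})"

definition open_cblinfun :: "('a, 'b) cblinfun set \<Rightarrow> bool"
  where "open_cblinfun S = (\<forall>x\<in>S. \<forall>\<^sub>F (x', y) in uniformity. x' = x \<longrightarrow> y \<in> S)"

instance
proof
  fix c d :: complex and r s :: real and f g h :: "('a, 'b) cblinfun"
  show "f + g + h = f + (g + h)" by transfer (simp add: algebra_simps)
  show "f + g = g + f" by transfer (simp add: algebra_simps)
  show "0 + f = f" by transfer simp
  show "- f + f = 0" by transfer simp
  show "f - g = f + - g" by transfer simp
  show "r *\<^sub>R (f + g) = r *\<^sub>R f + r *\<^sub>R g" by transfer (simp add: algebra_simps)
  show "(r + s) *\<^sub>R f = r *\<^sub>R f + s *\<^sub>R f" by transfer (simp add: algebra_simps)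
  show "r *\<^sub>R s *\<^sub>R f = (r * s) *\<^sub>R f" by transfer simp
  show "1 *\<^sub>R f = f" by transfer simp
  show "dist f g = norm (f - g)" by (rule dist_cblinfun_def)
  show "sgn f = inverse (norm f) *\<^sub>R f" by (rule sgn_cblinfun_def)
  show "uniformity = (INF e\<in>{0 <..}. principal {(x, y :: ('a, 'b) cblinfun). dist x y < e})"
    by (rule uniformity_cblinfun_def)
  show "open S = (\<forall>x\<in>S. \<forall>\<^sub>F (x', y) in uniformity. x' = x \<longrightarrow> y \<in> S)"
    for S :: "('a, 'b) cblinfun set" by (rule open_cblinfun_def)
  show "norm f = 0 \<longleftrightarrow> f = 0" by transfer simp
  show "norm (f + g) \<le> norm f + norm g" by transfer (rule norm_triangle_ineq)
  show "norm (r *\<^sub>R f) = \<bar>r\<bar> * norm f" by transfer simp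
  show "c *\<^sub>C (f + g) = c *\<^sub>C f + c *\<^sub>C g"
    by transfer (rule blinfun_eqI, subst Blinfun_scaleC_apply,
        simp add: Blinfun_scaleC_apply blinfun.add_left scaleC_add_right)
  show "(c + d) *\<^sub>C f = c *\<^sub>C f + d *\<^sub>C f"
    by transfer (rule blinfun_eqI, subst Blinfun_scaleC_apply,
        simp add: Blinfun_scaleC_apply blinfun.add_left scaleC_add_left)
  show "c *\<^sub>C d *\<^sub>C f = (c * d) *\<^sub>C f"
    by transfer (rule blinfun_eqI, subst Blinfun_scaleC_apply,
        simp add: Blinfun_scaleC_apply scaleC_scaleC)
  show "of_real r *\<^sub>C f = r *\<^sub>R f"
    by transfer (rule blinfun_eqI, subst Blinfun_scaleC_apply,
        simp add: Blinfun_scaleC_apply blinfun.scaleR_left scaleC_of_real)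
  show "norm (c *\<^sub>C f) = cmod c * norm f"
  proof transfer
    fix c and f :: "'a \<Rightarrow>\<^sub>L 'b"
    have le: "norm (Blinfun (\<lambda>x. a *\<^sub>C blinfun_apply k x)) \<le> cmod a * norm k"
      for a and k :: "'a \<Rightarrow>\<^sub>L 'b"
      by (rule norm_blinfun_bound)
        (simp_all add: Blinfun_scaleC_apply norm_scaleC mult.assoc mult_left_mono norm_blinfun)
    show "norm (Blinfun (\<lambda>x. c *\<^sub>C blinfun_apply f x)) = cmod c * norm f"
    proof (cases "c = 0")
      case True
      then show ?thesis using le[of 0 f] by simp
    next
      case False
      let ?g = "Blinfun (\<lambda>x. c *\<^sub>C blinfun_apply f x)"
      have "f = Blinfun (\<lambda>x. inverse c *\<^sub>C blinfun_apply ?g x)"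
        using False
        by (intro blinfun_eqI, simp only: Blinfun_scaleC_apply scaleC_scaleC)
          (simp add: scaleC_of_real[of 1, simplified])
      then have "norm f \<le> cmod (inverse c) * norm ?g"
        using le[of "inverse c" ?g] by simp
      then have "cmod c * norm f \<le> norm ?g"
        using False by (simp add: norm_inverse norm_divide field_simps)
      then show ?thesis using le[of c f] by simp
    qed
  qed
qed

end

type_synonym 'x cdual = "('x, complex) cblinfun"


section \<open>Harmonic analysis on a compact Abelian group\<close>

text \<open>
  The group is written additively. The type \<^typ>\<open>'g \<Rightarrow>\<^sub>C 'x\<close> consists of all bounded
  continuous functions with the sup norm, hence is \<open>C(G,X)\<close> when the group is compact.
\<close>

definition dual_group :: "('g::topological_ab_group_add \<Rightarrow> complex) set"
  where "dual_group =
    {\<gamma>. continuous_on UNIV \<gamma> \<and> (\<forall>s. cmod (\<gamma> s) = 1) \<and> (\<forall>s t. \<gamma> (s + t) = \<gamma> s * \<gamma> t)}"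

definition normalized_haar_measure :: "'g::topological_ab_group_add measure \<Rightarrow> bool"
  where "normalized_haar_measure m \<longleftrightarrow>
    sets m = sets borel \<and>
    emeasure m UNIV = 1 \<and>
    (\<forall>s. \<forall>A\<in>sets borel. emeasure m ((+) s ` A) = emeasure m A) \<and>
    (\<forall>A\<in>sets borel.
      emeasure m A = (INF U\<in>{U. open U \<and> A \<subseteq> U}. emeasure m U) \<and>
      emeasure m A = (SUP K\<in>{K. compact K \<and> K \<subseteq> A}. emeasure m K))"

text \<open>
  \<open>M(G) = C(G)\<^sup>*\<close>: a finite regular complex Borel measure is identified with the functional
  it induces on \<open>C(G)\<close>; its norm is the total variation, and the integral of a continuous
  scalar function is the value of the functional.
\<close>

type_synonym 'g cmeasure = "('g \<Rightarrow>\<^sub>C complex) cdual"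

definition cmeasure_integral ::
  "'g::topological_space cmeasure \<Rightarrow> ('g \<Rightarrow> complex) \<Rightarrow> complex"
  where "cmeasure_integral \<mu> \<phi> = \<mu> (Bcontfun \<phi>)"

text \<open>
  The Bochner integral of the library needs a second countable range, so vector-valued integrals
  are taken in the weak sense: \<open>weak_integral I f\<close> is the element \<open>x\<close> with
  \<open>\<langle>x, x'\<rangle> = I (t \<mapsto> \<langle>f t, x'\<rangle>)\<close> for all \<open>x'\<close> in the dual, where \<open>I\<close> is the
  scalar integral. For continuous functions on a compact group it exists, and it is unique by
  the Hahn-Banach theorem.
\<close>

definition weak_integral ::
  "(('g \<Rightarrow> complex) \<Rightarrow> complex) \<Rightarrow> ('g \<Rightarrow> 'x::complex_banach) \<Rightarrow> 'x"
  where "weak_integral I f = (THE x. \<forall>x' :: 'x cdual. x' x = I (\<lambda>t. x' (f t)))"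

definition convolution ::
  "('g::topological_ab_group_add \<Rightarrow>\<^sub>C 'x::complex_banach) \<Rightarrow> 'g cmeasure \<Rightarrow> 'g \<Rightarrow> 'x"
  where "convolution f \<mu> s = weak_integral (cmeasure_integral \<mu>) (\<lambda>t. f (s - t))"

definition fourier_coeff ::
  "'g::topological_ab_group_add measure \<Rightarrow> ('g \<Rightarrow>\<^sub>C 'x::complex_banach) \<Rightarrow> ('g \<Rightarrow> complex) \<Rightarrow> 'x"
  where "fourier_coeff m f \<gamma> =
    weak_integral (\<lambda>\<phi>. LINT t|m. \<phi> t) (\<lambda>t. cnj (\<gamma> t) *\<^sub>C f t)"


section \<open>Hilbert spaces and factorization\<close>

text \<open>
  Property (l) quantifies over Hilbert spaces inside a formula, so these are
  represented by carrier sets with explicit operations. The inner product is linear in its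
  first argument.
\<close>

record 'h hilbert_ops =
  hcarrier :: "'h set"
  hzero :: 'h
  hadd :: "'h \<Rightarrow> 'h \<Rightarrow> 'h"
  hscale :: "complex \<Rightarrow> 'h \<Rightarrow> 'h"
  hinner :: "'h \<Rightarrow> 'h \<Rightarrow> complex"

definition hnorm :: "'h hilbert_ops \<Rightarrow> 'h \<Rightarrow> real"
  where "hnorm H x = sqrt (Re (hinner H x x))"

definition hdist :: "'h hilbert_ops \<Rightarrow> 'h \<Rightarrow> 'h \<Rightarrow> real"
  where "hdist H x y = hnorm H (hadd H x (hscale H (- 1) y))"

locale hilbert_space =
  fixes H :: "'h hilbert_ops"
  assumes zero_closed: "hzero H \<in> hcarrier H"
    and add_closed: "\<lbrakk>x \<in> hcarrier H; y \<in> hcarrier H\<rbrakk> \<Longrightarrow> hadd H x y \<in> hcarrier H"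
    and scale_closed: "x \<in> hcarrier H \<Longrightarrow> hscale H c x \<in> hcarrier H"
    and add_assoc: "\<lbrakk>x \<in> hcarrier H; y \<in> hcarrier H; z \<in> hcarrier H\<rbrakk> \<Longrightarrow>
      hadd H (hadd H x y) z = hadd H x (hadd H y z)"
    and add_commute: "\<lbrakk>x \<in> hcarrier H; y \<in> hcarrier H\<rbrakk> \<Longrightarrow> hadd H x y = hadd H y x"
    and add_zero: "x \<in> hcarrier H \<Longrightarrow> hadd H x (hzero H) = x"
    and add_inverse: "x \<in> hcarrier H \<Longrightarrow> hadd H x (hscale H (- 1) x) = hzero H"
    and scale_add_right: "\<lbrakk>x \<in> hcarrier H; y \<in> hcarrier H\<rbrakk> \<Longrightarrow>
      hscale H c (hadd H x y) = hadd H (hscale H c x) (hscale H c y)"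
    and scale_add_left: "x \<in> hcarrier H \<Longrightarrow>
      hscale H (c + d) x = hadd H (hscale H c x) (hscale H d x)"
    and scale_scale: "x \<in> hcarrier H \<Longrightarrow> hscale H c (hscale H d x) = hscale H (c * d) x"
    and scale_one: "x \<in> hcarrier H \<Longrightarrow> hscale H 1 x = x"
    and inner_commute: "\<lbrakk>x \<in> hcarrier H; y \<in> hcarrier H\<rbrakk> \<Longrightarrow> hinner H x y = cnj (hinner H y x)"
    and inner_add_left: "\<lbrakk>x \<in> hcarrier H; y \<in> hcarrier H; z \<in> hcarrier H\<rbrakk> \<Longrightarrow>
      hinner H (hadd H x y) z = hinner H x z + hinner H y z"
    and inner_scale_left: "\<lbrakk>x \<in> hcarrier H; y \<in> hcarrier H\<rbrakk> \<Longrightarrow>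
      hinner H (hscale H c x) y = c * hinner H x y"
    and inner_pos: "\<lbrakk>x \<in> hcarrier H; x \<noteq> hzero H\<rbrakk> \<Longrightarrow> 0 < Re (hinner H x x)"
    and complete: "\<lbrakk>\<And>n::nat. u n \<in> hcarrier H;
        \<And>e. 0 < e \<Longrightarrow> \<exists>N. \<forall>i\<ge>N. \<forall>j\<ge>N. hdist H (u i) (u j) < e\<rbrakk> \<Longrightarrow>
      \<exists>l\<in>hcarrier H. (\<lambda>n. hdist H (u n) l) \<longlonglongrightarrow> 0"

definition bounded_into :: "'h hilbert_ops \<Rightarrow> ('a::complex_normed_vector \<Rightarrow> 'h) \<Rightarrow> bool"
  where "bounded_into H A \<longleftrightarrow>
    (\<forall>x. A x \<in> hcarrier H) \<and>
    (\<forall>x y. A (x + y) = hadd H (A x) (A y)) \<and>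
    (\<forall>c x. A (c *\<^sub>C x) = hscale H c (A x)) \<and>
    (\<exists>K. \<forall>x. hnorm H (A x) \<le> K * norm x)"

definition bounded_from :: "'h hilbert_ops \<Rightarrow> ('h \<Rightarrow> 'b::complex_normed_vector) \<Rightarrow> bool"
  where "bounded_from H B \<longleftrightarrow>
    (\<forall>x\<in>hcarrier H. \<forall>y\<in>hcarrier H. B (hadd H x y) = B x + B y) \<and>
    (\<forall>c. \<forall>x\<in>hcarrier H. B (hscale H c x) = c *\<^sub>C B x) \<and>
    (\<exists>K. \<forall>x\<in>hcarrier H. norm (B x) \<le> K * hnorm H x)"

definition factors_through ::
  "'h hilbert_ops \<Rightarrow> ('g::topological_ab_group_add \<Rightarrow>\<^sub>C 'x::complex_banach) \<Rightarrow> bool"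
  where "factors_through H f \<longleftrightarrow>
    (\<exists>(A :: 'g cmeasure \<Rightarrow> 'h) (B :: 'h \<Rightarrow> ('g \<Rightarrow>\<^sub>C 'x)).
      bounded_into H A \<and> bounded_from H B \<and>
      (\<forall>\<mu>. apply_bcontfun (B (A \<mu>)) = convolution f \<mu>))"

text \<open>
  HOL cannot quantify over the type of the points of \<open>H\<close>. The points are therefore taken from
  \<^typ>\<open>'g cmeasure \<Rightarrow> complex\<close>; this is no restriction, as shown by the lemma
  \<open>factors_through_hilbert_spaceI\<close> below: a factorization through a Hilbert space over any
  type yields one of this form.
\<close>

definition factors_through_hilbert_space ::
  "('g::topological_ab_group_add \<Rightarrow>\<^sub>C 'x::complex_banach) \<Rightarrow> bool"
  where "factors_through_hilbert_space f \<longleftrightarrow>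
    (\<exists>H :: ('g cmeasure \<Rightarrow> complex) hilbert_ops. hilbert_space H \<and> factors_through H f)"

subsection \<open>Independence of the type of points\<close>

definition transport :: "('h \<Rightarrow> 'k) \<Rightarrow> 'h hilbert_ops \<Rightarrow> 'k hilbert_ops"
  where "transport J H = (let r = inv_into (hcarrier H) J in
    \<lparr>hcarrier = J ` hcarrier H, hzero = J (hzero H),
     hadd = (\<lambda>x y. J (hadd H (r x) (r y))),
     hscale = (\<lambda>c x. J (hscale H c (r x))),
     hinner = (\<lambda>x y. hinner H (r x) (r y))\<rparr>)"

lemma hilbert_space_transport:
  assumes "hilbert_space H" and J: "inj_on J (hcarrier H)"
  shows "hilbert_space (transport J H)"
proof -
  interpret hilbert_space H by fact
  let ?T = "transport J H"
  have r[simp]: "inv_into (hcarrier H) J (J x) = x" if "x \<in> hcarrier H" for x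
    using J that by simp
  have sel[simp]: "hcarrier ?T = J ` hcarrier H" "hzero ?T = J (hzero H)"
    "hadd ?T x y = J (hadd H (inv_into (hcarrier H) J x) (inv_into (hcarrier H) J y))"
    "hscale ?T c x = J (hscale H c (inv_into (hcarrier H) J x))"
    "hinner ?T x y = hinner H (inv_into (hcarrier H) J x) (inv_into (hcarrier H) J y)" for x y c
    by (simp_all add: transport_def Let_def)
  note [simp] = zero_closed add_closed scale_closed
  have d[simp]: "hdist ?T (J x) (J y) = hdist H x y" if "x \<in> hcarrier H" "y \<in> hcarrier H" for x y
    using that by (simp add: hdist_def hnorm_def)
  show ?thesis
  proof
    fix u :: "nat \<Rightarrow> _"
    assume u: "\<And>n. u n \<in> hcarrier ?T"
      and C: "\<And>e. 0 < e \<Longrightarrow> \<exists>N. \<forall>i\<ge>N. \<forall>j\<ge>N. hdist ?T (u i) (u j) < e"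
    define v where "v n = inv_into (hcarrier H) J (u n)" for n
    have v: "v n \<in> hcarrier H" "u n = J (v n)" for n
      using u[of n] by (auto simp: v_def)
    obtain l where l: "l \<in> hcarrier H" "(\<lambda>n. hdist H (v n) l) \<longlonglongrightarrow> 0"
      using complete[of v] v C by auto
    then show "\<exists>l\<in>hcarrier ?T. (\<lambda>n. hdist ?T (u n) l) \<longlonglongrightarrow> 0"
      by (intro bexI[of _ "J l"]) (simp_all add: v)
  qed (auto simp: add_assoc add_zero add_inverse scale_add_right scale_add_left scale_scale
      scale_one inner_add_left inner_scale_left
      intro: add_commute[THEN arg_cong[where f = J]] inner_commute inner_pos)
qed

context hilbert_space
begin

lemma inner_add_right: "\<lbrakk>x \<in> hcarrier H; y \<in> hcarrier H; z \<in> hcarrier H\<rbrakk> \<Longrightarrow>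
    hinner H z (hadd H x y) = hinner H z x + hinner H z y"
  by (metis add_closed complex_cnj_add inner_add_left inner_commute)

lemma inner_scale_right: "\<lbrakk>x \<in> hcarrier H; y \<in> hcarrier H\<rbrakk> \<Longrightarrow>
    hinner H x (hscale H c y) = cnj c * hinner H x y"
  by (metis complex_cnj_mult inner_commute inner_scale_left scale_closed)

lemma inner_zero: "x \<in> hcarrier H \<Longrightarrow> hinner H (hzero H) x = 0"
  by (metis add_cancel_right_right add_zero inner_add_left zero_closed)

lemma inner_nonneg: "x \<in> hcarrier H \<Longrightarrow> 0 \<le> Re (hinner H x x)"
  by (cases "x = hzero H") (auto simp: inner_zero intro: less_imp_le inner_pos)

lemma hnorm_square: "x \<in> hcarrier H \<Longrightarrow> (hnorm H x)\<^sup>2 = Re (hinner H x x)"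
  by (simp add: hnorm_def inner_nonneg)

lemma hnorm_nonneg: "x \<in> hcarrier H \<Longrightarrow> 0 \<le> hnorm H x"
  by (simp add: hnorm_def inner_nonneg)

lemma hnorm_scale: "x \<in> hcarrier H \<Longrightarrow> hnorm H (hscale H c x) = cmod c * hnorm H x"
proof -
  assume x: "x \<in> hcarrier H"
  have "hinner H (hscale H c x) (hscale H c x) = of_real ((cmod c)\<^sup>2) * hinner H x x"
    using x by (simp add: inner_scale_left inner_scale_right scale_closed complex_norm_square
        del: of_real_power)
  then show ?thesis
    by (simp add: hnorm_def real_sqrt_mult del: of_real_power)
qed

lemma hnorm_add_square:
  assumes "x \<in> hcarrier H" "y \<in> hcarrier H"
  shows "(hnorm H (hadd H x y))\<^sup>2 \<le> 2 * (hnorm H x)\<^sup>2 + 2 * (hnorm H y)\<^sup>2"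
proof -
  have "0 \<le> Re (hinner H (hadd H x (hscale H (-1) y)) (hadd H x (hscale H (-1) y)))"
    using assms by (intro inner_nonneg add_closed scale_closed)
  then show ?thesis
    using assms by (simp add: hnorm_square add_closed scale_closed inner_add_left inner_add_right
        inner_scale_left inner_scale_right)
qed

lemma hnorm_add_less:
  assumes "x \<in> hcarrier H" "y \<in> hcarrier H" "hnorm H x < e / 2" "hnorm H y < e / 2"
  shows "hnorm H (hadd H x y) < e"
proof -
  have "(hnorm H x)\<^sup>2 < (e / 2)\<^sup>2" "(hnorm H y)\<^sup>2 < (e / 2)\<^sup>2"
    using assms hnorm_nonneg by (auto intro!: power_strict_mono)
  then have "(hnorm H (hadd H x y))\<^sup>2 < e\<^sup>2"
    using hnorm_add_square[OF assms(1,2)] by (simp add: power_divide)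
  moreover have "0 \<le> e" using hnorm_nonneg[OF assms(1)] assms(3) by simp
  ultimately show ?thesis by (rule power_less_imp_less_base)
qed

lemma add_swap:
  assumes "a \<in> hcarrier H" "b \<in> hcarrier H" "c \<in> hcarrier H" "d \<in> hcarrier H"
  shows "hadd H (hadd H a b) (hadd H c d) = hadd H (hadd H a c) (hadd H b d)"
  using assms by (metis add_assoc add_closed add_commute)

lemma hilbert_space_subspace:
  assumes sub: "C \<subseteq> hcarrier H" and z: "hzero H \<in> C"
    and add: "\<And>x y. x \<in> C \<Longrightarrow> y \<in> C \<Longrightarrow> hadd H x y \<in> C"
    and scale: "\<And>c x. x \<in> C \<Longrightarrow> hscale H c x \<in> C"
    and closed: "\<And>l. l \<in> hcarrier H \<Longrightarrow> (\<And>e. 0 < e \<Longrightarrow> \<exists>x\<in>C. hdist H x l < e) \<Longrightarrow> l \<in> C"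
  shows "hilbert_space (H\<lparr>hcarrier := C\<rparr>)"
proof -
  have d: "hdist (H\<lparr>hcarrier := C\<rparr>) = hdist H"
    by (intro ext) (simp add: hdist_def hnorm_def)
  note s = subsetD[OF sub]
  show ?thesis
  proof (unfold_locales, unfold d, goal_cases)
    case (16 u)
    then obtain l where l: "l \<in> hcarrier H" "(\<lambda>n. hdist H (u n) l) \<longlonglongrightarrow> 0"
      using complete[of u] s by auto
    have "l \<in> C"
    proof (rule closed[OF l(1)])
      fix e :: real assume "0 < e"
      then have "\<forall>\<^sub>F n in sequentially. hdist H (u n) l < e"
        using l(2) by (rule order_tendstoD(2)[rotated])
      then obtain n where "hdist H (u n) l < e" by (auto simp: eventually_sequentially)
      then show "\<exists>x\<in>C. hdist H x l < e" using 16(1)[of n] by auto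
    qed
    then show ?case using l(2) by auto
  qed (auto simp: z add scale s add_assoc add_zero add_inverse scale_add_right scale_add_left
      scale_scale scale_one inner_add_left inner_scale_left
      intro: add_commute inner_commute inner_pos)
qed

end

lemma factors_through_hilbert_spaceI:
  fixes f :: "'g::topological_ab_group_add \<Rightarrow>\<^sub>C 'x::complex_banach" and H :: "'h hilbert_ops"
  assumes "hilbert_space H" and "factors_through H f"
  shows "factors_through_hilbert_space f"
proof -
  interpret hilbert_space H by fact
  obtain A :: "'g cmeasure \<Rightarrow> 'h" and B :: "'h \<Rightarrow> ('g \<Rightarrow>\<^sub>C 'x)"
    where A: "bounded_into H A" and B: "bounded_from H B"
      and AB: "\<And>\<mu>. apply_bcontfun (B (A \<mu>)) = convolution f \<mu>"
    using assms(2) by (auto simp: factors_through_def)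
  have A_in[simp]: "A \<mu> \<in> hcarrier H"
    and A_add: "A (\<mu> + \<nu>) = hadd H (A \<mu>) (A \<nu>)"
    and A_scale: "A (c *\<^sub>C \<mu>) = hscale H c (A \<mu>)" for c \<mu> \<nu>
    using A by (auto simp: bounded_into_def)
  note [simp] = zero_closed add_closed scale_closed
  define C where "C = {h \<in> hcarrier H. \<forall>e>0. \<exists>\<mu>. hdist H h (A \<mu>) < e}"
  have C_sub: "C \<subseteq> hcarrier H" by (auto simp: C_def)
  have hdist_same: "hdist H x x = 0" if "x \<in> hcarrier H" for x
    using that by (simp add: hdist_def add_inverse hnorm_def inner_zero)
  have A_C: "A \<mu> \<in> C" for \<mu>
    by (auto simp: C_def intro!: exI[of _ \<mu>] simp: hdist_same)
  have "hscale H 0 (A 0) = hzero H"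
    using scale_add_left[of "A 0" 1 "-1"] by (simp add: scale_one add_inverse)
  then have "A 0 = hzero H"
    using A_scale[of 0 0] by (simp add: scaleC_zero)
  then have zero_C: "hzero H \<in> C" using A_C[of 0] by simp
  have add_C: "hadd H x y \<in> C" if "x \<in> C" "y \<in> C" for x y
  proof -
    have xy: "x \<in> hcarrier H" "y \<in> hcarrier H" using that by (auto simp: C_def)
    have "\<exists>\<mu>. hdist H (hadd H x y) (A \<mu>) < e" if "0 < e" for e
    proof -
      have "\<exists>\<mu>. hdist H x (A \<mu>) < e / 2" "\<exists>\<nu>. hdist H y (A \<nu>) < e / 2"
        using \<open>x \<in> C\<close> \<open>y \<in> C\<close> half_gt_zero[OF \<open>0 < e\<close>] unfolding C_def by blast+
      then obtain \<mu> \<nu> where "hdist H x (A \<mu>) < e / 2" "hdist H y (A \<nu>) < e / 2"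
        by blast
      then have "hnorm H (hadd H (hadd H x (hscale H (-1) (A \<mu>)))
          (hadd H y (hscale H (-1) (A \<nu>)))) < e"
        using xy by - (rule hnorm_add_less, simp_all add: hdist_def)
      then have "hdist H (hadd H x y) (A (\<mu> + \<nu>)) < e"
        using xy by (simp add: hdist_def A_add scale_add_right add_swap)
      then show ?thesis ..
    qed
    then show ?thesis using xy by (simp add: C_def)
  qed
  have scale_C: "hscale H c x \<in> C" if "x \<in> C" for c x
  proof -
    have x: "x \<in> hcarrier H" using that by (auto simp: C_def)
    have "\<exists>\<mu>. hdist H (hscale H c x) (A \<mu>) < e" if "0 < e" for e
    proof -
      have "0 < e / (cmod c + 1)" using \<open>0 < e\<close> by (simp add: add_nonneg_pos)
      then obtain \<mu> where \<mu>: "hdist H x (A \<mu>) < e / (cmod c + 1)"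
        using \<open>x \<in> C\<close> unfolding C_def by blast
      have "hdist H (hscale H c x) (A (c *\<^sub>C \<mu>)) =
          hnorm H (hscale H c (hadd H x (hscale H (-1) (A \<mu>))))"
        using x by (simp add: hdist_def A_scale scale_add_right scale_scale mult.commute)
      also have "\<dots> = cmod c * hdist H x (A \<mu>)"
        using x by (simp add: hnorm_scale hdist_def)
      also have "\<dots> \<le> (cmod c + 1) * hdist H x (A \<mu>)"
        using x by (intro mult_right_mono) (auto simp: hdist_def intro: hnorm_nonneg)
      also have "\<dots> < e"
        using \<mu> by (simp add: pos_less_divide_eq add_nonneg_pos mult.commute)
      finally show ?thesis ..
    qed
    then show ?thesis using x by (simp add: C_def)
  qed
  have closed_C: "l \<in> C" if l: "l \<in> hcarrier H"
    and lim: "\<And>e. 0 < e \<Longrightarrow> \<exists>x\<in>C. hdist H x l < e" for l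
  proof -
    have "\<exists>\<mu>. hdist H l (A \<mu>) < e" if "0 < e" for e
    proof -
      obtain x where x: "x \<in> C" "hdist H x l < e / 2"
        using lim[of "e / 2"] \<open>0 < e\<close> by auto
      obtain \<mu> where \<mu>: "hdist H x (A \<mu>) < e / 2"
        using x(1) half_gt_zero[OF \<open>0 < e\<close>] unfolding C_def by blast
      have xH: "x \<in> hcarrier H" using x C_sub by auto
      let ?p = "hadd H x (hscale H (-1) l)" and ?q = "hadd H x (hscale H (-1) (A \<mu>))"
      have "hnorm H (hscale H (-1) ?p) < e / 2" "hnorm H ?q < e / 2"
        using x(2) \<mu> l xH by (simp_all add: hnorm_scale hdist_def)
      then have "hnorm H (hadd H (hscale H (-1) ?p) ?q) < e"
        using l xH by - (rule hnorm_add_less, simp_all)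
      moreover have "hadd H (hscale H (-1) ?p) ?q =
          hadd H (hadd H (hscale H (-1) x) l) ?q"
        using l xH by (simp add: scale_add_right scale_scale scale_one)
      moreover have "\<dots> = hadd H (hadd H (hscale H (-1) x) x) (hadd H l (hscale H (-1) (A \<mu>)))"
        using l xH by (intro add_swap) auto
      moreover have "\<dots> = hadd H l (hscale H (-1) (A \<mu>))"
        using l xH by (metis A_in add_closed add_commute add_inverse add_zero scale_closed zero_closed)
      ultimately show ?thesis by (auto simp: hdist_def)
    qed
    then show ?thesis using l by (simp add: C_def)
  qed
  define K where "K = H\<lparr>hcarrier := C\<rparr>"
  have K: "hilbert_space K"
    unfolding K_def
    using C_sub zero_C add_C scale_C closed_C by (rule hilbert_space_subspace)
  define J where "J h = (\<lambda>\<mu>. hinner H h (A \<mu>))" for h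
  have J: "inj_on J C"
  proof (rule inj_onI)
    fix x y assume xy: "x \<in> C" "y \<in> C" "J x = J y"
    define d where "d = hadd H x (hscale H (-1) y)"
    have xyH: "x \<in> hcarrier H" "y \<in> hcarrier H" using xy C_sub by auto
    have d: "d \<in> C" "d \<in> hcarrier H"
      using xy C_sub by (auto simp: d_def intro: add_C scale_C)
    have perp: "hinner H d (A \<mu>) = 0" for \<mu>
      using xyH fun_cong[OF xy(3), of \<mu>]
      by (simp add: d_def J_def inner_add_left inner_scale_left)
    have perp': "hinner H (A \<mu>) d = 0" for \<mu>
      using perp[of \<mu>] inner_commute[of "A \<mu>" d] d by simp
    have "d = hzero H"
    proof (rule ccontr)
      assume "d \<noteq> hzero H"
      then have "0 < hnorm H d" using inner_pos[OF d(2)] by (simp add: hnorm_def)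
      then obtain \<mu> where \<mu>: "hdist H d (A \<mu>) < hnorm H d"
        using d(1) unfolding C_def by blast
      have "(hnorm H d)\<^sup>2 \<le> (hnorm H d)\<^sup>2 + (hnorm H (A \<mu>))\<^sup>2" by simp
      also have "\<dots> = (hdist H d (A \<mu>))\<^sup>2"
        using d(2) perp[of \<mu>] perp'[of \<mu>]
        by (simp add: hdist_def hnorm_square inner_add_left inner_add_right inner_scale_left
            inner_scale_right)
      also have "\<dots> < (hnorm H d)\<^sup>2"
        using \<mu> d(2) by (intro power_strict_mono) (auto simp: hdist_def intro: hnorm_nonneg)
      finally show False by simp
    qed
    then have "hadd H (hadd H x (hscale H (-1) y)) y = y"
      using xyH by (metis d_def add_commute add_zero zero_closed)
    then show "x = y"
      using xyH by (metis add_assoc add_commute add_inverse add_zero scale_closed)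
  qed
  have T: "hilbert_space (transport J K)"
    by (rule hilbert_space_transport[OF K]) (simp add: K_def J)
  have r[simp]: "inv_into C J (J x) = x" if "x \<in> C" for x
    using J that by simp
  have sel[simp]: "hcarrier (transport J K) = J ` C"
    "hadd (transport J K) x y = J (hadd H (inv_into C J x) (inv_into C J y))"
    "hscale (transport J K) c x = J (hscale H c (inv_into C J x))"
    "hnorm (transport J K) x = hnorm H (inv_into C J x)" for x y c
    by (simp_all add: transport_def Let_def K_def hnorm_def)
  have "bounded_into (transport J K) (J \<circ> A)"
    using A by (auto simp: bounded_into_def A_C)
  moreover have "bounded_from (transport J K) (B \<circ> inv_into C J)"
    using B C_sub by (auto simp: bounded_from_def add_C scale_C subset_iff) blast
  ultimately have "factors_through (transport J K) f"
    unfolding factors_through_def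
    by (intro exI[of _ "J \<circ> A"] exI[of _ "B \<circ> inv_into C J"]) (auto simp: A_C AB)
  with T show ?thesis unfolding factors_through_hilbert_space_def by blast
qed


section \<open>Classes of operators and sequences\<close>

definition property_l ::
  "'g::topological_ab_group_add measure \<Rightarrow> ('x::complex_banach, 'y::complex_banach) cblinfun \<Rightarrow> bool"
  where "property_l m T \<longleftrightarrow>
    (\<forall>f :: 'g \<Rightarrow>\<^sub>C 'x. factors_through_hilbert_space f \<longrightarrow>
      (\<lambda>\<gamma>. norm (T (fourier_coeff m f \<gamma>))) summable_on dual_group)"

definition two_summing :: "('x::complex_banach, 'y::complex_banach) cblinfun \<Rightarrow> bool"
  where "two_summing T \<longleftrightarrow>
    (\<exists>C>0. \<forall>N. \<forall>x :: nat \<Rightarrow> 'x.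
      (\<Sum>n=1..N. (norm (T (x n)))\<^sup>2) \<le>
      C\<^sup>2 * (SUP x'\<in>{x' :: 'x cdual. norm x' \<le> 1}. \<Sum>n=1..N. (cmod (cblinfun_apply x' (x n)))\<^sup>2))"

definition l1_weak :: "(nat \<Rightarrow> 'x::complex_banach) set"
  where "l1_weak = {d. \<forall>x' :: 'x cdual. summable (\<lambda>n. cmod (x' (d n)))}"

definition l1_space :: "(nat \<Rightarrow> 'x::complex_banach) set"
  where "l1_space = {d. summable (\<lambda>n. norm (d n))}"

definition l2_space :: "(nat \<Rightarrow> 'x::complex_banach) set"
  where "l2_space = {d. summable (\<lambda>n. (norm (d n))\<^sup>2)}"

end

theory Submission
  imports Defs
begin

text \<open>
  If \<open>T\<close> is not \<open>2\<close>-summing, there are finite families \<open>z\<^sub>i\<close>, jointly weakly square summable after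
  rescaling, and a square summable \<open>\<alpha>\<close> with \<open>\<Sum> \<bar>\<alpha>\<^sub>i\<bar> \<parallel>T z\<^sub>i\<parallel> = \<infinity>\<close>. Spread over distinct characters
  \<open>\<gamma>\<^sub>i\<close>, the function \<open>f = \<Sum> \<alpha>\<^sub>i \<gamma>\<^sub>i z\<^sub>i\<close> has Fourier coefficients \<open>\<alpha>\<^sub>i z\<^sub>i\<close>, and its convolution operator
  factors through \<open>\<ell>\<^sup>2\<close>, contradicting property \<open>(l)\<close>. This needs infinitely many characters; they
  are found as minimal self-adjoint idempotents of the convolution algebra \<open>C(G)\<close>, obtained from
  normalized convolution powers.

  Conversely, let the convolution operator of \<open>f\<close> be \<open>B A\<close> with \<open>A : M(G) \<rightarrow> H\<close> and
  \<open>B : H \<rightarrow> C(G,X)\<close>. A Bessel inequality bounds \<open>\<Sum>\<^sub>\<gamma> \<parallel>A(\<gamma> m)\<parallel>\<^sup>2\<close> by \<open>\<parallel>A\<parallel>\<^sup>2\<close>. Since \<open>B A(\<gamma> m)\<close> is \<open>\<gamma>\<close>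
  times the coefficient of \<open>f\<close> at \<open>\<gamma>\<close>, the coefficients are square summable; evaluating
  \<open>B A(\<Sum>\<^sub>\<gamma> \<theta>\<^sub>\<gamma> cnj (\<gamma> s) \<gamma> m)\<close> at \<open>s\<close>, with unimodular \<open>\<theta>\<^sub>\<gamma>\<close>, and averaging the squares over \<open>s\<close>
  shows that they are weakly absolutely summable. So assertion (3) applies to them.
\<close>

text \<open>Assertion (1) implies (2) only on infinite groups: a finite group has finitely many
  characters, so there every operator possesses (l), while the identity of an infinite-dimensional
  Banach space is not 2-summing. The group need be neither metrizable nor second countable, and
  \<open>X\<close> need not be separable. So product measures are out of reach and vector-valued
  integrals exist only weakly. The substitute is a partition of unity adapted to the functions at
  hand, with the Hahn-Banach theorem turning scalar identities and estimates into vector ones. The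
  Bessel inequality rests on \<open>M(G)\<close> being a space of measures: an operator from it into
  a Hilbert space is controlled by its values on point masses, whose norms are at most that of the
  operator. Written through point masses, the sum over \<gamma> becomes an average over the group,
  and the sum reappears on the right with a factor 1/2.\<close>

section \<open>Functional analysis\<close>

text \<open>The library has this instance for metric domains only.\<close>

instance bcontfun :: (topological_space, complete_space) complete_space
proof
  fix f :: "nat \<Rightarrow> 'a \<Rightarrow>\<^sub>C 'b"
  assume "Cauchy f"
  have "uniformly_Cauchy_on UNIV (\<lambda>n. apply_bcontfun (f n))"
  proof (rule uniformly_Cauchy_onI)
    fix e :: real assume "0 < e"
    then obtain M where "\<forall>i\<ge>M. \<forall>j\<ge>M. dist (f i) (f j) < e"
      using metric_CauchyD[OF \<open>Cauchy f\<close>] by blast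
    then show "\<exists>M. \<forall>x\<in>UNIV. \<forall>i\<ge>M. \<forall>j\<ge>M. dist (f i x) (f j x) < e"
      using dist_fun_lt_imp_dist_val_lt by fast
  qed
  then have "uniformly_convergent_on UNIV (\<lambda>n. apply_bcontfun (f n))"
    by (rule Cauchy_uniformly_convergent)
  then obtain g where g: "uniform_limit UNIV (\<lambda>n. apply_bcontfun (f n)) g sequentially"
    unfolding uniformly_convergent_on_def ..
  obtain h where "f \<longlonglongrightarrow> h"
    by (rule uniform_limit_bcontfunE[OF g sequentially_bot]) (rule that)
  then show "convergent f" by (rule convergentI)
qed

instance bcontfun :: (topological_space, banach) banach ..

instance bcontfun :: (topological_space, complex_banach) complex_banach ..

section \<open>Pointwise calculus in spaces of continuous functions and of operators\<close>

lemma scaleC_bcontfun_apply [simp]: "(c *\<^sub>C f) x = c *\<^sub>C f x"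
  for f :: "'a::topological_space \<Rightarrow>\<^sub>C 'b::complex_normed_vector"
  by (simp add: scaleC_bcontfun.rep_eq)

lemma sum_bcontfun_apply: "(\<Sum>i\<in>I. f i) x = (\<Sum>i\<in>I. f i x)"
  for f :: "'i \<Rightarrow> 'a::topological_space \<Rightarrow>\<^sub>C 'b::real_normed_vector"
  by (induction I rule: infinite_finite_induct) auto

lemma bounded_linear_bcontfun_apply:
  "bounded_linear (\<lambda>f :: 'a::topological_space \<Rightarrow>\<^sub>C 'b::real_normed_vector. f x)"
  by (rule bounded_linear_intro[where K = 1]) (simp_all add: norm_bounded)

lemma Bcontfun_apply:
  fixes f :: "'a::topological_space \<Rightarrow> 'b::metric_space"
  assumes "compact (UNIV :: 'a set)" "continuous_on UNIV f"
  shows "apply_bcontfun (Bcontfun f) = f"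
  using assms by (intro Bcontfun_inverse) (auto simp: bcontfun_def intro: compact_imp_bounded compact_continuous_image)

lemma cblinfun_add_right: "cblinfun_apply f (x + y) = f x + f y"
  and cblinfun_diff_right: "cblinfun_apply f (x - y) = f x - f y"
  and cblinfun_scaleR_right: "cblinfun_apply f (r *\<^sub>R x) = r *\<^sub>R f x"
  and cblinfun_zero_right [simp]: "cblinfun_apply f 0 = 0"
  by (transfer, simp add: blinfun.bilinear_simps)+

lemma cblinfun_scaleC_right: "cblinfun_apply f (c *\<^sub>C x) = c *\<^sub>C f x"
  by transfer simp

lemma cblinfun_sum_right: "cblinfun_apply f (\<Sum>i\<in>I. g i) = (\<Sum>i\<in>I. f (g i))"
  by (induction I rule: infinite_finite_induct) (auto simp: cblinfun_add_right)

lemma norm_cblinfun_apply: "norm (cblinfun_apply f x) \<le> norm f * norm x"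
  by transfer (rule norm_blinfun)

lemma bounded_linear_cblinfun_apply: "bounded_linear (cblinfun_apply f)"
  by (transfer, rule blinfun.bounded_linear_right)

lemma continuous_on_cblinfun_apply [continuous_intros]:
  "continuous_on S g \<Longrightarrow> continuous_on S (\<lambda>x. cblinfun_apply f (g x))"
  by (rule bounded_linear.continuous_on[OF bounded_linear_cblinfun_apply])

lemma continuous_on_scaleC [continuous_intros]:
  fixes g :: "'a::topological_space \<Rightarrow> 'b::complex_normed_vector"
  assumes "continuous_on S c" "continuous_on S g"
  shows "continuous_on S (\<lambda>x. c x *\<^sub>C g x)"
proof -
  have "bounded_bilinear (\<lambda>c (x::'b). c *\<^sub>C x)"
    by standard (auto simp: scaleC_add_left scaleC_add_right scaleR_scaleC_commute norm_scaleC
        mult.commute[of a "complex_of_real r" for a r] scaleC_of_real[symmetric] scaleC_scaleC scaleC_complex_def intro!: exI[of _ 1])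
  from bounded_bilinear.continuous_on[OF this assms] show ?thesis .
qed

lemma cblinfun_add_left [simp]: "cblinfun_apply (f + g) x = f x + g x"
  and cblinfun_diff_left [simp]: "cblinfun_apply (f - g) x = f x - g x"
  and cblinfun_zero_left [simp]: "cblinfun_apply 0 x = 0"
  by (transfer, simp add: blinfun.bilinear_simps)+

lemma cblinfun_scaleC_left [simp]: "cblinfun_apply (c *\<^sub>C f) x = c *\<^sub>C f x"
  by transfer (rule Blinfun_scaleC_apply)

lemma cblinfun_sum_left: "cblinfun_apply (\<Sum>i\<in>I. f i) x = (\<Sum>i\<in>I. f i x)"
  by (induction I rule: infinite_finite_induct) auto

lemma norm_cblinfun_bound:
  "0 \<le> b \<Longrightarrow> (\<And>x. norm (cblinfun_apply f x) \<le> b * norm x) \<Longrightarrow> norm f \<le> b"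
  by transfer (rule norm_blinfun_bound)

lemma ex_cblinfun:
  fixes f :: "'a::complex_normed_vector \<Rightarrow> 'b::complex_normed_vector"
  assumes add: "\<And>x y. f (x + y) = f x + f y" and scale: "\<And>c x. f (c *\<^sub>C x) = c *\<^sub>C f x"
    and bound: "\<And>x. norm (f x) \<le> b * norm x"
  shows "\<exists>F. cblinfun_apply F = f"
proof -
  have "bounded_linear f"
    using bound by (intro bounded_linear_intro[where K = b])
      (auto simp: add scale scaleC_of_real[symmetric] mult.commute)
  then show ?thesis
    by (intro exI[of _ "Abs_cblinfun (Blinfun f)"] ext)
      (simp add: cblinfun_apply.rep_eq Abs_cblinfun_inverse bounded_linear_Blinfun_apply scale)
qed

subsection \<open>The Hahn-Banach theorem\<close>

text \<open>Domination by the norm is part of the notion: with subadditivity it forces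
  \<open>- norm x \<le> p x\<close>, which keeps all the infima formed below finite.\<close>

definition sublinear :: "('a::real_normed_vector \<Rightarrow> real) \<Rightarrow> bool"
  where "sublinear p \<longleftrightarrow> (\<forall>x y. p (x + y) \<le> p x + p y) \<and>
    (\<forall>t\<ge>0. \<forall>x. p (t *\<^sub>R x) = t * p x) \<and> (\<forall>x. p x \<le> norm x)"

lemma sublinear_lower: "sublinear p \<Longrightarrow> - norm x \<le> p x"
proof -
  assume p: "sublinear p"
  have "p 0 = 0" using p unfolding sublinear_def by (metis mult_zero_left order_refl scaleR_zero_left)
  then have "0 \<le> p x + p (- x)" using p unfolding sublinear_def by (metis add.right_inverse)
  moreover have "p (- x) \<le> norm x" using p unfolding sublinear_def by (metis norm_minus_cancel)
  ultimately show ?thesis by simp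
qed

text \<open>An inequality for positive \<open>t\<close> is enough, since applying it to
  \<open>inverse t\<close> gives the reverse one.\<close>

lemma sublinearI:
  fixes p :: "'a::real_normed_vector \<Rightarrow> real"
  assumes add: "\<And>x y. p (x + y) \<le> p x + p y"
    and scale: "\<And>t x. 0 < t \<Longrightarrow> p (t *\<^sub>R x) \<le> t * p x"
    and le: "\<And>x. p x \<le> norm x"
  shows "sublinear p"
proof -
  have eq: "p (t *\<^sub>R x) = t * p x" if "0 < t" for t x
  proof -
    have "p ((inverse t) *\<^sub>R (t *\<^sub>R x)) \<le> inverse t * p (t *\<^sub>R x)"
      using that by (intro scale) simp
    then have "t * p x \<le> p (t *\<^sub>R x)" using that by (simp add: field_simps)
    then show ?thesis using scale[OF that, of x] by simp
  qed
  have "p 0 = 0" using le[of 0] add[of 0 0] by simp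
  then show ?thesis using eq add le unfolding sublinear_def by (metis le_less mult_zero_left scaleR_zero_left)
qed

text \<open>Shifting in a direction \<open>y\<close> makes a sublinear functional smaller; a minimal one is fixed by
  all shifts and therefore linear.\<close>

definition shift_inf :: "('a::real_normed_vector \<Rightarrow> real) \<Rightarrow> 'a \<Rightarrow> 'a \<Rightarrow> real"
  where "shift_inf p y x = (INF t\<in>{0..}. p (x + t *\<^sub>R y) - t * p y)"

lemma shift_inf_le:
  assumes p: "sublinear p" and t: "0 \<le> t"
  shows "shift_inf p y x \<le> p (x + t *\<^sub>R y) - t * p y"
proof -
  \<comment> \<open>Subadditivity on \<open>s y = (x + s y) + (- x)\<close> bounds the family below,
    so the infimum is a genuine one.\<close>
  have "- norm x \<le> p (x + s *\<^sub>R y) - s * p y" if "0 \<le> s" for s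
  proof -
    have "s * p y = p ((x + s *\<^sub>R y) + (- x))" using p that by (simp add: sublinear_def)
    also have "\<dots> \<le> p (x + s *\<^sub>R y) + p (- x)" using p unfolding sublinear_def by blast
    also have "p (- x) \<le> norm x" using p unfolding sublinear_def by (metis norm_minus_cancel)
    finally show ?thesis by simp
  qed
  then have "bdd_below ((\<lambda>t. p (x + t *\<^sub>R y) - t * p y) ` {0..})"
    by (auto intro!: bdd_belowI)
  then show ?thesis unfolding shift_inf_def using t by (intro cINF_lower) auto
qed

lemma sublinear_shift_inf:
  fixes p :: "'a::real_normed_vector \<Rightarrow> real"
  assumes p: "sublinear p"
  shows "sublinear (shift_inf p y)"
proof (rule sublinearI)
  have least: "b \<le> shift_inf p y x"
    if "\<And>t. 0 \<le> t \<Longrightarrow> b \<le> p (x + t *\<^sub>R y) - t * p y" for b x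
    unfolding shift_inf_def using that by (intro cINF_greatest) auto
  fix x z :: 'a
  \<comment> \<open>Parameters \<open>s\<close> for \<open>x\<close> and \<open>t\<close> for
    \<open>z\<close> are matched by the parameter \<open>s + t\<close> for
    \<open>x + z\<close>.\<close>
  have "shift_inf p y (x + z) - (p (x + s *\<^sub>R y) - s * p y) \<le> p (z + t *\<^sub>R y) - t * p y"
    if "0 \<le> s" "0 \<le> t" for s t
  proof -
    have "shift_inf p y (x + z) \<le> p ((x + z) + (s + t) *\<^sub>R y) - (s + t) * p y"
      using that by (intro shift_inf_le p) auto
    also have "(x + z) + (s + t) *\<^sub>R y = (x + s *\<^sub>R y) + (z + t *\<^sub>R y)" by (simp add: algebra_simps)
    also have "p \<dots> \<le> p (x + s *\<^sub>R y) + p (z + t *\<^sub>R y)" using p unfolding sublinear_def by blast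
    finally show ?thesis by (simp add: algebra_simps)
  qed
  then have "shift_inf p y (x + z) - (p (x + s *\<^sub>R y) - s * p y) \<le> shift_inf p y z" if "0 \<le> s" for s
    using that by (intro least) auto
  then have "shift_inf p y (x + z) - shift_inf p y z \<le> shift_inf p y x"
    by (intro least) (simp add: algebra_simps)
  then show "shift_inf p y (x + z) \<le> shift_inf p y x + shift_inf p y z" by simp
  show "shift_inf p y (t *\<^sub>R x) \<le> t * shift_inf p y x" if "0 < t" for t
  proof -
    have "shift_inf p y (t *\<^sub>R x) / t \<le> p (x + s *\<^sub>R y) - s * p y" if "0 \<le> s" for s
    proof -
      have "shift_inf p y (t *\<^sub>R x) \<le> p (t *\<^sub>R x + (t * s) *\<^sub>R y) - (t * s) * p y"
        using \<open>0 < t\<close> \<open>0 \<le> s\<close> by (intro shift_inf_le p) auto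
      also have "t *\<^sub>R x + (t * s) *\<^sub>R y = t *\<^sub>R (x + s *\<^sub>R y)" by (simp add: algebra_simps)
      also have "p \<dots> = t * p (x + s *\<^sub>R y)" using p \<open>0 < t\<close> unfolding sublinear_def by simp
      finally show ?thesis using \<open>0 < t\<close> by (simp add: field_simps)
    qed
    then have "shift_inf p y (t *\<^sub>R x) / t \<le> shift_inf p y x" by (rule least)
    then show ?thesis using that by (simp add: field_simps)
  qed
  have "shift_inf p y x \<le> p x" using shift_inf_le[OF p, of 0 y x] by simp
  also have "\<dots> \<le> norm x" using p unfolding sublinear_def by blast
  finally show "shift_inf p y x \<le> norm x" .
qed

text \<open>In a chain, two members \<open>p\<close> and \<open>q\<close> can be replaced by the
  smaller one \<open>r\<close>, so \<open>p x + q y\<close> dominates \<open>r (x + y)\<close>; for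
  arbitrary families the infimum need not be subadditive.\<close>

lemma sublinear_INF_chain:
  fixes P :: "('a::real_normed_vector \<Rightarrow> real) set"
  assumes ne: "P \<noteq> {}" and sub: "\<And>p. p \<in> P \<Longrightarrow> sublinear p"
    and chain: "\<And>p q. p \<in> P \<Longrightarrow> q \<in> P \<Longrightarrow> p \<le> q \<or> q \<le> p"
  shows "sublinear (\<lambda>x. INF p\<in>P. p x)" and "p \<in> P \<Longrightarrow> (INF p\<in>P. p x) \<le> p x"
proof -
  have bdd: "bdd_below ((\<lambda>p. p x) ` P)" for x
    using sublinear_lower[OF sub] by (auto intro!: bdd_belowI)
  have lower: "(INF p\<in>P. p x) \<le> p x" if "p \<in> P" for p x
    using bdd that by (rule cINF_lower)
  then show "p \<in> P \<Longrightarrow> (INF p\<in>P. p x) \<le> p x" .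
  show "sublinear (\<lambda>x. INF p\<in>P. p x)"
  proof (rule sublinearI)
    fix x y :: 'a
    have "(INF p\<in>P. p (x + y)) - p x \<le> q y" if "p \<in> P" "q \<in> P" for p q
    proof -
      have "\<exists>r\<in>P. r \<le> p \<and> r \<le> q" using chain[OF that] that by auto
      then obtain r where r: "r \<in> P" "r \<le> p" "r \<le> q" by blast
      have "(INF p\<in>P. p (x + y)) \<le> r (x + y)" using r(1) by (rule lower)
      also have "\<dots> \<le> r x + r y" using sub[OF r(1)] unfolding sublinear_def by blast
      also have "\<dots> \<le> p x + q y" using r(2,3) by (intro add_mono) (auto simp: le_fun_def)
      finally show ?thesis by simp
    qed
    then have "(INF p\<in>P. p (x + y)) - p x \<le> (INF p\<in>P. p y)" if "p \<in> P" for p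
      using ne that by (intro cINF_greatest) auto
    then have "(INF p\<in>P. p (x + y)) - (INF p\<in>P. p y) \<le> (INF p\<in>P. p x)"
      using ne by (intro cINF_greatest) (auto simp: algebra_simps)
    then show "(INF p\<in>P. p (x + y)) \<le> (INF p\<in>P. p x) + (INF p\<in>P. p y)" by simp
    show "(INF p\<in>P. p (t *\<^sub>R x)) \<le> t * (INF p\<in>P. p x)" if "0 < t" for t
    proof -
      have "(INF p\<in>P. p (t *\<^sub>R x)) / t \<le> q x" if "q \<in> P" for q
      proof -
        have "(INF p\<in>P. p (t *\<^sub>R x)) \<le> q (t *\<^sub>R x)" using that by (rule lower)
        also have "\<dots> = t * q x" using sub[OF that] \<open>0 < t\<close> unfolding sublinear_def by simp
        finally show ?thesis using \<open>0 < t\<close> by (simp add: field_simps)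
      qed
      then have "(INF p\<in>P. p (t *\<^sub>R x)) / t \<le> (INF p\<in>P. p x)" using ne by (intro cINF_greatest) auto
      then show ?thesis using that by (simp add: field_simps)
    qed
    obtain p where p: "p \<in> P" using ne by blast
    show "(INF p\<in>P. p x) \<le> norm x"
      using lower[OF p, of x] sub[OF p] unfolding sublinear_def by (meson order_trans)
  qed
qed

lemma ex_minimal_sublinear:
  fixes p\<^sub>0 :: "'a::real_normed_vector \<Rightarrow> real"
  assumes p0: "sublinear p\<^sub>0"
  shows "\<exists>p. sublinear p \<and> p \<le> p\<^sub>0 \<and> (\<forall>q. sublinear q \<longrightarrow> q \<le> p \<longrightarrow> q = p)"
proof -
  let ?A = "{p. sublinear p \<and> p \<le> p\<^sub>0}"
  have "\<exists>p\<in>?A. \<forall>q\<in>?A. q \<le> p \<longrightarrow> q = p"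
  proof (rule predicate_Zorn[where P = "\<lambda>p q. q \<le> p"])
    show "partial_order_on ?A (relation_of (\<lambda>p q. q \<le> p) ?A)"
      by (rule partial_order_on_relation_ofI) auto
    fix C assume C: "C \<in> Chains (relation_of (\<lambda>p q. q \<le> p) ?A)"
    then have sub: "p \<in> ?A" if "p \<in> C" for p
      using that by (auto simp: Chains_def relation_of_def)
    have chain: "p \<le> q \<or> q \<le> p" if "p \<in> C" "q \<in> C" for p q
      using C that by (auto simp: Chains_def relation_of_def)
    show "\<exists>u\<in>?A. \<forall>a\<in>C. u \<le> a"
    proof (cases "C = {}")
      case True
      then show ?thesis using p0 by auto
    next
      case False
      define u where "u = (\<lambda>x. INF p\<in>C. p x)"
      have "sublinear u" unfolding u_def
        using False sub chain by (intro sublinear_INF_chain) auto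
      moreover have le: "u \<le> p" if "p \<in> C" for p
        unfolding u_def le_fun_def
        using sublinear_INF_chain(2)[of C p] False sub chain that by auto
      moreover have "u \<le> p\<^sub>0"
        using False le sub by (metis (mono_tags, lifting) all_not_in_conv mem_Collect_eq order_trans)
      ultimately show ?thesis by auto
    qed
  qed
  then show ?thesis by (auto intro: order_trans)
qed

lemma hahn_banach_real:
  fixes x\<^sub>0 :: "'a::real_normed_vector"
  obtains r where "linear r" "\<And>x. r x \<le> norm x" "r x\<^sub>0 = norm x\<^sub>0"
proof -
  have n: "sublinear (norm :: 'a \<Rightarrow> real)"
    by (rule sublinearI) (auto intro: norm_triangle_ineq)
  \<comment> \<open>Minimality below the norm alone would not fix the value at
    \<open>x\<^sub>0\<close>. Below the norm shifted in the direction \<open>x\<^sub>0\<close>, the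
    choice t = 1 yields \<open>p (- x\<^sub>0) \<le> - norm x\<^sub>0\<close>.\<close>
  obtain p where p: "sublinear p" "p \<le> shift_inf norm x\<^sub>0"
    and min: "\<And>q. sublinear q \<Longrightarrow> q \<le> p \<Longrightarrow> q = p"
    using ex_minimal_sublinear[OF sublinear_shift_inf[OF n]] by blast
  have fixed: "shift_inf p y = p" for y
    by (rule min[OF sublinear_shift_inf[OF p(1)]])
      (use shift_inf_le[OF p(1), of 0 y] in \<open>auto simp: le_fun_def\<close>)
  \<comment> \<open>Being fixed by the shift gives, at t = 1,
    \<open>p x \<le> p (x + y) - p y\<close>: superadditivity, next to the given
    subadditivity.\<close>
  have add: "p (x + y) = p x + p y" for x y
    using shift_inf_le[OF p(1), of 1 y x] p(1) unfolding fixed sublinear_def by (fastforce intro: antisym)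
  have p0: "p 0 = 0" using add[of 0 0] by simp
  have neg: "p (- x) = - p x" for x using add[of x "- x"] p0 by simp
  have "p (t *\<^sub>R x) = t * p x" for t x
  proof (cases "0 \<le> t")
    case True
    then show ?thesis using p(1) by (simp add: sublinear_def)
  next
    case False
    then have "p ((- t) *\<^sub>R x) = (- t) * p x" using p(1) by (simp add: sublinear_def del: scaleR_minus_left)
    then show ?thesis using neg[of "(- t) *\<^sub>R x"] by simp
  qed
  then have "linear p" by (intro linearI) (auto simp: add)
  moreover have le: "p x \<le> norm x" for x using p(1) by (simp add: sublinear_def)
  moreover have "p (- x\<^sub>0) \<le> - norm x\<^sub>0"
    using p(2) shift_inf_le[OF n, of 1 x\<^sub>0 "- x\<^sub>0"] by (auto simp: le_fun_def intro: order_trans)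
  then have "p x\<^sub>0 = norm x\<^sub>0" using neg[of x\<^sub>0] le[of x\<^sub>0] by simp
  ultimately show ?thesis using that by blast
qed

theorem hahn_banach:
  fixes x\<^sub>0 :: "'a::complex_normed_vector"
  obtains x' :: "'a cdual" where "norm x' \<le> 1" "x' x\<^sub>0 = of_real (norm x\<^sub>0)"
proof -
  obtain r where r: "linear r" and le: "\<And>x. r x \<le> norm x" and r0: "r x\<^sub>0 = norm x\<^sub>0"
    using hahn_banach_real[of x\<^sub>0] by blast
  note rl = linear_add[OF r] linear_cmul[OF r]
  have c_eq: "c *\<^sub>C x = Re c *\<^sub>R x + Im c *\<^sub>R (\<i> *\<^sub>C x)" for c and x :: 'a
    unfolding scaleC_of_real[symmetric] scaleC_scaleC scaleC_add_left[symmetric]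
    by (simp add: complex_eq[symmetric] mult.commute)
  have ii: "\<i> *\<^sub>C \<i> *\<^sub>C x = - x" for x :: 'a
    using scaleC_of_real[of "-1" x] by (simp add: scaleC_scaleC)
  \<comment> \<open>The complex-linear functional whose real part is \<open>r\<close>.\<close>
  define g where "g x = Complex (r x) (- r (\<i> *\<^sub>C x))" for x
  have g_add: "g (x + y) = g x + g y" for x y
    by (simp add: g_def complex_eq_iff rl scaleC_add_right)
  have g_scale: "g (c *\<^sub>C x) = c *\<^sub>C g x" for c x
    unfolding scaleC_complex_def
    by (subst (1) c_eq)
      (simp add: g_def complex_eq_iff rl scaleC_add_right scaleR_scaleC_commute ii linear_neg[OF r] linear_diff[OF r] algebra_simps)
  have bound: "cmod (g x) \<le> 1 * norm x" for x
  proof (cases "g x = 0")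
    case False
    \<comment> \<open>Rotating \<open>x\<close> makes the value of \<open>g\<close> real and
      nonnegative, hence a value of \<open>r\<close>.\<close>
    define c where "c = cnj (sgn (g x))"
    have c: "cmod c = 1" using False by (simp add: c_def norm_sgn)
    have "c * g x = of_real (cmod (g x))"
      using False by (simp add: c_def sgn_div_norm scaleR_conv_of_real field_simps complex_norm_square[symmetric] power2_eq_square)
    then have "cmod (g x) = Re (g (c *\<^sub>C x))"
      by (simp add: g_scale scaleC_complex_def)
    also have "\<dots> \<le> norm (c *\<^sub>C x)" by (simp add: g_def le)
    finally show ?thesis using c by (simp add: norm_scaleC)
  qed simp
  obtain F where F: "cblinfun_apply F = g" using ex_cblinfun[of g 1] g_add g_scale bound by auto
  have "norm F \<le> 1" by (rule norm_cblinfun_bound) (use bound in \<open>auto simp: F\<close>)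
  \<comment> \<open>The real part \<open>norm x\<^sub>0\<close> already exhausts the bound on the
    modulus.\<close>
  have "Im (g x\<^sub>0) = 0"
  proof -
    have "(cmod (g x\<^sub>0))\<^sup>2 \<le> (norm x\<^sub>0)\<^sup>2" using bound[of x\<^sub>0] by (intro power_mono) auto
    then show ?thesis by (simp add: cmod_power2) (simp add: g_def r0)
  qed
  then have "F x\<^sub>0 = of_real (norm x\<^sub>0)" by (simp add: F complex_eq_iff) (simp add: g_def r0)
  with \<open>norm F \<le> 1\<close> show ?thesis using that by blast
qed

lemma cdual_separates:
  fixes x y :: "'a::complex_normed_vector"
  assumes "\<And>x' :: 'a cdual. x' x = x' y"
  shows "x = y"
proof -
  obtain x' :: "'a cdual" where "x' (x - y) = of_real (norm (x - y))" using hahn_banach by metis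
  then show ?thesis using assms[of x'] by (simp add: cblinfun_diff_right)
qed

lemma norm_le_cdual:
  fixes x :: "'a::complex_normed_vector"
  assumes "\<And>x' :: 'a cdual. norm x' \<le> 1 \<Longrightarrow> cmod (cblinfun_apply x' x) \<le> b"
  shows "norm x \<le> b"
proof -
  obtain x' :: "'a cdual" where "norm x' \<le> 1" "x' x = of_real (norm x)" using hahn_banach by metis
  then show ?thesis using assms[of x'] by simp
qed

subsection \<open>Weak integrals of continuous functions\<close>

text \<open>\<open>d t i\<close> stands for a distance from \<open>t\<close> to the anchor
  \<open>i\<close>, chosen afresh in each application; its sublevel sets replace metric balls. The
  bumps \<open>max 0 (e - d t i)\<close> are divided by their sum, which a finite subcover makes
  positive.\<close>

lemma partition_of_unity:
  fixes d :: "'a::topological_space \<Rightarrow> 'a \<Rightarrow> real"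
  assumes cpt: "compact (UNIV :: 'a set)" and cont: "\<And>i. continuous_on UNIV (\<lambda>t. d t i)"
    and zero: "\<And>i. d i i = 0" and "0 < e"
  obtains I :: "'a set" and \<phi> :: "'a \<Rightarrow> 'a \<Rightarrow> real" where
    "finite I" "\<And>i. continuous_on UNIV (\<phi> i)" "\<And>i t. 0 \<le> \<phi> i t"
    "\<And>t. (\<Sum>i\<in>I. \<phi> i t) = 1" "\<And>i t. \<phi> i t \<noteq> 0 \<Longrightarrow> d t i < e"
proof -
  obtain I where I: "finite I" "UNIV = (\<Union>i\<in>I. {t. d t i < e})"
  proof (rule compactE_image[OF cpt, of UNIV "\<lambda>i. {t. d t i < e}"])
    show "open {t. d t i < e}" for i
      using cont by (intro open_Collect_less) auto
    show "UNIV \<subseteq> (\<Union>i\<in>UNIV. {t. d t i < e})" using zero \<open>0 < e\<close> by auto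
  qed (use that in auto)
  define s where "s t = (\<Sum>i\<in>I. max 0 (e - d t i))" for t
  have s_pos: "0 < s t" for t
  proof -
    obtain i where "i \<in> I" "d t i < e" using I(2) by blast
    then show ?thesis unfolding s_def using I(1) by (intro sum_pos2[of I i]) auto
  qed
  show ?thesis
  proof (rule that[of I "\<lambda>i t. max 0 (e - d t i) / s t"])
    show "continuous_on UNIV (\<lambda>t. max 0 (e - d t i) / s t)" for i
      using s_pos cont unfolding s_def by (intro continuous_intros) (auto simp: less_imp_neq[symmetric])
    show "(\<Sum>i\<in>I. max 0 (e - d t i) / s t) = 1" for t
      using s_pos[of t] by (simp add: sum_divide_distrib[symmetric] s_def[symmetric])
  qed (use I(1) s_pos in \<open>auto simp: less_imp_le max_def split: if_splits\<close>)
qed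

lemma cmeasure_integral_bound:
  fixes \<mu> :: "'g::topological_space cmeasure"
  assumes "compact (UNIV :: 'g set)" "continuous_on UNIV \<phi>" "\<And>t. cmod (\<phi> t) \<le> b"
  shows "cmod (cmeasure_integral \<mu> \<phi>) \<le> norm \<mu> * b"
proof -
  have "cmod (cmeasure_integral \<mu> \<phi>) \<le> norm \<mu> * norm (Bcontfun \<phi>)"
    unfolding cmeasure_integral_def by (rule norm_cblinfun_apply)
  also have "\<dots> \<le> norm \<mu> * b"
    using assms(3) by (intro mult_left_mono norm_bound) (auto simp: Bcontfun_apply[OF assms(1,2)])
  finally show ?thesis .
qed

text \<open>Riemann sums over partitions of unity approximate the integral uniformly over the dual unit
  ball, hence form a Cauchy sequence.\<close>

lemma ex_weak_integral:
  fixes F :: "'g::topological_space \<Rightarrow> 'x::complex_banach" and \<mu> :: "'g cmeasure"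
  assumes cpt: "compact (UNIV :: 'g set)" and F: "continuous_on UNIV F"
  shows "\<exists>x. \<forall>x' :: 'x cdual. x' x = cmeasure_integral \<mu> (\<lambda>t. x' (F t))"
proof -
  let ?J = "\<lambda>x'. cmeasure_integral \<mu> (\<lambda>t. cblinfun_apply x' (F t))"
  have approx: "\<exists>x. \<forall>x' :: 'x cdual. cmod (cblinfun_apply x' x - ?J x') \<le> norm \<mu> * (norm x' * e)"
    if "0 < e" for e
  proof -
    have c: "continuous_on UNIV (\<lambda>t. norm (F t - F i))" for i
      by (intro continuous_intros F)
    have z: "norm (F i - F i) = 0" for i by simp
    obtain I :: "'g set" and \<phi> :: "'g \<Rightarrow> 'g \<Rightarrow> real" where I: "finite I"
      and \<phi>: "\<And>i. continuous_on UNIV (\<phi> i)" "\<And>i t. 0 \<le> \<phi> i t" "\<And>t. (\<Sum>i\<in>I. \<phi> i t) = 1"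
        "\<And>i t. \<phi> i t \<noteq> 0 \<Longrightarrow> norm (F t - F i) < e"
      by (rule partition_of_unity[OF cpt c z \<open>0 < e\<close>]) (rule that)
    define h where "h i = Bcontfun (\<lambda>t. complex_of_real (\<phi> i t))" for i
    have h: "apply_bcontfun (h i) = (\<lambda>t. complex_of_real (\<phi> i t))" for i
      unfolding h_def by (intro Bcontfun_apply cpt continuous_intros \<phi>)
    \<comment> \<open>A Riemann sum: \<open>\<mu> (h i)\<close> is the mass of the piece around the
      anchor \<open>i\<close>.\<close>
    define x where "x = (\<Sum>i\<in>I. \<mu> (h i) *\<^sub>C F i)"
    have "cmod (cblinfun_apply x' x - ?J x') \<le> norm \<mu> * (norm x' * e)" for x' :: "'x cdual"
    proof -
      define k where "k = Bcontfun (\<lambda>t. x' (F t))"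
      have k: "apply_bcontfun k = (\<lambda>t. x' (F t))"
        unfolding k_def by (intro Bcontfun_apply cpt continuous_intros F)
      have x'x: "x' x = \<mu> (\<Sum>i\<in>I. x' (F i) *\<^sub>C h i)"
        by (simp add: x_def cblinfun_sum_right cblinfun_scaleC_right scaleC_complex_def mult.commute)
      have "x' x - ?J x' = \<mu> ((\<Sum>i\<in>I. x' (F i) *\<^sub>C h i) - k)"
        unfolding x'x cmeasure_integral_def k_def[symmetric] by (simp add: cblinfun_diff_right)
      also have "cmod \<dots> \<le> norm \<mu> * norm ((\<Sum>i\<in>I. x' (F i) *\<^sub>C h i) - k)"
        by (rule norm_cblinfun_apply)
      also have "norm ((\<Sum>i\<in>I. x' (F i) *\<^sub>C h i) - k) \<le> norm x' * e"
      proof (rule norm_bound)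
        fix t
        have "((\<Sum>i\<in>I. x' (F i) *\<^sub>C h i) - k) t = (\<Sum>i\<in>I. \<phi> i t *\<^sub>R x' (F i)) - (\<Sum>i\<in>I. \<phi> i t) *\<^sub>R x' (F t)"
          by (simp add: sum_bcontfun_apply h k \<phi>(3) scaleC_complex_def scaleR_conv_of_real mult.commute)
        also have "\<dots> = (\<Sum>i\<in>I. \<phi> i t *\<^sub>R x' (F i - F t))"
          by (simp add: scaleR_sum_left sum_subtractf[symmetric] cblinfun_diff_right scaleR_diff_right del: scaleR_conv_of_real)
        also have "norm \<dots> \<le> (\<Sum>i\<in>I. \<phi> i t * (norm x' * e))"
        proof (rule sum_norm_le)
          fix i assume "i \<in> I"
          show "norm (\<phi> i t *\<^sub>R x' (F i - F t)) \<le> \<phi> i t * (norm x' * e)"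
          proof (cases "\<phi> i t = 0")
            case False
            have "cmod (x' (F i - F t)) \<le> norm x' * norm (F i - F t)" by (rule norm_cblinfun_apply)
            also have "\<dots> \<le> norm x' * e"
              using \<phi>(4)[OF False] by (intro mult_left_mono) (auto simp: norm_minus_commute)
            finally show ?thesis using \<phi>(2)[of i t] by (auto intro: mult_left_mono)
          qed simp
        qed
        also have "\<dots> = norm x' * e" using \<phi>(3) by (simp add: sum_distrib_right[symmetric])
        finally show "norm (((\<Sum>i\<in>I. x' (F i) *\<^sub>C h i) - k) t) \<le> norm x' * e" .
      qed
      finally show ?thesis by (simp add: mult_left_mono)
    qed
    then show ?thesis by blast
  qed
  have "\<exists>x. \<forall>x' :: 'x cdual. cmod (cblinfun_apply x' x - ?J x') \<le> norm \<mu> * (norm x' * inverse (real (Suc n)))" for n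
    by (rule approx) simp
  then obtain X where X: "\<And>n x'. cmod (cblinfun_apply x' (X n) - ?J x') \<le> norm \<mu> * (norm x' * inverse (real (Suc n)))"
    by metis
  have null: "(\<lambda>n. c * inverse (real (Suc n))) \<longlonglongrightarrow> 0" for c
    by (intro tendsto_mult_right_zero LIMSEQ_inverse_real_of_nat)
  have dist: "norm (X i - X j) \<le> norm \<mu> * inverse (real (Suc i)) + norm \<mu> * inverse (real (Suc j))" for i j
  proof (rule norm_le_cdual)
    fix x' :: "'x cdual" assume x': "norm x' \<le> 1"
    have le: "cmod (cblinfun_apply x' (X n) - ?J x') \<le> norm \<mu> * inverse (real (Suc n))" for n
    proof -
      have "norm \<mu> * (norm x' * inverse (real (Suc n))) \<le> norm \<mu> * (1 * inverse (real (Suc n)))"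
        using x' by (intro mult_left_mono mult_right_mono) auto
      then show ?thesis using X[of x' n] by simp
    qed
    have "cmod (cblinfun_apply x' (X i - X j)) = cmod ((cblinfun_apply x' (X i) - ?J x') - (cblinfun_apply x' (X j) - ?J x'))"
      by (simp add: cblinfun_diff_right)
    also have "\<dots> \<le> cmod (cblinfun_apply x' (X i) - ?J x') + cmod (cblinfun_apply x' (X j) - ?J x')" by (rule norm_triangle_ineq4)
    finally show "cmod (cblinfun_apply x' (X i - X j)) \<le> norm \<mu> * inverse (real (Suc i)) + norm \<mu> * inverse (real (Suc j))"
      using le[of i] le[of j] by linarith
  qed
  have "Cauchy X"
  proof (rule metric_CauchyI)
    fix e :: real assume "0 < e"
    then have "\<forall>\<^sub>F n in sequentially. norm \<mu> * inverse (real (Suc n)) < e / 2"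
      using null[of "norm \<mu>"] by (intro order_tendstoD(2)) auto
    then obtain N where N: "\<And>n. N \<le> n \<Longrightarrow> norm \<mu> * inverse (real (Suc n)) < e / 2"
      by (auto simp: eventually_sequentially)
    show "\<exists>M. \<forall>m\<ge>M. \<forall>n\<ge>M. dist (X m) (X n) < e"
    proof (intro exI allI impI)
      fix i j assume "N \<le> i" "N \<le> j"
      then show "dist (X i) (X j) < e" using dist[of i j] N[of i] N[of j] unfolding dist_norm by linarith
    qed
  qed
  then obtain x where x: "X \<longlonglongrightarrow> x" using Cauchy_convergent_iff convergent_def by blast
  have "cblinfun_apply x' x = ?J x'" for x' :: "'x cdual"
  proof (rule LIMSEQ_unique)
    show "(\<lambda>n. cblinfun_apply x' (X n)) \<longlonglongrightarrow> x' x" by (rule bounded_linear.tendsto[OF bounded_linear_cblinfun_apply x])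
    show "(\<lambda>n. cblinfun_apply x' (X n)) \<longlonglongrightarrow> ?J x'"
    proof (rule LIM_zero_cancel, rule Lim_null_comparison[OF _ null])
      show "\<forall>\<^sub>F n in sequentially. norm (cblinfun_apply x' (X n) - ?J x') \<le> (norm \<mu> * norm x') * inverse (real (Suc n))"
        using X by (simp add: mult.assoc)
    qed
  qed
  then show ?thesis by blast
qed

lemma weak_integral_eqI:
  fixes F :: "'g \<Rightarrow> 'x::complex_banach"
  assumes "\<And>x' :: 'x cdual. x' x = I (\<lambda>t. x' (F t))"
  shows "weak_integral I F = x"
  unfolding weak_integral_def using assms by (intro the_equality) (auto intro: cdual_separates)

lemma weak_integral:
  fixes F :: "'g::topological_space \<Rightarrow> 'x::complex_banach" and \<mu> :: "'g cmeasure"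
  assumes "compact (UNIV :: 'g set)" and "continuous_on UNIV F"
  shows "cblinfun_apply x' (weak_integral (cmeasure_integral \<mu>) F) = cmeasure_integral \<mu> (\<lambda>t. x' (F t))"
  using ex_weak_integral[OF assms, of \<mu>] weak_integral_eqI[of _ "cmeasure_integral \<mu>" F] by metis

section \<open>Haar measure and convolution\<close>

locale compact_haar =
  fixes m :: "'g::{topological_ab_group_add, t2_space} measure"
  assumes cpt: "compact (UNIV :: 'g set)" and haar: "normalized_haar_measure m"
begin

lemma sets_m [measurable_cong]: "sets m = sets borel"
  using haar by (simp add: normalized_haar_measure_def)

lemma space_m [simp]: "space m = UNIV"
  using sets_eq_imp_space_eq[OF sets_m] by simp

lemma emeasure_UNIV: "emeasure m UNIV = 1"
  using haar by (simp add: normalized_haar_measure_def)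

sublocale finite_measure m
  by standard (simp add: emeasure_UNIV)

lemma measure_UNIV [simp]: "measure m UNIV = 1"
  by (simp add: measure_def emeasure_UNIV)

lemma measurable_continuous:
  "continuous_on UNIV f \<Longrightarrow> f \<in> borel_measurable m"
  using borel_measurable_continuous_onI measurable_cong_sets[OF sets_m refl] by blast

lemma integrable_continuous [intro]:
  fixes f :: "'g \<Rightarrow> 'b::{banach, second_countable_topology}"
  assumes "continuous_on UNIV f"
  shows "integrable m f"
proof -
  have "bounded (range f)" using compact_imp_bounded[OF compact_continuous_image[OF assms cpt]] .
  then obtain B where "\<And>t. norm (f t) \<le> B" by (auto simp: bounded_iff)
  then show ?thesis
    by (intro integrable_const_bound[of f B] measurable_continuous assms) auto
qed

lemma integral_translate:
  fixes f :: "'g \<Rightarrow> 'b::{banach, second_countable_topology}"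
  assumes f: "continuous_on UNIV f"
  shows "(LINT t|m. f (t + s)) = (LINT t|m. f t)"
proof -
  have meas: "(+) s \<in> measurable m m"
  proof -
    have "(+) s \<in> borel_measurable m"
      by (rule measurable_continuous) (intro continuous_intros)
    then show ?thesis using measurable_cong_sets[OF refl sets_m] by blast
  qed
  have "distr m m ((+) s) = m"
  proof (rule measure_eqI)
    fix A assume "A \<in> sets (distr m m ((+) s))"
    then have A: "A \<in> sets m" by simp
    have "(+) s -` A = (+) (- s) ` A"
    proof (intro set_eqI iffI)
      fix x assume "x \<in> (+) s -` A"
      then show "x \<in> (+) (- s) ` A" by (intro image_eqI[of _ _ "s + x"]) auto
    qed auto
    moreover have "emeasure m ((+) (- s) ` A) = emeasure m A"
      using A haar unfolding normalized_haar_measure_def by blast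
    ultimately show "emeasure (distr m m ((+) s)) A = emeasure m A"
      using A meas by (simp only: emeasure_distr space_m Int_UNIV_right)
  qed simp
  then have "(LINT t|m. f t) = (LINT t|distr m m ((+) s). f t)" by simp
  also have "\<dots> = (LINT t|m. f (s + t))"
    by (rule integral_distr[OF meas measurable_continuous[OF f]])
  finally show ?thesis by (simp add: add.commute)
qed

lemma integral_mono_continuous:
  fixes f g :: "'g \<Rightarrow> real"
  assumes "continuous_on UNIV f" "continuous_on UNIV g" "\<And>t. f t \<le> g t"
  shows "(LINT t|m. f t) \<le> (LINT t|m. g t)"
  using assms by (intro integral_mono) auto

lemma integral_norm_le:
  fixes f :: "'g \<Rightarrow> 'b::{banach, second_countable_topology}"
  assumes "continuous_on UNIV f" "\<And>t. norm (f t) \<le> b"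
  shows "norm (LINT t|m. f t) \<le> b"
proof -
  have "norm (LINT t|m. f t) \<le> (LINT t|m. norm (f t))" by (rule integral_norm_bound)
  also have "\<dots> \<le> (LINT t|m. b)"
    using assms by (intro integral_mono_continuous continuous_intros) auto
  finally show ?thesis by simp
qed

text \<open>Finitely many translates of a nonempty open set cover the group, so it has positive measure.\<close>

lemma integral_pos:
  fixes f :: "'g \<Rightarrow> real"
  assumes f: "continuous_on UNIV f" and nonneg: "\<And>t. 0 \<le> f t" and pos: "0 < f t\<^sub>0"
  shows "0 < (LINT t|m. f t)"
proof -
  let ?U = "\<lambda>s. {t. f t\<^sub>0 / 2 < f (t + s)}"
  have fs: "continuous_on UNIV (\<lambda>t. f (t + s))" for s
    by (rule continuous_on_compose2[OF f]) (auto intro!: continuous_intros)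
  obtain I where I: "finite I" "UNIV \<subseteq> (\<Union>s\<in>I. ?U s)"
  proof (rule compactE_image[OF cpt, of UNIV ?U])
    show "open (?U s)" for s
      by (intro open_Collect_less continuous_intros fs)
    show "UNIV \<subseteq> (\<Union>s\<in>UNIV. ?U s)"
    proof
      fix t
      have "t \<in> ?U (t\<^sub>0 - t)" using pos by simp
      then show "t \<in> (\<Union>s\<in>UNIV. ?U s)" by blast
    qed
  qed (use that in auto)
  have "f t\<^sub>0 / 2 = (LINT t|m. f t\<^sub>0 / 2)" by simp
  also have "\<dots> \<le> (LINT t|m. (\<Sum>s\<in>I. f (t + s)))"
  proof (rule integral_mono_continuous)
    fix t
    obtain s where "s \<in> I" "f t\<^sub>0 / 2 < f (t + s)" using I(2) by auto
    moreover from this have "f (t + s) \<le> (\<Sum>s\<in>I. f (t + s))"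
      using I(1) nonneg by (intro member_le_sum) auto
    ultimately show "f t\<^sub>0 / 2 \<le> (\<Sum>s\<in>I. f (t + s))" by simp
  qed (auto intro!: continuous_intros fs)
  also have "\<dots> = (\<Sum>s\<in>I. LINT t|m. f (t + s))"
    by (intro Bochner_Integration.integral_sum integrable_continuous fs)
  also have "\<dots> = card I * (LINT t|m. f t)"
    by (simp add: integral_translate[OF f])
  finally have "0 < card I * (LINT t|m. f t)" using pos by simp
  then show ?thesis by (simp add: zero_less_mult_iff)
qed

subsection \<open>Measures with continuous densities\<close>

text \<open>The measure with density \<phi> relative to \<open>m\<close>. For continuous \<phi> the
  choice is determined, by \<open>dens_apply\<close>; Haar measure itself is
  \<open>dens (\<lambda>_. 1)\<close>.\<close>

definition dens :: "('g \<Rightarrow> complex) \<Rightarrow> 'g cmeasure"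
  where "dens \<phi> = (SOME F. cblinfun_apply F = (\<lambda>h :: 'g \<Rightarrow>\<^sub>C complex. LINT t|m. \<phi> t * h t))"

lemma dens_apply:
  assumes \<phi>: "continuous_on UNIV \<phi>"
  shows "dens \<phi> h = (LINT t|m. \<phi> t * h t)"
    and norm_dens: "norm (dens \<phi>) \<le> (LINT t|m. cmod (\<phi> t))"
proof -
  have c: "continuous_on UNIV (\<lambda>t. \<phi> t * apply_bcontfun h t)" for h :: "'g \<Rightarrow>\<^sub>C complex"
    by (intro continuous_intros \<phi> continuous_on_apply_bcontfun)
  have bound: "cmod (LINT t|m. \<phi> t * h t) \<le> (LINT t|m. cmod (\<phi> t)) * norm h" for h :: "'g \<Rightarrow>\<^sub>C complex"
  proof -
    have "cmod (LINT t|m. \<phi> t * h t) \<le> (LINT t|m. cmod (\<phi> t * h t))" by (rule integral_norm_bound)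
    also have "\<dots> \<le> (LINT t|m. cmod (\<phi> t) * norm h)"
      using \<phi> by (intro integral_mono_continuous continuous_intros c)
        (auto simp: norm_mult intro!: mult_left_mono norm_bounded)
    finally show ?thesis by simp
  qed
  have "\<exists>F. cblinfun_apply F = (\<lambda>h::'g \<Rightarrow>\<^sub>C complex. LINT t|m. \<phi> t * h t)"
  proof (rule ex_cblinfun[OF _ _ bound])
    show "(LINT t|m. \<phi> t * (h + k) t) = (LINT t|m. \<phi> t * h t) + (LINT t|m. \<phi> t * k t)"
      for h k :: "'g \<Rightarrow>\<^sub>C complex"
      by (simp add: distrib_left Bochner_Integration.integral_add integrable_continuous c)
    show "(LINT t|m. \<phi> t * (z *\<^sub>C h) t) = z *\<^sub>C (LINT t|m. \<phi> t * h t)"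
      for z and h :: "'g \<Rightarrow>\<^sub>C complex"
      by (simp add: scaleC_complex_def mult.left_commute)
  qed
  then have ap: "cblinfun_apply (dens \<phi>) = (\<lambda>h. LINT t|m. \<phi> t * h t)"
    unfolding dens_def by (rule someI_ex)
  show "dens \<phi> h = (LINT t|m. \<phi> t * h t)" by (simp add: ap)
  show "norm (dens \<phi>) \<le> (LINT t|m. cmod (\<phi> t))"
    by (rule norm_cblinfun_bound) (use bound ap in auto)
qed

lemma cmeasure_integral_dens:
  assumes "continuous_on UNIV \<phi>" "continuous_on UNIV h"
  shows "cmeasure_integral (dens \<phi>) h = (LINT t|m. \<phi> t * h t)"
  by (simp add: cmeasure_integral_def dens_apply assms Bcontfun_apply cpt)

lemma fourier_coeff_dual:
  fixes f :: "'g \<Rightarrow>\<^sub>C 'x::complex_banach"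
  assumes \<gamma>: "continuous_on UNIV \<gamma>"
  shows "cblinfun_apply x' (fourier_coeff m f \<gamma>) = (LINT t|m. cnj (\<gamma> t) * x' (f t))"
proof -
  let ?F = "\<lambda>t. cnj (\<gamma> t) *\<^sub>C f t"
  have F: "continuous_on UNIV ?F" by (intro continuous_intros \<gamma> continuous_on_apply_bcontfun)
  obtain x where x: "\<And>x' :: 'x cdual. x' x = cmeasure_integral (dens (\<lambda>_. 1)) (\<lambda>t. x' (?F t))"
    using ex_weak_integral[OF cpt F, of "dens (\<lambda>_. 1)"] by blast
  have x: "cblinfun_apply x' x = (LINT t|m. x' (?F t))" for x' :: "'x cdual"
    unfolding x by (subst cmeasure_integral_dens) (auto intro!: continuous_intros F)
  then have "fourier_coeff m f \<gamma> = x" unfolding fourier_coeff_def by (rule weak_integral_eqI)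
  then show ?thesis by (simp add: x cblinfun_scaleC_right scaleC_complex_def)
qed

subsection \<open>Fubini's theorem for continuous functions\<close>

text \<open>The Borel sets of the product need not be generated by rectangles. Fubini's theorem comes
  instead from the weak integral of the \<open>C(G)\<close>-valued function \<open>s \<mapsto> K(s, \<cdot>)\<close>, tested against the
  evaluations and against the Haar functional.\<close>

lemma ex_partial_integral:
  fixes K :: "'g \<times> 'g \<Rightarrow> complex"
  assumes K: "continuous_on UNIV K"
  obtains x :: "'g \<Rightarrow>\<^sub>C complex" where "\<And>t. x t = (LINT s|m. K (s, t))"
    "(LINT t|m. x t) = (LINT s|m. LINT t|m. K (s, t))"
proof -
  have Ks: "continuous_on UNIV (\<lambda>t. K (s, t))" and Kt: "continuous_on UNIV (\<lambda>s. K (s, t))" for s t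
    by (rule continuous_on_compose2[OF K], auto intro!: continuous_intros)+
  define F where "F s = Bcontfun (\<lambda>t. K (s, t))" for s
  have F: "F s t = K (s, t)" for s t
    by (simp add: F_def Bcontfun_apply[OF cpt Ks])
  have contF: "continuous_on UNIV F"
    unfolding continuous_on_def
  proof (intro ballI tendstoI)
    fix s :: 'g and e :: real assume "0 < e"
    obtain X0 where X0: "s \<in> X0" "open X0" "\<forall>x\<in>X0 \<inter> UNIV. \<forall>t\<in>UNIV. dist (K (x, t)) (K (s, t)) \<le> e / 2"
      using continuous_on_prod_compactE[of UNIV UNIV K s "e / 2"] K cpt \<open>0 < e\<close>
      by (metis UNIV_I UNIV_Times_UNIV half_gt_zero)
    have "dist (F x) (F s) < e" if "x \<in> X0" for x
    proof -
      have "dist (F x) (F s) \<le> e / 2" using X0(3) that by (intro dist_bound) (auto simp: F)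
      then show ?thesis using \<open>0 < e\<close> by simp
    qed
    then show "\<forall>\<^sub>F x in at s within UNIV. dist (F x) (F s) < e"
      using X0(1,2) by (auto simp: eventually_at_topological)
  qed
  obtain x where x: "\<And>x' :: ('g \<Rightarrow>\<^sub>C complex) cdual.
      x' x = cmeasure_integral (dens (\<lambda>_. 1)) (\<lambda>s. x' (F s))"
    using ex_weak_integral[OF cpt contF, of "dens (\<lambda>_. 1)"] by blast
  have x: "cblinfun_apply x' x = (LINT s|m. x' (F s))" for x' :: "('g \<Rightarrow>\<^sub>C complex) cdual"
    unfolding x by (subst cmeasure_integral_dens) (auto intro!: continuous_intros contF)
  show ?thesis
  proof (rule that)
    fix t :: 'g
    obtain e :: "('g \<Rightarrow>\<^sub>C complex) cdual" where e: "cblinfun_apply e = (\<lambda>h. h t)"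
      using ex_cblinfun[of "\<lambda>h :: 'g \<Rightarrow>\<^sub>C complex. apply_bcontfun h t" 1] by (auto simp: norm_bounded)
    show "x t = (LINT s|m. K (s, t))" using x[of e] by (simp add: e F)
  next
    show "(LINT t|m. x t) = (LINT s|m. LINT t|m. K (s, t))"
      using x[of "dens (\<lambda>_. 1)"] by (simp add: dens_apply F)
  qed
qed

lemma fubini:
  fixes K :: "'g \<Rightarrow> 'g \<Rightarrow> complex"
  assumes "continuous_on UNIV (\<lambda>p. K (fst p) (snd p))"
  shows "(LINT s|m. LINT t|m. K s t) = (LINT t|m. LINT s|m. K s t)"
proof -
  obtain x :: "'g \<Rightarrow>\<^sub>C complex" where "\<And>t. x t = (LINT s|m. K s t)"
    "(LINT t|m. x t) = (LINT s|m. LINT t|m. K s t)"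
    using ex_partial_integral[OF assms] by auto
  then show ?thesis by simp
qed

text \<open>Haar measure is only defined by translation invariance. Integrate
  \<open>f (s - t)\<close> over both variables: with \<open>t\<close> inside, every inner integral
  is that of the reflected function; with \<open>s\<close> inside, that of \<open>f\<close>.\<close>

lemma integral_reflect:
  fixes f :: "'g \<Rightarrow> complex"
  assumes f: "continuous_on UNIV f"
  shows "(LINT t|m. f (s - t)) = (LINT t|m. f t)"
proof -
  have fs: "continuous_on UNIV (\<lambda>t. f (s - t))" for s
    by (rule continuous_on_compose2[OF f]) (auto intro!: continuous_intros)
  have eq: "(LINT t|m. f (s - t)) = (LINT t|m. f (- t))" for s
  proof -
    have "(LINT t|m. f (s - t)) = (LINT t|m. f (s - (t + s)))"
      using integral_translate[OF fs, of s s] by simp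
    then show ?thesis by simp
  qed
  have "(LINT s|m. LINT t|m. f (s - t)) = (LINT t|m. LINT s|m. f (s - t))"
    by (rule fubini, rule continuous_on_compose2[OF f]) (auto intro!: continuous_intros)
  also have "\<dots> = (LINT t|m. LINT s|m. f s)"
    using integral_translate[OF f, of "- t" for t] by simp
  finally show ?thesis by (simp add: eq)
qed

subsection \<open>Characters\<close>

lemma dual_groupD:
  assumes "\<gamma> \<in> dual_group"
  shows "continuous_on UNIV \<gamma>" "cmod (\<gamma> s) = 1" "\<gamma> (s + t) = \<gamma> s * \<gamma> t"
    "\<gamma> s * cnj (\<gamma> s) = 1" "\<gamma> 0 = 1" "\<gamma> (- s) = cnj (\<gamma> s)" "\<gamma> (s - t) = \<gamma> s * cnj (\<gamma> t)"
proof -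
  show "continuous_on UNIV \<gamma>" and 1: "\<And>s. cmod (\<gamma> s) = 1" and 2: "\<And>s t. \<gamma> (s + t) = \<gamma> s * \<gamma> t"
    using assms by (auto simp: dual_group_def)
  show 3: "\<gamma> s * cnj (\<gamma> s) = 1" for s
    using 1[of s] by (simp add: complex_norm_square[symmetric])
  show 4: "\<gamma> 0 = 1" using 2[of 0 0] 1[of 0] by auto
  have "\<gamma> s * \<gamma> (- s) = 1" for s using 2[of s "- s"] 4 by simp
  then show 5: "\<gamma> (- s) = cnj (\<gamma> s)" for s
  proof -
    have "\<gamma> s * \<gamma> (- s) = \<gamma> s * cnj (\<gamma> s)" "\<gamma> s \<noteq> 0"
      using \<open>\<gamma> s * \<gamma> (- s) = 1\<close> 3[of s] by auto
    then show ?thesis by simp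
  qed
  show "\<gamma> (s - t) = \<gamma> s * cnj (\<gamma> t)" using 2[of s "- t"] 5 by simp
qed

text \<open>Translation by \<open>s\<close> multiplies the integral by
  \<open>\<gamma> s * cnj (\<delta> s)\<close>, which differs from 1 for a suitable \<open>s\<close>
  unless the characters agree.\<close>

lemma integral_characters:
  assumes "\<gamma> \<in> dual_group" "\<delta> \<in> dual_group"
  shows "(LINT t|m. \<gamma> t * cnj (\<delta> t)) = (if \<gamma> = \<delta> then 1 else 0)"
proof (cases "\<gamma> = \<delta>")
  case True
  then show ?thesis using dual_groupD(4)[OF assms(1)] by simp
next
  case False
  then obtain s where s: "\<gamma> s \<noteq> \<delta> s" by blast
  let ?I = "LINT t|m. \<gamma> t * cnj (\<delta> t)"
  note g = dual_groupD[OF assms(1)] and d = dual_groupD[OF assms(2)]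
  have "?I = (LINT t|m. \<gamma> (t + s) * cnj (\<delta> (t + s)))"
    by (rule integral_translate[symmetric]) (intro continuous_intros g d)
  also have "\<dots> = (LINT t|m. (\<gamma> s * cnj (\<delta> s)) * (\<gamma> t * cnj (\<delta> t)))"
    by (simp add: g(3) d(3) mult_ac)
  also have "\<dots> = (\<gamma> s * cnj (\<delta> s)) * ?I" by simp
  finally have "(\<gamma> s * cnj (\<delta> s) - 1) * ?I = 0" by (simp add: algebra_simps)
  then have "?I = 0 \<or> \<gamma> s * cnj (\<delta> s) = 1" by (simp add: disj_commute)
  moreover have "\<gamma> s * cnj (\<delta> s) \<noteq> 1"
  proof
    assume "\<gamma> s * cnj (\<delta> s) = 1"
    then have "\<gamma> s * (\<delta> s * cnj (\<delta> s)) = \<delta> s" by (simp add: mult_ac)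
    then show False using s d(4)[of s] by simp
  qed
  ultimately show ?thesis using False by simp
qed

end

section \<open>The convolution algebra of continuous functions\<close>

text \<open>Meant for the squared norms of the powers of a self-adjoint element. Log-convexity makes
  the ratios increase, submultiplicativity bounds them by \<open>c 0\<close>, and \<open>l\<close>
  is their limit. The normalized terms decrease and stay above 1, because \<open>l ^ Suc k\<close>
  is the limit of \<open>c (n + Suc k) / c n \<le> c k\<close>. The lower bound on \<open>L\<close>
  later keeps the limit projection away from zero.\<close>

lemma convergent_ratio_powers:
  fixes c :: "nat \<Rightarrow> real"
  assumes pos: "\<And>n. 0 < c n" and logconvex: "\<And>n. (c (Suc n))\<^sup>2 \<le> c n * c (Suc (Suc n))"
    and submult: "\<And>i j. c (Suc (i + j)) \<le> c i * c j"
  obtains l L where "0 < l" "1 \<le> L" "(\<lambda>n. c n / l ^ Suc n) \<longlonglongrightarrow> L"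
proof -
  define r where "r n = c (Suc n) / c n" for n
  have r_le: "r n \<le> c 0" for n
    using submult[of n 0] pos[of n] by (simp add: r_def field_simps)
  have "incseq r"
    using pos logconvex by (intro incseq_SucI) (simp add: r_def field_simps power2_eq_square)
  then obtain l where l: "r \<longlonglongrightarrow> l" "\<And>n. r n \<le> l"
    using incseq_convergent[of r "c 0"] r_le by blast
  have "0 < r 0" using pos by (simp add: r_def)
  then have "0 < l" using l(2)[of 0] by simp
  define D where "D n = c n / l ^ Suc n" for n
  have "c (Suc n) \<le> l * c n" for n using l(2)[of n] pos[of n] by (simp add: r_def field_simps)
  then have "decseq D"
    using \<open>0 < l\<close> by (intro decseq_SucI) (simp add: D_def field_simps)
  have D_ge: "1 \<le> D k" for k
  proof -
    have "(\<lambda>n. c (n + j) / c n) \<longlonglongrightarrow> l ^ j" for j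
    proof (induction j)
      case 0
      have "c n \<noteq> 0" for n using pos[of n] by simp
      then show ?case by simp
    next
      case (Suc j)
      have "(\<lambda>n. r (n + j) * (c (n + j) / c n)) \<longlonglongrightarrow> l * l ^ j"
        by (intro tendsto_mult LIMSEQ_ignore_initial_segment l(1) Suc)
      moreover have "r (n + j) * (c (n + j) / c n) = c (n + Suc j) / c n" for n
        using pos[of "n + j"] by (simp add: r_def)
      ultimately show ?case by (simp only: power_Suc)
    qed
    then have "(\<lambda>n. c (n + Suc k) / c n) \<longlonglongrightarrow> l ^ Suc k" .
    moreover have "c (n + Suc k) / c n \<le> c k" for n
      using submult[of n k] pos[of n] by (simp add: field_simps)
    ultimately have "l ^ Suc k \<le> c k" by (intro LIMSEQ_le_const2) auto
    then show ?thesis using \<open>0 < l\<close> by (simp add: D_def)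
  qed
  obtain L where "D \<longlonglongrightarrow> L" "\<And>n. L \<le> D n"
    using decseq_convergent[OF \<open>decseq D\<close>, of 1] D_ge by blast
  moreover from this have "1 \<le> L" using D_ge by (intro LIMSEQ_le_const) auto
  ultimately show ?thesis using \<open>0 < l\<close> that unfolding D_def by blast
qed

context compact_haar
begin

definition conv :: "('g \<Rightarrow>\<^sub>C complex) \<Rightarrow> ('g \<Rightarrow>\<^sub>C complex) \<Rightarrow> ('g \<Rightarrow>\<^sub>C complex)"  (infixl "\<star>" 70)
  where "g \<star> h = Bcontfun (\<lambda>s. LINT t|m. g (s - t) * h t)"

definition adj :: "('g \<Rightarrow>\<^sub>C complex) \<Rightarrow> ('g \<Rightarrow>\<^sub>C complex)"
  where "adj g = Bcontfun (\<lambda>t. cnj (g (- t)))"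

definition translate :: "'g \<Rightarrow> ('g \<Rightarrow>\<^sub>C complex) \<Rightarrow> ('g \<Rightarrow>\<^sub>C complex)"
  where "translate s g = Bcontfun (\<lambda>t. g (t + s))"

definition sqnorm :: "('g \<Rightarrow>\<^sub>C complex) \<Rightarrow> real"
  where "sqnorm g = (LINT t|m. (cmod (g t))\<^sup>2)"

lemma cont_compose [continuous_intros]:
  "continuous_on S k \<Longrightarrow> continuous_on S (\<lambda>x. apply_bcontfun (g :: 'g \<Rightarrow>\<^sub>C complex) (k x))"
  by (rule continuous_on_compose2[OF continuous_on_apply_bcontfun[of UNIV g]]) auto

text \<open>\<open>ex_partial_integral\<close> produces the integral as an element of
  \<open>C(G)\<close>, so continuity of the convolution comes with it.\<close>

lemma conv_apply: "(g \<star> h) s = (LINT t|m. g (s - t) * h t)"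
proof -
  have "continuous_on UNIV (\<lambda>p. apply_bcontfun g (snd p - fst p) * h (fst p))"
    by (intro continuous_intros)
  then obtain x :: "'g \<Rightarrow>\<^sub>C complex" where x: "\<And>s. x s = (LINT t|m. g (s - t) * h t)"
    by (rule ex_partial_integral) auto
  then have "Bcontfun (\<lambda>s. LINT t|m. g (s - t) * h t) = x"
    by (simp add: x[symmetric] apply_bcontfun_inverse)
  then show ?thesis by (simp add: conv_def x)
qed

lemma adj_apply [simp]: "adj g t = cnj (g (- t))"
  unfolding adj_def by (subst Bcontfun_apply[OF cpt]) (auto intro!: continuous_intros)

lemma translate_apply [simp]: "translate s g t = g (t + s)"
  unfolding translate_def by (subst Bcontfun_apply[OF cpt]) (auto intro!: continuous_intros)

lemma conv_commute: "g \<star> h = h \<star> g"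
proof (rule bcontfun_eqI)
  fix s
  have "(LINT t|m. g (s - t) * h (s - (s - t))) = (LINT t|m. g t * h (s - t))"
    by (rule integral_reflect[of "\<lambda>t. g t * h (s - t)"]) (intro continuous_intros)
  then show "(g \<star> h) s = (h \<star> g) s" by (simp add: conv_apply mult.commute)
qed

lemma conv_assoc: "(g \<star> h) \<star> k = g \<star> (h \<star> k)"
proof (rule bcontfun_eqI)
  fix s
  have "(g \<star> (h \<star> k)) s = (LINT v|m. LINT t|m. g (s - v) * (h (v - t) * k t))"
    by (simp add: conv_apply)
  also have "\<dots> = (LINT t|m. LINT v|m. g (s - v) * (h (v - t) * k t))"
    by (rule fubini) (intro continuous_intros)
  also have "\<dots> = (LINT t|m. LINT v|m. g (s - (v + t)) * (h (v + t - t) * k t))"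
    by (intro Bochner_Integration.integral_cong refl integral_translate[symmetric]) (intro continuous_intros)
  also have "\<dots> = (LINT t|m. (LINT v|m. g (s - t - v) * h v) * k t)"
    by (simp add: mult.assoc[symmetric] diff_diff_add add.commute)
  also have "\<dots> = ((g \<star> h) \<star> k) s" by (simp add: conv_apply)
  finally show "((g \<star> h) \<star> k) s = (g \<star> (h \<star> k)) s" ..
qed

lemma conv_add_left: "(g + h) \<star> k = g \<star> k + h \<star> k"
proof (rule bcontfun_eqI)
  fix s
  have i: "integrable m (\<lambda>t. apply_bcontfun f (s - t) * k t)" for f
    by (intro integrable_continuous continuous_intros)
  show "((g + h) \<star> k) s = (g \<star> k + h \<star> k) s"
    by (simp add: conv_apply distrib_right i)
qed

lemma conv_scaleC_left: "(c *\<^sub>C g) \<star> k = c *\<^sub>C (g \<star> k)"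
  by (rule bcontfun_eqI) (simp add: conv_apply scaleC_complex_def mult.assoc)

lemma conv_scaleC_right: "g \<star> (c *\<^sub>C k) = c *\<^sub>C (g \<star> k)"
  by (metis conv_commute conv_scaleC_left)

lemma norm_conv_le: "norm (g \<star> h) \<le> norm g * norm h"
proof (rule norm_bound)
  fix s
  show "norm ((g \<star> h) s) \<le> norm g * norm h"
    unfolding conv_apply
    by (rule integral_norm_le)
      (auto simp: norm_mult intro!: mult_mono norm_bounded continuous_intros)
qed

lemma bounded_bilinear_conv: "bounded_bilinear (\<star>)"
proof
  show "(g + h) \<star> k = g \<star> k + h \<star> k" and "g \<star> (h + k) = g \<star> h + g \<star> k" for g h k
    by (metis conv_commute conv_add_left)+
  show "(r *\<^sub>R g) \<star> h = r *\<^sub>R (g \<star> h)" and "g \<star> (r *\<^sub>R h) = r *\<^sub>R (g \<star> h)" for r g h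
    by (simp_all add: scaleC_of_real[symmetric] conv_scaleC_left conv_scaleC_right)
  show "\<exists>K. \<forall>g h. norm (g \<star> h) \<le> norm g * norm h * K"
    using norm_conv_le by (intro exI[of _ 1]) auto
qed

lemmas conv_diff_left = bounded_bilinear.diff_left[OF bounded_bilinear_conv]
  and conv_diff_right = bounded_bilinear.diff_right[OF bounded_bilinear_conv]
  and conv_add_right = bounded_bilinear.add_right[OF bounded_bilinear_conv]
  and conv_zero_left = bounded_bilinear.zero_left[OF bounded_bilinear_conv]
  and conv_zero_right = bounded_bilinear.zero_right[OF bounded_bilinear_conv]
  and tendsto_conv = bounded_bilinear.tendsto[OF bounded_bilinear_conv]

lemma adj_adj [simp]: "adj (adj g) = g"
  by (rule bcontfun_eqI) simp

lemma adj_add: "adj (g + h) = adj g + adj h"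
  and adj_diff: "adj (g - h) = adj g - adj h"
  by (rule bcontfun_eqI, simp)+

lemma adj_scaleC: "adj (c *\<^sub>C g) = cnj c *\<^sub>C adj g"
  by (rule bcontfun_eqI) (simp add: scaleC_complex_def)

lemma adj_conv: "adj (g \<star> h) = adj g \<star> adj h"
proof (rule bcontfun_eqI)
  fix s
  let ?f = "\<lambda>t. cnj (g (- s - t)) * cnj (h t)"
  have "adj (g \<star> h) s = (LINT t|m. ?f t)"
    by (simp add: conv_apply Bochner_Integration.integral_cnj[symmetric])
  also have "\<dots> = (LINT t|m. ?f (0 - t))"
    by (rule integral_reflect[symmetric]) (intro continuous_intros)
  also have "\<dots> = (adj g \<star> adj h) s" by (simp add: conv_apply algebra_simps)
  finally show "adj (g \<star> h) s = (adj g \<star> adj h) s" .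
qed

lemma norm_adj_le: "norm (adj g) \<le> norm g"
  by (rule norm_bound) (simp add: norm_bounded)

lemma tendsto_adj: "(f \<longlongrightarrow> l) F \<Longrightarrow> ((\<lambda>x. adj (f x)) \<longlongrightarrow> adj l) F"
  by (rule bounded_linear.tendsto[OF bounded_linear_intro[where K = 1]])
    (auto simp: adj_add norm_adj_le scaleC_of_real[symmetric] adj_scaleC)

text \<open>Evaluation at 0 acts as a trace: it turns identities of the convolution algebra into
  identities between squared norms.\<close>

lemma conv_adj_0: "(g \<star> adj g) 0 = of_real (sqnorm g)"
proof -
  have "(g \<star> adj g) 0 = (LINT t|m. of_real ((cmod (g (0 - t)))\<^sup>2))"
    by (simp add: conv_apply complex_norm_square del: of_real_power)
  also have "\<dots> = (LINT t|m. of_real ((cmod (g t))\<^sup>2))"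
    by (rule integral_reflect) (intro continuous_intros)
  finally show ?thesis by (simp add: sqnorm_def del: of_real_power)
qed

lemma sqnorm_nonneg: "0 \<le> sqnorm g"
  by (simp add: sqnorm_def)

lemma sqnorm_pos: "g \<noteq> 0 \<Longrightarrow> 0 < sqnorm g"
proof -
  assume "g \<noteq> 0"
  then obtain t where "g t \<noteq> 0" by (metis bcontfun_eqI zero_bcontfun.rep_eq)
  then show ?thesis unfolding sqnorm_def
    by (intro integral_pos[of _ t] continuous_intros) auto
qed

lemma integral_Cauchy_Schwarz:
  fixes f g :: "'g \<Rightarrow> real"
  assumes f: "continuous_on UNIV f" and g: "continuous_on UNIV g"
  shows "(LINT t|m. f t * g t)\<^sup>2 \<le> (LINT t|m. (f t)\<^sup>2) * (LINT t|m. (g t)\<^sup>2)"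
proof -
  define A where "A = (LINT t|m. (f t)\<^sup>2)"
  define B where "B = (LINT t|m. (g t)\<^sup>2)"
  define C where "C = (LINT t|m. f t * g t)"
  have i: "integrable m (\<lambda>t. (f t)\<^sup>2)" "integrable m (\<lambda>t. (g t)\<^sup>2)" "integrable m (\<lambda>t. f t * g t)"
    by (intro integrable_continuous continuous_intros f g)+
  have "C\<^sup>2 \<le> A * B"
  proof (cases "\<exists>t. g t \<noteq> 0")
    case True
    then obtain t where "g t \<noteq> 0" by blast
    then have "0 < B" unfolding B_def by (intro integral_pos[of _ t] continuous_intros g) auto
    have "0 \<le> (LINT t|m. (B * f t - C * g t)\<^sup>2)" by simp
    also have "\<dots> = (LINT t|m. B\<^sup>2 * (f t)\<^sup>2 - (2 * B * C) * (f t * g t) + C\<^sup>2 * (g t)\<^sup>2)"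
      by (rule Bochner_Integration.integral_cong) (auto simp: power2_eq_square algebra_simps)
    also have "\<dots> = B\<^sup>2 * A - (2 * B * C) * C + C\<^sup>2 * B"
      using i by (simp add: A_def B_def C_def)
    also have "\<dots> = B * (A * B - C\<^sup>2)" by (simp add: power2_eq_square algebra_simps)
    finally show ?thesis using \<open>0 < B\<close> by (simp add: zero_le_mult_iff)
  qed (simp add: B_def C_def)
  then show ?thesis by (simp add: A_def B_def C_def)
qed

lemma cmod_conv_le: "(cmod ((g \<star> h) s))\<^sup>2 \<le> sqnorm g * sqnorm h"
proof -
  have "cmod ((g \<star> h) s) \<le> (LINT t|m. cmod (g (s - t)) * cmod (h t))"
    unfolding conv_apply norm_mult[symmetric] by (rule integral_norm_bound)
  then have "(cmod ((g \<star> h) s))\<^sup>2 \<le> (LINT t|m. cmod (g (s - t)) * cmod (h t))\<^sup>2"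
    by (intro power_mono) auto
  also have "\<dots> \<le> (LINT t|m. (cmod (g (s - t)))\<^sup>2) * (LINT t|m. (cmod (h t))\<^sup>2)"
    by (intro integral_Cauchy_Schwarz continuous_intros)
  also have "(LINT t|m. (cmod (g (s - t)))\<^sup>2) = sqnorm g"
  proof -
    have "complex_of_real (LINT t|m. (cmod (g (s - t)))\<^sup>2) = (LINT t|m. complex_of_real ((cmod (g (s - t)))\<^sup>2))"
      by (simp del: of_real_power)
    also have "\<dots> = (LINT t|m. complex_of_real ((cmod (g t))\<^sup>2))"
      by (rule integral_reflect) (intro continuous_intros)
    finally show ?thesis by (simp add: sqnorm_def del: of_real_power)
  qed
  finally show ?thesis by (simp add: sqnorm_def)
qed

lemma norm_conv_sqnorm: "norm (g \<star> h) \<le> sqrt (sqnorm g * sqnorm h)"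
  by (rule norm_bound) (use cmod_conv_le in \<open>simp add: real_le_rsqrt\<close>)

subsection \<open>Idempotents\<close>

text \<open>Convolution with such a \<open>p\<close> is a nonzero orthogonal projection of the
  square integrable functions, and \<open>sqnorm p\<close> is its rank.\<close>

definition idem :: "('g \<Rightarrow>\<^sub>C complex) \<Rightarrow> bool"
  where "idem p \<longleftrightarrow> p \<star> p = p \<and> adj p = p \<and> p \<noteq> 0"

lemma idem_at_0: "idem p \<Longrightarrow> p 0 = of_real (sqnorm p)"
  using conv_adj_0[of p] by (simp add: idem_def)

text \<open>Since \<open>p\<close> is its own convolution square, \<open>sqnorm p\<close> bounds it
  pointwise, so over total mass 1 \<open>sqnorm p\<close> is at most its own square. The gap between
  0 and 1 is what stops the descent to minimal idempotents.\<close>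

lemma sqnorm_idem: "idem p \<Longrightarrow> 1 \<le> sqnorm p"
proof -
  assume p: "idem p"
  then have pos: "0 < sqnorm p" by (simp add: idem_def sqnorm_pos)
  have "(cmod (p t))\<^sup>2 \<le> (sqnorm p)\<^sup>2" for t
    using cmod_conv_le[of p p t] p by (simp add: idem_def power2_eq_square)
  then have "sqnorm p \<le> (LINT t|m. (sqnorm p)\<^sup>2)"
    unfolding sqnorm_def[of p] by (intro integral_mono_continuous continuous_intros) (simp_all add: sqnorm_def)
  then show ?thesis using pos by (simp add: power2_eq_square)
qed

text \<open>The normalized powers of a self-adjoint element converge in \<open>L\<^sup>2\<close>, because their inner
  products are the terms of one convergent sequence, and one further convolution makes the
  convergence uniform. The limit is the spectral projection of the largest eigenvalue.\<close>

lemma ex_top_idem: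
  assumes sa: "adj l = l" and "l \<noteq> 0"
  obtains p and r :: real where "idem p" "(l \<star> l) \<star> p = of_real r *\<^sub>C p"
    "\<And>q. l \<star> q = l \<Longrightarrow> p \<star> q = p" "\<And>h. l \<star> h = 0 \<Longrightarrow> p \<star> h = 0"
proof -
  \<comment> \<open>The algebra need not have a unit, so the powers start at \<open>l\<close>:
    \<open>v n\<close> has \<open>n + 1\<close> factors.\<close>
  define v where "v n = ((\<lambda>x. x \<star> l) ^^ n) l" for n
  have v0: "v 0 = l" and vS: "v (Suc n) = v n \<star> l" for n by (simp_all add: v_def)
  have v_conv: "v i \<star> v j = v (Suc (i + j))" for i j
    by (induction j) (simp_all add: v0 vS conv_assoc[symmetric])
  have v_adj: "adj (v n) = v n" for n
    by (induction n) (simp_all add: v0 vS sa adj_conv)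
  define c where "c n = sqnorm (v n)" for n
  \<comment> \<open>The even powers. Their values at 0 are the numbers \<open>c n\<close>, from
    which all inner products of powers can be read off.\<close>
  define w where "w n = v (Suc (n + n))" for n
  have w_eq: "w n = v n \<star> v n" for n by (simp add: w_def v_conv)
  have w0: "w n 0 = of_real (c n)" for n
    using conv_adj_0[of "v n"] by (simp add: w_eq v_adj c_def)
  have w_conv: "w i \<star> w j = w (Suc (i + j))" for i j by (simp add: w_def v_conv algebra_simps)
  have logconvex: "(c (Suc n))\<^sup>2 \<le> c n * c (Suc (Suc n))" for n
    using cmod_conv_le[of "v n" "v (Suc (Suc n))" 0] w0[of "Suc n"]
    by (simp add: v_conv w_def c_def)
  \<comment> \<open>A nonzero self-adjoint element is not nilpotent: \<open>c 0\<close> and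
    \<open>c 1\<close> are positive directly, and log-convexity hands positivity on.\<close>
  have c0: "0 < c n" for n
  proof (induction n rule: less_induct)
    case (less n)
    have "0 < c 0" using \<open>l \<noteq> 0\<close> by (simp add: c_def v0 sqnorm_pos)
    moreover have "0 < c 1"
    proof -
      have "v 1 0 \<noteq> 0" using w0[of 0] \<open>0 < c 0\<close> by (simp add: w_def)
      then have "v 1 \<noteq> 0" by auto
      then show ?thesis by (simp add: c_def sqnorm_pos)
    qed
    moreover have "0 < c (Suc (Suc k))" if "n = Suc (Suc k)" for k
    proof -
      have "0 < c (Suc k)" "0 < c k" using less[of "Suc k"] less[of k] that by auto
      then have "0 < (c (Suc k))\<^sup>2" "0 < c k" by auto
      then have "0 < c k * c (Suc (Suc k))" using logconvex[of k] by linarith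
      then show ?thesis using \<open>0 < c k\<close> by (simp add: zero_less_mult_iff)
    qed
    moreover have "n = 0 \<or> n = 1 \<or> (\<exists>k. n = Suc (Suc k))" by (cases n; cases "n - 1") auto
    ultimately show ?case by blast
  qed
  have w_norm: "norm (w n) \<le> c n" for n
    using norm_conv_sqnorm[of "v n" "v n"] c0[of n] by (simp add: w_eq c_def)
  have submult: "c (Suc (i + j)) \<le> c i * c j" for i j
  proof -
    have "c (Suc (i + j)) = cmod ((w i \<star> w j) 0)" using c0[of "Suc (i + j)"] by (simp add: w_conv w0)
    also have "\<dots> \<le> norm (w i \<star> w j)" by (rule norm_bounded)
    also have "\<dots> \<le> norm (w i) * norm (w j)" by (rule norm_conv_le)
    also have "\<dots> \<le> c i * c j" using c0[of i] by (intro mult_mono w_norm) auto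
    finally show ?thesis .
  qed
  obtain r L where r: "0 < r" and L: "1 \<le> L" "(\<lambda>n. c n / r ^ Suc n) \<longlonglongrightarrow> L"
    using convergent_ratio_powers[of c, OF c0 logconvex submult] by blast
  define D where "D n = c n / r ^ Suc n" for n
  \<comment> \<open>Powers of \<open>l \<star> l\<close> divided by \<open>r\<close>, its largest
    eigenvalue.\<close>
  define W where "W n = inverse (of_real r) ^ Suc n *\<^sub>C w n" for n
  have W_conv: "W i \<star> W j = W (Suc (i + j))" for i j
    by (simp add: W_def w_conv conv_scaleC_left conv_scaleC_right scaleC_scaleC power_add mult_ac)
  have W_adj: "adj (W n) = W n" for n
    by (simp add: W_def adj_scaleC w_def v_adj)
  have W_0: "W n 0 = of_real (D n)" for n
    by (simp add: W_def D_def w0 scaleC_complex_def field_simps)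
  have sq_diff: "sqnorm (W i - W j) = D (Suc (i + i)) + D (Suc (j + j)) - 2 * D (Suc (i + j))" for i j
  proof -
    have "of_real (sqnorm (W i - W j)) = ((W i - W j) \<star> (W i - W j)) 0"
      using conv_adj_0[of "W i - W j"] by (simp add: adj_diff W_adj)
    also have "\<dots> = of_real (D (Suc (i + i)) + D (Suc (j + j)) - 2 * D (Suc (i + j)))"
      by (simp add: conv_diff_left conv_diff_right W_conv W_0 add.commute[of j i])
    finally show ?thesis by (simp only: of_real_eq_iff)
  qed
  have D_lim: "D \<longlonglongrightarrow> L" using L(2) by (simp add: D_def[abs_def])
  have "Cauchy (\<lambda>n. W (Suc n))"
  proof (rule metric_CauchyI)
    fix e :: real assume "0 < e"
    \<comment> \<open>The three terms of \<open>sq_diff\<close> carry the weights 1, 1 and 2, whence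
      the 4; \<open>sqnorm (W 0)\<close> comes from the extra convolution, and 1 is added to keep
      the divisor positive.\<close>
    define d where "d = e\<^sup>2 / (4 * (sqnorm (W 0) + 1))"
    have "0 < d" using \<open>0 < e\<close> sqnorm_nonneg[of "W 0"] by (simp add: d_def)
    then obtain N where N: "\<And>n. N \<le> n \<Longrightarrow> \<bar>D n - L\<bar> < d"
      using D_lim unfolding lim_sequentially dist_real_def by blast
    show "\<exists>M. \<forall>i\<ge>M. \<forall>j\<ge>M. dist (W (Suc i)) (W (Suc j)) < e"
    proof (intro exI allI impI)
      fix i j assume ij: "N \<le> i" "N \<le> j"
      have "sqnorm (W i - W j) < 4 * d"
        using N[of "Suc (i + i)"] N[of "Suc (j + j)"] N[of "Suc (i + j)"] ij by (auto simp: sq_diff abs_less_iff)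
      have "dist (W (Suc i)) (W (Suc j)) = norm ((W i - W j) \<star> W 0)"
        by (simp add: dist_norm conv_diff_left W_conv)
      also have "\<dots> \<le> sqrt (sqnorm (W i - W j) * sqnorm (W 0))" by (rule norm_conv_sqnorm)
      also have "\<dots> < e"
      proof (rule real_less_lsqrt)
        have "sqnorm (W i - W j) * sqnorm (W 0) \<le> sqnorm (W i - W j) * (sqnorm (W 0) + 1)"
          using sqnorm_nonneg by (intro mult_left_mono) auto
        also have "\<dots> < (4 * d) * (sqnorm (W 0) + 1)"
          using \<open>sqnorm (W i - W j) < 4 * d\<close> sqnorm_nonneg[of "W 0"] by (intro mult_strict_right_mono) auto
        also have "\<dots> = e\<^sup>2" using sqnorm_nonneg[of "W 0"] by (simp add: d_def field_simps)
        finally show "sqnorm (W i - W j) * sqnorm (W 0) < e\<^sup>2" .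
      qed (use \<open>0 < e\<close> sqnorm_nonneg in auto)
      finally show "dist (W (Suc i)) (W (Suc j)) < e" .
    qed
  qed
  then obtain p where "(\<lambda>n. W (Suc n)) \<longlonglongrightarrow> p" using Cauchy_convergent_iff convergent_def by blast
  then have p: "W \<longlonglongrightarrow> p" by (rule LIMSEQ_imp_Suc)
  have p_conv: "(\<lambda>n. W n \<star> h) \<longlonglongrightarrow> p \<star> h" for h by (intro tendsto_conv p tendsto_const)
  have "p \<star> p = p"
  proof (rule LIMSEQ_unique)
    show "(\<lambda>n. W n \<star> W n) \<longlonglongrightarrow> p \<star> p" by (intro tendsto_conv p)
    have "strict_mono (\<lambda>n::nat. Suc (n + n))" by (rule strict_monoI) auto
    then show "(\<lambda>n. W n \<star> W n) \<longlonglongrightarrow> p" unfolding W_conv using LIMSEQ_subseq_LIMSEQ[OF p] by (auto simp: o_def)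
  qed
  moreover have "adj p = p"
    using LIMSEQ_unique[OF _ p, of "adj p"] tendsto_adj[OF p] by (simp only: W_adj)
  \<comment> \<open>The value of \<open>p\<close> at 0 is the limit \<open>L\<close> of the
    \<open>D n\<close>, which is at least 1.\<close>
  moreover have "p \<noteq> 0"
  proof
    assume "p = 0"
    have "(\<lambda>n. W n 0) \<longlonglongrightarrow> p 0" by (rule bounded_linear.tendsto[OF bounded_linear_bcontfun_apply p])
    then have "(\<lambda>n. complex_of_real (D n)) \<longlonglongrightarrow> 0" by (simp add: W_0 \<open>p = 0\<close>)
    moreover have "(\<lambda>n. complex_of_real (D n)) \<longlonglongrightarrow> of_real L" using D_lim by (rule tendsto_of_real)
    ultimately have "complex_of_real L = 0" by (metis LIMSEQ_unique)
    then show False using L(1) by simp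
  qed
  ultimately have "idem p" by (simp add: idem_def)
  have eig: "(l \<star> l) \<star> p = of_real r *\<^sub>C p"
  proof -
    have "W 0 \<star> p = p"
    proof (rule LIMSEQ_unique)
      show "(\<lambda>n. W 0 \<star> W n) \<longlonglongrightarrow> W 0 \<star> p" by (intro tendsto_conv p tendsto_const)
      show "(\<lambda>n. W 0 \<star> W n) \<longlonglongrightarrow> p" using LIMSEQ_Suc[OF p] by (simp add: W_conv)
    qed
    then have "of_real r *\<^sub>C (W 0 \<star> p) = of_real r *\<^sub>C p" by simp
    then show ?thesis using r
      by (simp add: W_def w_eq v0 conv_scaleC_left scaleC_scaleC) (simp add: scaleC_of_real[of 1, simplified])
  qed
  have unit: "p \<star> q = p" if "l \<star> q = l" for q
  proof (rule LIMSEQ_unique[OF p_conv])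
    have "v n \<star> q = v n" for n using that by (cases n) (simp_all add: v0 vS conv_assoc)
    then have "W n \<star> q = W n" for n by (simp add: W_def w_def conv_scaleC_left)
    then show "(\<lambda>n. W n \<star> q) \<longlonglongrightarrow> p" using p by simp
  qed
  have ann: "p \<star> h = 0" if "l \<star> h = 0" for h
  proof (rule LIMSEQ_unique[OF p_conv])
    have "v n \<star> h = 0" for n using that by (cases n) (simp_all add: v0 vS conv_assoc conv_zero_right)
    then have "W n \<star> h = 0" for n by (simp add: W_def w_def conv_scaleC_left scaleC_zero)
    then show "(\<lambda>n. W n \<star> h) \<longlonglongrightarrow> 0" by simp
  qed
  show ?thesis by (rule that[OF \<open>idem p\<close> eig unit ann])
qed

text \<open>For an idempotent \<open>r\<close> properly below \<open>p\<close>, the difference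
  \<open>p - r\<close> is again idempotent and \<open>sqnorm\<close> is additive, being the value at
  0. Each descent therefore costs at least 1, and induction on an integer bound terminates.\<close>

lemma ex_minimal_idem:
  assumes "idem p"
  obtains q where "idem q" "q \<star> p = q" "\<And>r. idem r \<Longrightarrow> r \<star> q = r \<Longrightarrow> r = q"
proof -
  have "\<exists>q. idem q \<and> q \<star> p = q \<and> (\<forall>r. idem r \<longrightarrow> r \<star> q = r \<longrightarrow> r = q)"
    if "idem p" "sqnorm p \<le> real n" for n p
    using that
  proof (induction n arbitrary: p)
    case 0
    then show ?case using sqnorm_idem[of p] by simp
  next
    case (Suc n)
    show ?case
    proof (cases "\<forall>r. idem r \<longrightarrow> r \<star> p = r \<longrightarrow> r = p")
      case True
      then show ?thesis using Suc.prems by (intro exI[of _ p]) (simp add: idem_def)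
    next
      case False
      then obtain r where r: "idem r" "r \<star> p = r" "r \<noteq> p" by blast
      have "idem (p - r)"
        using r Suc.prems(1) conv_commute[of p r]
        by (simp add: idem_def conv_diff_left conv_diff_right adj_diff)
      then have "1 \<le> sqnorm (p - r)" by (rule sqnorm_idem)
      moreover have "complex_of_real (sqnorm (p - r)) = of_real (sqnorm p - sqnorm r)"
        using idem_at_0[OF \<open>idem (p - r)\<close>] idem_at_0[OF r(1)] idem_at_0[OF Suc.prems(1)] by simp
      then have "sqnorm (p - r) = sqnorm p - sqnorm r" by (simp only: of_real_eq_iff)
      ultimately have "sqnorm r \<le> real n" using Suc.prems(2) by simp
      from Suc.IH[OF r(1) this] obtain q where q: "idem q" "q \<star> r = q" "\<forall>s. idem s \<longrightarrow> s \<star> q = s \<longrightarrow> s = q"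
        by blast
      have "q \<star> p = q" using q(2) r(2) by (metis conv_assoc)
      then show ?thesis using q by blast
    qed
  qed
  then show ?thesis using assms that real_arch_simple by metis
qed

text \<open>The ideal generated by a minimal idempotent is one-dimensional. The top idempotent of a
  nonzero self-adjoint \<open>l\<close> in it lies below \<open>q\<close>, hence equals
  \<open>q\<close>, which makes \<open>l \<star> l\<close> a multiple of \<open>q\<close>.
  Polarization and the splitting of \<open>g\<close> into self-adjoint parts do the rest.\<close>

lemma minimal_idem_multiple:
  assumes q: "idem q" and min: "\<And>r. idem r \<Longrightarrow> r \<star> q = r \<Longrightarrow> r = q" and g: "g \<star> q = g"
  shows "\<exists>c. g = c *\<^sub>C q"
proof -
  have qq: "q \<star> q = q" "adj q = q" using q by (simp_all add: idem_def)
  have square: "\<exists>c. l \<star> l = c *\<^sub>C q" if l: "adj l = l" "l \<star> q = l" for l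
  proof (cases "l = 0")
    case True
    then show ?thesis by (intro exI[of _ 0]) (simp add: conv_zero_left scaleC_of_real[of 0, simplified])
  next
    case False
    obtain p and r :: real where p: "idem p" "(l \<star> l) \<star> p = of_real r *\<^sub>C p" "p \<star> q = p"
      using ex_top_idem[OF l(1) False] l(2) by metis
    have "p = q" using min p by blast
    then have "(l \<star> l) \<star> q = of_real r *\<^sub>C q" using p by simp
    then show ?thesis using l(2) by (auto simp: conv_assoc)
  qed
  have one: "1 *\<^sub>C x = x" for x :: "'g \<Rightarrow>\<^sub>C complex" using scaleC_of_real[of 1 x] by simp
  have sa: "\<exists>c. l = c *\<^sub>C q" if l: "adj l = l" "l \<star> q = l" for l
  proof -
    \<comment> \<open>Squaring \<open>l + q\<close> leaves the cross term \<open>l + l\<close>,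
      because \<open>q\<close> acts on \<open>l\<close> as a unit.\<close>
    obtain c d where c: "l \<star> l = c *\<^sub>C q" and d: "(l + q) \<star> (l + q) = d *\<^sub>C q"
      using square[OF l] square[of "l + q"] l qq by (auto simp: adj_add conv_add_left)
    have "(l + q) \<star> (l + q) = l \<star> l + (l + l) + q"
      using l qq conv_commute[of q l] by (simp add: conv_add_left conv_add_right)
    then have "l + l = d *\<^sub>C q - c *\<^sub>C q - 1 *\<^sub>C q" using c d by (simp add: one algebra_simps)
    also have "\<dots> = (d - c - 1) *\<^sub>C q"
      using scaleC_add_left[of "d - c - 1" "1 + c" q] by (simp add: scaleC_add_left algebra_simps)
    finally have "(1/2) *\<^sub>C (l + l) = ((d - c - 1) / 2) *\<^sub>C q" by (simp add: scaleC_scaleC)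
    moreover have "(1/2) *\<^sub>C (l + l) = l"
      by (simp add: scaleC_add_right scaleC_add_left[symmetric] one)
    ultimately show ?thesis by auto
  qed
  have ag: "adj g \<star> q = adj g" using g qq adj_conv[of g q] by simp
  obtain a b where a: "g + adj g = a *\<^sub>C q" and b: "\<i> *\<^sub>C (g - adj g) = b *\<^sub>C q"
  proof -
    have "adj (\<i> *\<^sub>C (g - adj g)) = \<i> *\<^sub>C (g - adj g)"
      by (rule bcontfun_eqI) (simp add: scaleC_complex_def algebra_simps)
    then show ?thesis using sa[of "g + adj g"] sa[of "\<i> *\<^sub>C (g - adj g)"] that g ag
      by (auto simp: adj_add conv_add_left conv_scaleC_left conv_diff_left add.commute)
  qed
  have "g = (1/2) *\<^sub>C ((g + adj g) + (-\<i>) *\<^sub>C (\<i> *\<^sub>C (g - adj g)))"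
    by (rule bcontfun_eqI) (simp add: scaleC_complex_def algebra_simps)
  also have "\<dots> = ((a + (-\<i>) * b) / 2) *\<^sub>C q"
    unfolding a b by (simp add: scaleC_scaleC scaleC_add_left[symmetric])
  finally show ?thesis by blast
qed

text \<open>Convolution commutes with translation, so every translate of \<open>q\<close> stays in
  the one-dimensional ideal and is a multiple of \<open>q\<close>. This is the functional equation
  up to the factor \<open>q 0\<close>; self-adjointness gives modulus 1.\<close>

lemma minimal_idem_character:
  assumes q: "idem q" and min: "\<And>r. idem r \<Longrightarrow> r \<star> q = r \<Longrightarrow> r = q"
  shows "(\<lambda>t. q t / q 0) \<in> dual_group"
proof -
  let ?\<chi> = "\<lambda>t. q t / q 0"
  have q0: "q 0 \<noteq> 0" using idem_at_0[OF q] sqnorm_idem[OF q] by simp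
  have qq: "q \<star> q = q" "adj q = q" using q by (simp_all add: idem_def)
  have mult: "?\<chi> (s + t) = ?\<chi> s * ?\<chi> t" for s t
  proof -
    have "translate t q \<star> q = translate t (q \<star> q)"
      by (rule bcontfun_eqI) (simp add: conv_apply algebra_simps)
    then obtain c where c: "translate t q = c *\<^sub>C q" using minimal_idem_multiple[OF q min] qq by metis
    have "q (x + t) = c * q x" for x
      using arg_cong[OF c, of "\<lambda>h. apply_bcontfun h x"] by (simp add: scaleC_complex_def)
    from this[of s] this[of 0] show ?thesis using q0 by simp
  qed
  have refl: "q (- t) = cnj (q t)" for t
    using arg_cong[OF qq(2), of "\<lambda>h. apply_bcontfun h (- t)"] by simp
  have "cmod (?\<chi> t) = 1" for t
  proof -
    have "cnj (q 0) = q 0" using refl[of 0] by simp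
    then have "?\<chi> t * cnj (?\<chi> t) = 1" using mult[of t "- t"] q0 refl[of t] by simp
    then have "complex_of_real ((cmod (?\<chi> t))\<^sup>2) = of_real 1" unfolding complex_norm_square by simp
    then have "(cmod (?\<chi> t))\<^sup>2 = 1" by (simp only: of_real_eq_iff)
    then have "cmod (?\<chi> t) = 1 \<or> cmod (?\<chi> t) = -1" by (simp only: power2_eq_1_iff)
    then show ?thesis using norm_ge_zero[of "?\<chi> t"] by linarith
  qed
  moreover have "continuous_on UNIV ?\<chi>" using q0 by (intro continuous_intros) auto
  ultimately show ?thesis using mult unfolding dual_group_def by blast
qed

subsection \<open>An infinite compact group has infinitely many characters\<close>

text \<open>By invariance all points have the same mass, and arbitrarily many of them share the
  total mass 1.\<close>

lemma measure_singleton: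
  assumes "infinite (UNIV :: 'g set)"
  shows "emeasure m {0} = 0"
proof -
  have eq: "measure m {s} = measure m {0}" for s :: 'g
  proof -
    have "emeasure m ((+) s ` {0}) = emeasure m {0}"
    proof -
      have "{0 :: 'g} \<in> sets borel" by simp
      then show ?thesis using haar unfolding normalized_haar_measure_def by blast
    qed
    then have "emeasure m {s} = emeasure m {0}" by simp
    then show ?thesis unfolding measure_def by (rule arg_cong)
  qed
  have sets: "{s} \<in> sets m" for s :: 'g by (simp add: sets_m)
  have "real n * measure m {0} \<le> 1" for n
  proof -
    obtain S :: "'g set" where S: "finite S" "card S = n"
      using infinite_arbitrarily_large[OF assms] by blast
    have "measure m S = (\<Sum>s\<in>S. measure m {s})"
      using S(1) sets by (intro finite_measure_eq_sum_singleton) auto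
    also have "\<dots> = (\<Sum>s\<in>S. measure m {0})" by (intro sum.cong refl eq)
    also have "\<dots> = real n * measure m {0}" by (simp add: S(2))
    finally show ?thesis using finite_measure_mono[of S UNIV] by (simp add: sets_m)
  qed
  then have "\<not> 0 < measure m {0}"
    using reals_Archimedean3[of "measure m {0}"] by (meson linorder_not_le)
  then have "measure m {0} = 0" using measure_nonneg[of m "{0}"] by linarith
  then show ?thesis by (simp add: emeasure_eq_measure)
qed

text \<open>Outer regularity gives the null set \<open>{0}\<close> a neighborhood of small measure,
  and Urysohn's lemma a function living on it. Such functions show that no continuous function is a
  convolution unit on an infinite group.\<close>

lemma ex_bump:
  assumes "infinite (UNIV :: 'g set)" "0 < e"
  obtains h :: "'g \<Rightarrow>\<^sub>C complex" where "h 0 = 1" "(LINT t|m. cmod (h t)) < e"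
proof -
  have "{0 :: 'g} \<in> sets borel" by simp
  then have "emeasure m {0} = (INF U\<in>{U. open U \<and> {0} \<subseteq> U}. emeasure m U)"
    using haar unfolding normalized_haar_measure_def by blast
  then have "(INF U\<in>{U. open U \<and> {0} \<subseteq> U}. emeasure m U) = 0"
    using measure_singleton[OF assms(1)] by metis
  then have "(INF U\<in>{U. open U \<and> {0} \<subseteq> U}. emeasure m U) < ennreal e" using \<open>0 < e\<close> by simp
  then obtain U where U: "open U" "0 \<in> U" "emeasure m U < ennreal e"
    unfolding INF_less_iff by auto
  have "normal_space (euclidean :: 'g topology)"
  proof (rule compact_Hausdorff_or_regular_imp_normal_space)
    show "compact_space (euclidean :: 'g topology)" using cpt by (simp add: compact_space_def)
    show "Hausdorff_space (euclidean :: 'g topology) \<or> regular_space (euclidean :: 'g topology)"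
      using hausdorff by (auto simp: Hausdorff_space_def disjnt_def)
  qed
  then obtain f where f: "continuous_map euclidean (top_of_set {0..1::real}) f" "f ` (- U) \<subseteq> {0}" "f ` {0} \<subseteq> {1}"
    by (rule Urysohn_lemma[of euclidean "- U" "{0}" 0 1]) (use U in \<open>auto simp: disjnt_def\<close>)
  have cont: "continuous_on UNIV f" and range: "\<And>t. 0 \<le> f t \<and> f t \<le> 1"
    using f(1) by (auto simp: continuous_map_in_subtopology)
  define h where "h = Bcontfun (\<lambda>t. complex_of_real (f t))"
  have h: "apply_bcontfun h = (\<lambda>t. complex_of_real (f t))"
    unfolding h_def by (intro Bcontfun_apply cpt continuous_intros cont)
  show ?thesis
  proof (rule that)
    show "h 0 = 1" using f(3) by (simp add: h)
    have "(LINT t|m. cmod (h t)) \<le> (LINT t|m. indicator U t)"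
    proof (rule integral_mono)
      show "integrable m (indicator U :: 'g \<Rightarrow> real)"
        using U(1) by (intro integrable_real_indicator) (auto simp: sets_m less_top[symmetric])
      show "cmod (h t) \<le> indicator U t" for t
        using range[of t] f(2) by (auto simp: h indicator_def)
    qed (intro integrable_continuous continuous_intros)
    also have "\<dots> = measure m U" by simp
    also have "\<dots> < e" using U(3) by (simp add: emeasure_eq_measure ennreal_less_iff)
    finally show "(LINT t|m. cmod (h t)) < e" .
  qed
qed

text \<open>If there were finitely many characters, their sum \<open>D\<close> would be a
  convolution unit: any defect of this would be annihilated by all characters and yet produce a new
  one. But \<open>D\<close> is bounded, and a bump of small integral has value 1 at 0, which
  \<open>D \<star> h\<close> cannot reach.\<close>

theorem infinite_dual_group:
  assumes inf: "infinite (UNIV :: 'g set)"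
  shows "infinite (dual_group :: ('g \<Rightarrow> complex) set)"
proof
  assume fin: "finite (dual_group :: ('g \<Rightarrow> complex) set)"
  define b where "b \<gamma> = Bcontfun \<gamma>" for \<gamma> :: "'g \<Rightarrow> complex"
  have b: "apply_bcontfun (b \<gamma>) = \<gamma>" if "\<gamma> \<in> dual_group" for \<gamma>
    unfolding b_def by (rule Bcontfun_apply[OF cpt dual_groupD(1)[OF that]])
  define D where "D = (\<Sum>\<gamma>\<in>dual_group. b \<gamma>)"
  have b_conv: "b \<gamma> \<star> b \<delta> = (if \<gamma> = \<delta> then b \<delta> else 0)"
    if "\<gamma> \<in> dual_group" "\<delta> \<in> dual_group" for \<gamma> \<delta>
  proof (rule bcontfun_eqI)
    fix s
    have "(b \<gamma> \<star> b \<delta>) s = (LINT t|m. \<gamma> s * (\<delta> t * cnj (\<gamma> t)))"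
      using that by (simp add: conv_apply b dual_groupD(7) mult_ac)
    also have "\<dots> = \<gamma> s * (if \<delta> = \<gamma> then 1 else 0)"
      using integral_characters[OF that(2,1)] by simp
    finally show "(b \<gamma> \<star> b \<delta>) s = (if \<gamma> = \<delta> then b \<delta> else 0) s" using that by (simp add: b)
  qed
  have D_conv: "D \<star> b \<delta> = b \<delta>" if "\<delta> \<in> dual_group" for \<delta>
  proof -
    have "D \<star> b \<delta> = (\<Sum>\<gamma>\<in>dual_group. b \<gamma> \<star> b \<delta>)"
      unfolding D_def by (rule bounded_bilinear.sum_left[OF bounded_bilinear_conv])
    also have "\<dots> = (\<Sum>\<gamma>\<in>dual_group. if \<gamma> = \<delta> then b \<delta> else 0)"
      using b_conv that by (intro sum.cong) auto
    finally show ?thesis using fin that by simp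
  qed
  have unit: "h \<star> D = h" for h
  proof (rule ccontr)
    assume "h \<star> D \<noteq> h"
    define g where "g = h - h \<star> D"
    have "g \<noteq> 0" using \<open>h \<star> D \<noteq> h\<close> by (simp add: g_def)
    have g: "g \<star> b \<delta> = 0" if "\<delta> \<in> dual_group" for \<delta>
      by (simp add: g_def conv_diff_left conv_assoc D_conv that)
    \<comment> \<open>\<open>g\<close> need not be self-adjoint. \<open>k\<close> is, has the value
      \<open>sqnorm g\<close> at 0, and is still annihilated by every character.\<close>
    define k where "k = g \<star> adj g"
    have "adj k = k" by (simp add: k_def adj_conv conv_commute)
    moreover have "k \<noteq> 0" using conv_adj_0[of g] sqnorm_pos[OF \<open>g \<noteq> 0\<close>] by (auto simp: k_def)
    moreover have k: "k \<star> b \<delta> = 0" if "\<delta> \<in> dual_group" for \<delta>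
      using g[OF that] by (metis conv_assoc conv_commute conv_zero_right k_def)
    ultimately obtain p where p: "idem p" "\<And>\<delta>. \<delta> \<in> dual_group \<Longrightarrow> p \<star> b \<delta> = 0"
      using ex_top_idem[of k] by metis
    obtain q where q: "idem q" "q \<star> p = q" "\<And>r. idem r \<Longrightarrow> r \<star> q = r \<Longrightarrow> r = q"
      using ex_minimal_idem[OF p(1)] by metis
    let ?\<chi> = "\<lambda>t. q t / q 0"
    have \<chi>: "?\<chi> \<in> dual_group" using minimal_idem_character[OF q(1,3)] .
    have q0: "q 0 \<noteq> 0" using idem_at_0[OF q(1)] sqnorm_idem[OF q(1)] by simp
    \<comment> \<open>\<open>q\<close> is a multiple of its own character, while convolution with
      any character kills it; so \<open>q = q \<star> q\<close> would vanish.\<close>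
    have "q = q 0 *\<^sub>C b ?\<chi>"
      using q0 by (intro bcontfun_eqI) (simp add: b[OF \<chi>] scaleC_complex_def)
    then have "q \<star> q = q 0 *\<^sub>C (q \<star> b ?\<chi>)" by (metis conv_scaleC_right)
    also have "q \<star> b ?\<chi> = 0" using p(2)[OF \<chi>] q(2) by (metis conv_assoc conv_zero_right)
    finally show False using q(1) by (auto simp: idem_def scaleC_zero)
  qed
  define N where "N = real (card (dual_group :: ('g \<Rightarrow> complex) set)) + 1"
  obtain h :: "'g \<Rightarrow>\<^sub>C complex" where h: "h 0 = 1" "(LINT t|m. cmod (h t)) < 1 / N"
    using ex_bump[OF inf, of "1 / N"] by (auto simp: N_def add_nonneg_pos)
  have D_le: "cmod (D t) \<le> N" for t
  proof -
    have "cmod (D t) \<le> (\<Sum>\<gamma>\<in>dual_group. cmod (b \<gamma> t))"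
      unfolding D_def sum_bcontfun_apply by (rule norm_sum)
    also have "\<dots> = (\<Sum>\<gamma>\<in>(dual_group :: ('g \<Rightarrow> complex) set). 1)"
      by (intro sum.cong refl) (simp add: b dual_groupD(2))
    finally show ?thesis by (simp add: N_def)
  qed
  have "1 = cmod ((D \<star> h) 0)" using unit[of h] h(1) by (simp add: conv_commute)
  also have "\<dots> \<le> (LINT t|m. cmod (D (0 - t) * h t))"
    unfolding conv_apply by (rule integral_norm_bound)
  also have "\<dots> \<le> (LINT t|m. N * cmod (h t))"
    by (intro integral_mono_continuous continuous_intros)
      (auto simp: norm_mult intro!: mult_right_mono D_le)
  also have "\<dots> = N * (LINT t|m. cmod (h t))" by simp
  also have "\<dots> < N * (1 / N)"
    using h(2) by (intro mult_strict_left_mono) (auto simp: N_def add_nonneg_pos)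
  also have "\<dots> = 1" by (simp add: N_def)
  finally show False by simp
qed

end

section \<open>Convolution operators factoring through a Hilbert space\<close>

text \<open>Assertion (3) speaks of sequences, the coefficients are indexed by characters. A single
  \<open>d\<close> has to serve the weak sums, the squares and the images under \<open>T\<close> at
  once, so \<psi> is quantified after \<open>d\<close>.\<close>

lemma countable_family_sequence:
  fixes x :: "'i \<Rightarrow> 'a::zero"
  assumes "countable {i\<in>I. x i \<noteq> 0}"
  obtains d :: "nat \<Rightarrow> 'a" where
    "\<And>\<psi> :: 'a \<Rightarrow> real. \<psi> 0 = 0 \<Longrightarrow> (\<And>a. 0 \<le> \<psi> a) \<Longrightarrow>
      summable (\<lambda>n. \<psi> (d n)) \<longleftrightarrow> (\<lambda>i. \<psi> (x i)) summable_on I"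
proof -
  define S where "S = {i\<in>I. x i \<noteq> 0}"
  define r where "r = to_nat_on S"
  have inj: "inj_on r S" unfolding r_def S_def using assms by (rule inj_on_to_nat_on)
  \<comment> \<open>Indices outside the image carry 0, where \<psi> vanishes; this also covers a
    finite support.\<close>
  define d where "d n = (if n \<in> r ` S then x (inv_into S r n) else 0)" for n
  have dr: "d (r i) = x i" if "i \<in> S" for i using that inj by (simp add: d_def)
  show ?thesis
  proof (rule that)
    fix \<psi> :: "'a \<Rightarrow> real" assume \<psi>: "\<psi> 0 = 0" "\<And>a. 0 \<le> \<psi> a"
    have "summable (\<lambda>n. \<psi> (d n)) \<longleftrightarrow> (\<lambda>n. \<psi> (d n)) summable_on UNIV"
      using \<psi>(2) by (intro summable_on_UNIV_nonneg_real_iff[symmetric])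
    also have "\<dots> \<longleftrightarrow> (\<lambda>n. \<psi> (d n)) summable_on r ` S"
      by (rule summable_on_cong_neutral) (auto simp: d_def \<psi>(1))
    also have "\<dots> \<longleftrightarrow> ((\<lambda>n. \<psi> (d n)) \<circ> r) summable_on S"
      by (rule summable_on_reindex[OF inj])
    also have "\<dots> \<longleftrightarrow> (\<lambda>i. \<psi> (x i)) summable_on I"
      by (rule summable_on_cong_neutral) (auto simp: dr S_def \<psi>(1))
    finally show "summable (\<lambda>n. \<psi> (d n)) \<longleftrightarrow> (\<lambda>i. \<psi> (x i)) summable_on I" .
  qed
qed

text \<open>What remains of the first factor \<open>A\<close> of a factorization: the pulled-back
  inner product of \<open>A x\<close> and \<open>A y\<close>, possibly degenerate, with
  \<open>K\<close> bounding the norm of \<open>A\<close>.\<close>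

locale hermitian_form =
  fixes S :: "'a::complex_normed_vector \<Rightarrow> 'a \<Rightarrow> complex" and K :: real
  assumes add_left: "S (x + y) z = S x z + S y z"
    and scale_left: "S (c *\<^sub>C x) z = c * S x z"
    and commute: "S x y = cnj (S y x)"
    and nonneg: "0 \<le> Re (S x x)"
    and bound: "Re (S x x) \<le> (K * norm x)\<^sup>2"
begin

lemma zero_left [simp]: "S 0 z = 0"
  using add_left[of 0 0 z] by simp

lemma add_right: "S z (x + y) = S z x + S z y"
  by (metis add_left commute complex_cnj_add)

lemma scale_right: "S z (c *\<^sub>C x) = cnj c * S z x"
  by (metis scale_left commute complex_cnj_mult)

lemma sum_left: "S (\<Sum>i\<in>I. f i) z = (\<Sum>i\<in>I. S (f i) z)"
  by (induction I rule: infinite_finite_induct) (auto simp: add_left)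

lemma sum_right: "S z (\<Sum>i\<in>I. f i) = (\<Sum>i\<in>I. S z (f i))"
  using zero_left[of z] commute[of z 0]
  by (induction I rule: infinite_finite_induct) (auto simp: add_right)

text \<open>Positivity of the form at \<open>x - p y\<close>. Unlike the Cauchy-Schwarz inequality,
  the bound is linear in \<open>p\<close>, so it can be summed against weights that form a
  partition.\<close>

lemma Re_le:
  assumes "norm x \<le> p"
  shows "Re (S x y) \<le> p / 2 * (K\<^sup>2 + Re (S y y))"
proof (cases "p = 0")
  case True
  then show ?thesis using assms by simp
next
  case False
  then have "0 < p" using assms norm_ge_zero[of x] by linarith
  let ?d = "x + of_real (- p) *\<^sub>C y"
  have "0 \<le> Re (S ?d ?d)" by (rule nonneg)
  also have "S ?d ?d = S x x - of_real p * (S x y + S y x) + of_real (p\<^sup>2) * S y y"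
    by (simp add: add_left add_right scale_left scale_right power2_eq_square algebra_simps)
  also have "Re \<dots> = Re (S x x) - 2 * p * Re (S x y) + p\<^sup>2 * Re (S y y)"
    using commute[of y x] by (simp del: of_real_power)
  finally have "2 * p * Re (S x y) \<le> Re (S x x) + p\<^sup>2 * Re (S y y)" by simp
  also have "Re (S x x) \<le> K\<^sup>2 * p\<^sup>2"
  proof -
    have "(K * norm x)\<^sup>2 \<le> K\<^sup>2 * p\<^sup>2"
      unfolding power_mult_distrib using assms by (intro mult_left_mono power_mono) auto
    then show ?thesis using bound[of x] by linarith
  qed
  finally have "p * (2 * Re (S x y)) \<le> p * (p * (K\<^sup>2 + Re (S y y)))"
    by (simp add: power2_eq_square algebra_simps)
  then show ?thesis using \<open>0 < p\<close> by simp
qed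

end

context compact_haar
begin

text \<open>Orthogonality of characters removes the mixed terms. The coefficients
  \<open>x \<gamma>\<close> are arbitrary so that unimodular factors can be inserted later.\<close>

lemma Hermitian_Parseval:
  assumes S: "hermitian_form S K" and F: "F \<subseteq> dual_group"
  defines "\<psi> \<equiv> \<lambda>x s. Re (S (\<Sum>\<gamma>\<in>F. cnj (\<gamma> s) *\<^sub>C x \<gamma>) (\<Sum>\<gamma>\<in>F. cnj (\<gamma> s) *\<^sub>C x \<gamma>))"
  shows "continuous_on UNIV (\<psi> x)" and "(LINT s|m. \<psi> x s) = (\<Sum>\<gamma>\<in>F. Re (S (x \<gamma>) (x \<gamma>)))"
proof -
  interpret S: hermitian_form S K by fact
  let ?f = "\<lambda>\<gamma> \<delta> s. S (x \<gamma>) (x \<delta>) * (\<delta> s * cnj (\<gamma> s))"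
  have \<psi>: "\<psi> x = (\<lambda>s. Re (\<Sum>\<gamma>\<in>F. \<Sum>\<delta>\<in>F. ?f \<gamma> \<delta> s))"
    unfolding \<psi>_def S.sum_left unfolding S.sum_right S.scale_left S.scale_right
    by (simp add: mult_ac)
  have c: "continuous_on UNIV (?f \<gamma> \<delta>)" if "\<gamma> \<in> F" "\<delta> \<in> F" for \<gamma> \<delta>
    using that F dual_groupD(1) by (intro continuous_intros) auto
  have c2: "continuous_on UNIV (\<lambda>s. \<Sum>\<gamma>\<in>F. \<Sum>\<delta>\<in>F. ?f \<gamma> \<delta> s)"
    by (intro continuous_on_sum c)
  then show "continuous_on UNIV (\<psi> x)" unfolding \<psi> by (rule continuous_on_Re)
  have "(LINT s|m. \<psi> x s) = Re (LINT s|m. (\<Sum>\<gamma>\<in>F. \<Sum>\<delta>\<in>F. ?f \<gamma> \<delta> s))"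
    unfolding \<psi> by (rule integral_Re[OF integrable_continuous[OF c2]])
  also have "(LINT s|m. (\<Sum>\<gamma>\<in>F. \<Sum>\<delta>\<in>F. ?f \<gamma> \<delta> s)) = (\<Sum>\<gamma>\<in>F. LINT s|m. (\<Sum>\<delta>\<in>F. ?f \<gamma> \<delta> s))"
    by (intro Bochner_Integration.integral_sum integrable_continuous continuous_on_sum c)
  also have "\<dots> = (\<Sum>\<gamma>\<in>F. \<Sum>\<delta>\<in>F. LINT s|m. ?f \<gamma> \<delta> s)"
    by (intro sum.cong refl Bochner_Integration.integral_sum integrable_continuous c)
  also have "\<dots> = (\<Sum>\<gamma>\<in>F. \<Sum>\<delta>\<in>F. if \<delta> = \<gamma> then S (x \<gamma>) (x \<gamma>) else 0)"
    using F by (intro sum.cong refl) (auto simp: integral_characters subset_iff)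
  also have "\<dots> = (\<Sum>\<gamma>\<in>F. S (x \<gamma>) (x \<gamma>))"
    by (cases "finite F") simp_all
  finally show "(LINT s|m. \<psi> x s) = (\<Sum>\<gamma>\<in>F. Re (S (x \<gamma>) (x \<gamma>)))" by simp
qed

text \<open>Dual to the fact that bounded operators from a Hilbert space to \<open>C(G)\<close> are Hilbert-Schmidt
  into \<open>L\<^sup>2\<close>. The vector-valued polynomial \<open>w\<close> is tested against itself, with the characters
  replaced by their averages over a fine partition of unity.\<close>

lemma Hermitian_Bessel:
  assumes S: "hermitian_form S K" and F: "finite F" "F \<subseteq> dual_group"
  shows "(\<Sum>\<gamma>\<in>F. Re (S (dens \<gamma>) (dens \<gamma>))) \<le> K\<^sup>2"
proof -
  interpret S: hermitian_form S K by fact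
  note cont = dual_groupD(1)[OF subsetD[OF F(2)]]
  define Q where "Q = (\<Sum>\<gamma>\<in>F. Re (S (dens \<gamma>) (dens \<gamma>)))"
  \<comment> \<open>Formally, \<open>dens \<gamma>\<close> is the integral of \<gamma>(t) times the
    point mass at t, so \<open>Q\<close> is the average over t of \<open>S\<close> at that point
    mass and \<open>w t\<close>. By \<open>Re_le\<close> with p = 1 the real part of the integrand
    is at most \<open>(K\<^sup>2 + \<psi> t) / 2\<close>, whose average is
    \<open>(K\<^sup>2 + Q) / 2\<close>. Point masses do not depend norm-continuously on t; the
    measures \<open>\<nu> i\<close> below take their place.\<close>
  define w where "w s = (\<Sum>\<gamma>\<in>F. cnj (\<gamma> s) *\<^sub>C dens \<gamma>)" for s
  define \<psi> where "\<psi> s = Re (S (w s) (w s))" for s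
  have \<psi>_cont: "continuous_on UNIV \<psi>" and \<psi>_int: "(LINT s|m. \<psi> s) = Q"
    using Hermitian_Parseval[OF S F(2), of dens] by (simp_all add: \<psi>_def[abs_def] w_def Q_def)
  have est: "2 * Q \<le> e * (card F * K\<^sup>2 + Q) + (K\<^sup>2 + Q + e)" if "0 < e" for e
  proof -
    \<comment> \<open>The first term controls the error of replacing characters by their values at
      the anchors, the second that of returning from \<open>\<psi> i\<close> to
      \<open>\<psi> t\<close>.\<close>
    define d where "d t i = (\<Sum>\<gamma>\<in>F. cmod (\<gamma> t - \<gamma> i)) + \<bar>\<psi> t - \<psi> i\<bar>" for t i
    have d_cont: "continuous_on UNIV (\<lambda>t. d t i)" for i
      unfolding d_def by (intro continuous_intros \<psi>_cont cont)
    have d_zero: "d i i = 0" for i by (simp add: d_def)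
    obtain I and \<phi> :: "'g \<Rightarrow> 'g \<Rightarrow> real" where I: "finite I"
      and \<phi>: "\<And>i. continuous_on UNIV (\<phi> i)" "\<And>i t. 0 \<le> \<phi> i t" "\<And>t. (\<Sum>i\<in>I. \<phi> i t) = 1"
      and near: "\<And>i t. \<phi> i t \<noteq> 0 \<Longrightarrow> d t i < e"
      by (rule partition_of_unity[OF cpt d_cont d_zero \<open>0 < e\<close>]) (rule that)
    define p where "p i = (LINT t|m. \<phi> i t)" for i
    define \<nu> where "\<nu> i = dens (\<lambda>t. of_real (\<phi> i t))" for i
    have \<nu>_apply: "\<nu> i h = (LINT t|m. of_real (\<phi> i t) * h t)" for i h
      unfolding \<nu>_def by (intro dens_apply continuous_intros \<phi>(1))
    have \<nu>_norm: "norm (\<nu> i) \<le> p i" for i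
      using norm_dens[of "\<lambda>t. complex_of_real (\<phi> i t)"] \<phi>(2)
      by (simp add: \<nu>_def p_def continuous_on_of_real \<phi>(1))
    define r where "r \<gamma> = dens \<gamma> - (\<Sum>i\<in>I. \<gamma> i *\<^sub>C \<nu> i)" for \<gamma> :: "'g \<Rightarrow> complex"
    have r_norm: "norm (r \<gamma>) \<le> e" if \<gamma>: "\<gamma> \<in> F" for \<gamma>
    proof (rule norm_cblinfun_bound)
      fix h :: "'g \<Rightarrow>\<^sub>C complex"
      have i1: "integrable m (\<lambda>t. \<gamma> t * h t)" and i2: "integrable m (\<lambda>t. of_real (\<phi> i t) * h t)" for i
        by (intro integrable_continuous continuous_intros cont[OF \<gamma>] \<phi>(1))+
      have "r \<gamma> h = (LINT t|m. \<gamma> t * h t) - (\<Sum>i\<in>I. \<gamma> i * (LINT t|m. of_real (\<phi> i t) * h t))"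
        by (simp add: r_def cblinfun_sum_left scaleC_complex_def \<nu>_apply dens_apply[OF cont[OF \<gamma>]])
      also have "\<dots> = (LINT t|m. \<gamma> t * h t - (\<Sum>i\<in>I. \<gamma> i * (of_real (\<phi> i t) * h t)))"
        using i1 i2 by simp
      also have "cmod \<dots> \<le> e * norm h"
      proof (rule integral_norm_le)
        show "continuous_on UNIV (\<lambda>t. \<gamma> t * h t - (\<Sum>i\<in>I. \<gamma> i * (of_real (\<phi> i t) * h t)))"
          by (intro continuous_intros cont[OF \<gamma>] \<phi>(1))
        fix t
        have "\<gamma> t * h t - (\<Sum>i\<in>I. \<gamma> i * (of_real (\<phi> i t) * h t))
            = (\<Sum>i\<in>I. of_real (\<phi> i t)) * (\<gamma> t * h t) - (\<Sum>i\<in>I. \<gamma> i * (of_real (\<phi> i t) * h t))"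
          using \<phi>(3)[of t] by (simp add: of_real_sum[symmetric] del: of_real_sum)
        also have "\<dots> = (\<Sum>i\<in>I. of_real (\<phi> i t) * (\<gamma> t - \<gamma> i)) * h t"
          by (simp add: sum_distrib_right sum_distrib_left right_diff_distrib left_diff_distrib sum_subtractf mult_ac)
        also have "cmod \<dots> \<le> e * norm h"
          unfolding norm_mult
        proof (intro mult_mono norm_bounded)
          have "cmod (\<Sum>i\<in>I. of_real (\<phi> i t) * (\<gamma> t - \<gamma> i)) \<le> (\<Sum>i\<in>I. \<phi> i t * e)"
          proof (rule sum_norm_le)
            fix i
            show "cmod (of_real (\<phi> i t) * (\<gamma> t - \<gamma> i)) \<le> \<phi> i t * e"
            proof (cases "\<phi> i t = 0")
              case False
              have "cmod (\<gamma> t - \<gamma> i) \<le> (\<Sum>\<gamma>\<in>F. cmod (\<gamma> t - \<gamma> i))"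
                using F(1) \<gamma> by (intro member_le_sum) auto
              also have "\<dots> \<le> e" using near[OF False] by (simp add: d_def)
              finally show ?thesis using \<phi>(2)[of i t] by (simp add: norm_mult mult_left_mono)
            qed simp
          qed
          then show "cmod (\<Sum>i\<in>I. of_real (\<phi> i t) * (\<gamma> t - \<gamma> i)) \<le> e"
            using \<phi>(3)[of t] by (simp add: sum_distrib_right[symmetric])
        qed (use \<open>0 < e\<close> in auto)
        finally show "norm (\<gamma> t * h t - (\<Sum>i\<in>I. \<gamma> i * (of_real (\<phi> i t) * h t))) \<le> e * norm h" .
      qed
      finally show "norm (r \<gamma> h) \<le> e * norm h" .
    qed (use \<open>0 < e\<close> in simp)
    have "(\<Sum>\<gamma>\<in>F. S (dens \<gamma>) (dens \<gamma>)) = (\<Sum>\<gamma>\<in>F. S (r \<gamma> + (\<Sum>i\<in>I. \<gamma> i *\<^sub>C \<nu> i)) (dens \<gamma>))"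
      by (simp add: r_def)
    also have "\<dots> = (\<Sum>\<gamma>\<in>F. S (r \<gamma>) (dens \<gamma>)) + (\<Sum>\<gamma>\<in>F. \<Sum>i\<in>I. \<gamma> i * S (\<nu> i) (dens \<gamma>))"
      by (simp only: S.add_left S.sum_left S.scale_left sum.distrib)
    also have "(\<Sum>\<gamma>\<in>F. \<Sum>i\<in>I. \<gamma> i * S (\<nu> i) (dens \<gamma>)) = (\<Sum>i\<in>I. \<Sum>\<gamma>\<in>F. \<gamma> i * S (\<nu> i) (dens \<gamma>))"
      by (rule sum.swap)
    also have "\<dots> = (\<Sum>i\<in>I. S (\<nu> i) (w i))"
      by (simp add: w_def S.sum_right S.scale_right)
    finally have "Q = (\<Sum>\<gamma>\<in>F. Re (S (r \<gamma>) (dens \<gamma>))) + (\<Sum>i\<in>I. Re (S (\<nu> i) (w i)))"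
      unfolding Q_def by (metis Re_sum plus_complex.simps(1))
    also have "(\<Sum>\<gamma>\<in>F. Re (S (r \<gamma>) (dens \<gamma>))) \<le> (\<Sum>\<gamma>\<in>F. e / 2 * (K\<^sup>2 + Re (S (dens \<gamma>) (dens \<gamma>))))"
      by (intro sum_mono S.Re_le r_norm)
    also have "\<dots> = e / 2 * (card F * K\<^sup>2 + Q)"
      unfolding sum_distrib_left[symmetric] by (simp add: Q_def sum.distrib)
    also have "(\<Sum>i\<in>I. Re (S (\<nu> i) (w i))) \<le> (\<Sum>i\<in>I. p i / 2 * (K\<^sup>2 + \<psi> i))"
      unfolding \<psi>_def by (intro sum_mono S.Re_le \<nu>_norm)
    also have "\<dots> = (\<Sum>i\<in>I. LINT t|m. \<phi> i t * ((K\<^sup>2 + \<psi> i) / 2))"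
      by (simp add: p_def)
    also have "\<dots> = (LINT t|m. (\<Sum>i\<in>I. \<phi> i t * ((K\<^sup>2 + \<psi> i) / 2)))"
      by (intro Bochner_Integration.integral_sum[symmetric] integrable_continuous continuous_intros \<phi>(1))
    also have "\<dots> \<le> (LINT t|m. (K\<^sup>2 + \<psi> t + e) / 2)"
    proof (rule integral_mono_continuous)
      fix t
      have "(\<Sum>i\<in>I. \<phi> i t * ((K\<^sup>2 + \<psi> i) / 2)) \<le> (\<Sum>i\<in>I. \<phi> i t * ((K\<^sup>2 + \<psi> t + e) / 2))"
      proof (rule sum_mono)
        fix i
        show "\<phi> i t * ((K\<^sup>2 + \<psi> i) / 2) \<le> \<phi> i t * ((K\<^sup>2 + \<psi> t + e) / 2)"
        proof (cases "\<phi> i t = 0")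
          case False
          have "0 \<le> (\<Sum>\<gamma>\<in>F. cmod (\<gamma> t - \<gamma> i))" by (intro sum_nonneg) auto
          then have "\<psi> i \<le> \<psi> t + e" using near[OF False] unfolding d_def by linarith
          then show ?thesis using \<phi>(2)[of i t] by (intro mult_left_mono) auto
        qed simp
      qed
      also have "\<dots> = (K\<^sup>2 + \<psi> t + e) / 2"
        unfolding sum_distrib_right[symmetric] using \<phi>(3)[of t] by simp
      finally show "(\<Sum>i\<in>I. \<phi> i t * ((K\<^sup>2 + \<psi> i) / 2)) \<le> (K\<^sup>2 + \<psi> t + e) / 2" .
    qed (intro continuous_intros \<phi>(1) \<psi>_cont; simp)+
    also have "\<dots> = (K\<^sup>2 + Q + e) / 2"
      using integrable_continuous[OF \<psi>_cont] by (simp add: \<psi>_int)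
    finally show ?thesis by (simp add: field_simps)
  qed
  have "Q \<le> K\<^sup>2"
  proof (rule field_le_epsilon)
    fix e :: real assume "0 < e"
    \<comment> \<open>With \<open>e / c\<close> in \<open>est\<close> the two error terms add up to
      exactly \<open>e\<close>.\<close>
    define c where "c = card F * K\<^sup>2 + Q + 1"
    have "0 \<le> Q" unfolding Q_def by (intro sum_nonneg S.nonneg)
    then have "0 < c" by (auto simp: c_def intro: add_nonneg_pos)
    then have "2 * Q \<le> e / c * (card F * K\<^sup>2 + Q) + (K\<^sup>2 + Q + e / c)"
      using \<open>0 < e\<close> by (intro est) simp
    also have "\<dots> = e / c * c + (K\<^sup>2 + Q)"
    proof -
      have "card F * K\<^sup>2 + Q = c - 1" by (simp add: c_def)
      then show ?thesis by (simp add: right_diff_distrib)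
    qed
    also have "\<dots> = e + (K\<^sup>2 + Q)" using \<open>0 < c\<close> by simp
    finally show "Q \<le> K\<^sup>2 + e" by simp
  qed
  then show ?thesis by (simp add: Q_def)
qed

section \<open>Fourier coefficients of functions whose convolution operator factors\<close>

lemma convolution_dual:
  fixes f :: "'g \<Rightarrow>\<^sub>C 'x::complex_banach"
  shows "cblinfun_apply x' (convolution f \<mu> s) = cmeasure_integral \<mu> (\<lambda>t. x' (f (s - t)))"
  unfolding convolution_def
  by (rule weak_integral[OF cpt], rule continuous_on_compose2[OF continuous_on_apply_bcontfun[of UNIV f]])
    (auto intro!: continuous_intros)

lemma convolution_dens_sum:
  fixes f :: "'g \<Rightarrow>\<^sub>C 'x::complex_banach"
  assumes F: "F \<subseteq> dual_group"
  shows "convolution f (\<Sum>\<gamma>\<in>F. c \<gamma> *\<^sub>C dens \<gamma>) s = (\<Sum>\<gamma>\<in>F. (c \<gamma> * \<gamma> s) *\<^sub>C fourier_coeff m f \<gamma>)"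
proof (rule cdual_separates)
  fix x' :: "'x cdual"
  have f: "continuous_on UNIV (\<lambda>t. x' (f (s - t)))" for s
    by (intro continuous_intros, rule continuous_on_compose2[OF continuous_on_apply_bcontfun[of UNIV f]])
      (auto intro!: continuous_intros)
  have f0: "continuous_on UNIV (\<lambda>t. x' (f t))" by (intro continuous_intros continuous_on_apply_bcontfun)
  have "cmeasure_integral (dens \<gamma>) (\<lambda>t. x' (f (s - t))) = \<gamma> s * x' (fourier_coeff m f \<gamma>)" if "\<gamma> \<in> F" for \<gamma>
  proof -
    note \<gamma> = dual_groupD[OF subsetD[OF F that]]
    have "cmeasure_integral (dens \<gamma>) (\<lambda>t. x' (f (s - t))) = (LINT t|m. \<gamma> (s - (s - t)) * x' (f (s - t)))"
      using cmeasure_integral_dens[OF \<gamma>(1) f] by simp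
    also have "\<dots> = (LINT t|m. \<gamma> (s - t) * x' (f t))"
      by (rule integral_reflect, intro continuous_intros f0, rule continuous_on_compose2[OF \<gamma>(1)])
        (auto intro!: continuous_intros)
    also have "\<dots> = (LINT t|m. \<gamma> s * (cnj (\<gamma> t) * x' (f t)))" by (simp add: \<gamma>(7) mult.assoc)
    finally show ?thesis by (simp add: fourier_coeff_dual[OF \<gamma>(1)])
  qed
  then show "x' (convolution f (\<Sum>\<gamma>\<in>F. c \<gamma> *\<^sub>C dens \<gamma>) s) =
      x' (\<Sum>\<gamma>\<in>F. (c \<gamma> * \<gamma> s) *\<^sub>C fourier_coeff m f \<gamma>)"
    by (simp add: convolution_dual cmeasure_integral_def cblinfun_sum_left cblinfun_sum_right
        cblinfun_scaleC_right scaleC_complex_def mult.assoc)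
qed

lemma factorization_form:
  fixes f :: "'g \<Rightarrow>\<^sub>C 'x::complex_banach"
  assumes "factors_through_hilbert_space f"
  obtains S K where "hermitian_form S K" "\<And>\<mu> s. (norm (convolution f \<mu> s))\<^sup>2 \<le> K\<^sup>2 * Re (S \<mu> \<mu>)"
proof -
  obtain H :: "('g cmeasure \<Rightarrow> complex) hilbert_ops" and A and B :: "_ \<Rightarrow> ('g \<Rightarrow>\<^sub>C 'x)" where
    H: "hilbert_space H" and A: "bounded_into H A" and B: "bounded_from H B"
    and AB: "\<And>\<mu>. apply_bcontfun (B (A \<mu>)) = convolution f \<mu>"
    using assms unfolding factors_through_hilbert_space_def factors_through_def by auto
  interpret H: hilbert_space H by fact
  have A_in: "A \<mu> \<in> hcarrier H" for \<mu> using A by (simp add: bounded_into_def)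
  obtain K\<^sub>1 where K1: "\<And>\<mu>. hnorm H (A \<mu>) \<le> K\<^sub>1 * norm \<mu>" using A by (auto simp: bounded_into_def)
  obtain K\<^sub>2 where K2: "\<And>x. x \<in> hcarrier H \<Longrightarrow> norm (B x) \<le> K\<^sub>2 * hnorm H x"
    using B unfolding bounded_from_def by blast
  define K where "K = \<bar>K\<^sub>1\<bar> + \<bar>K\<^sub>2\<bar>"
  define S where "S \<mu> \<nu> = hinner H (A \<mu>) (A \<nu>)" for \<mu> \<nu>
  have SA: "Re (S \<mu> \<mu>) = (hnorm H (A \<mu>))\<^sup>2" for \<mu> by (simp add: S_def H.hnorm_square A_in)
  have form: "hermitian_form S K"
  proof
    fix \<mu> \<nu> \<rho> :: "'g cmeasure" and c
    show "S (\<mu> + \<nu>) \<rho> = S \<mu> \<rho> + S \<nu> \<rho>" "S (c *\<^sub>C \<mu>) \<rho> = c * S \<mu> \<rho>"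
      using A A_in by (simp_all add: S_def bounded_into_def H.inner_add_left H.inner_scale_left)
    show "S \<mu> \<nu> = cnj (S \<nu> \<mu>)" unfolding S_def by (intro H.inner_commute A_in)
    show "0 \<le> Re (S \<mu> \<mu>)" by (simp add: SA)
    have "hnorm H (A \<mu>) \<le> K * norm \<mu>"
      by (rule order_trans[OF K1 mult_right_mono]) (auto simp: K_def)
    then show "Re (S \<mu> \<mu>) \<le> (K * norm \<mu>)\<^sup>2"
      unfolding SA using H.hnorm_nonneg[OF A_in] by (intro power_mono)
  qed
  have "(norm (convolution f \<mu> s))\<^sup>2 \<le> K\<^sup>2 * Re (S \<mu> \<mu>)" for \<mu> s
  proof -
    have "norm (convolution f \<mu> s) \<le> norm (B (A \<mu>))" unfolding AB[symmetric] by (rule norm_bounded)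
    also have "\<dots> \<le> K\<^sub>2 * hnorm H (A \<mu>)" using A_in by (rule K2)
    also have "\<dots> \<le> K * hnorm H (A \<mu>)"
      using H.hnorm_nonneg[OF A_in] by (intro mult_right_mono) (auto simp: K_def)
    finally show ?thesis unfolding SA power_mult_distrib[symmetric] by (intro power_mono) auto
  qed
  with form that show ?thesis by blast
qed

lemma fourier_coeff_bounds:
  fixes f :: "'g \<Rightarrow>\<^sub>C 'x::complex_banach"
  assumes "factors_through_hilbert_space f"
  obtains C where
    "\<And>F. finite F \<Longrightarrow> F \<subseteq> dual_group \<Longrightarrow> (\<Sum>\<gamma>\<in>F. (norm (fourier_coeff m f \<gamma>))\<^sup>2) \<le> C"
    "\<And>F x'. finite F \<Longrightarrow> F \<subseteq> dual_group \<Longrightarrow>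
      (\<Sum>\<gamma>\<in>F. cmod (cblinfun_apply x' (fourier_coeff m f \<gamma>))) \<le> norm x' * C"
proof -
  obtain S K where S: "hermitian_form S K"
    and conv: "\<And>\<mu> s. (norm (convolution f \<mu> s))\<^sup>2 \<le> K\<^sup>2 * Re (S \<mu> \<mu>)"
    by (rule factorization_form[OF assms]) (rule that)
  interpret S: hermitian_form S K by fact
  show ?thesis
  proof (rule that)
    fix F :: "('g \<Rightarrow> complex) set" assume F: "finite F" "F \<subseteq> dual_group"
    have "(\<Sum>\<gamma>\<in>F. (norm (fourier_coeff m f \<gamma>))\<^sup>2) \<le> (\<Sum>\<gamma>\<in>F. K\<^sup>2 * Re (S (dens \<gamma>) (dens \<gamma>)))"
    proof (rule sum_mono)
      fix \<gamma> assume "\<gamma> \<in> F"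
      then have \<gamma>: "{\<gamma>} \<subseteq> dual_group" using F by auto
      have one: "1 *\<^sub>C z = z" for z :: "'b::complex_normed_vector" using scaleC_of_real[of 1 z] by simp
      have "convolution f (dens \<gamma>) 0 = fourier_coeff m f \<gamma>"
        using convolution_dens_sum[OF \<gamma>, of f "\<lambda>_. 1" 0] \<gamma> by (simp add: one dual_groupD(5))
      then show "(norm (fourier_coeff m f \<gamma>))\<^sup>2 \<le> K\<^sup>2 * Re (S (dens \<gamma>) (dens \<gamma>))"
        using conv[of "dens \<gamma>" 0] by simp
    qed
    also have "\<dots> \<le> K\<^sup>2 * K\<^sup>2"
      unfolding sum_distrib_left[symmetric] by (intro mult_left_mono Hermitian_Bessel[OF S F]) auto
    \<comment> \<open>The squares need the constant \<open>K\<^sup>2 * K\<^sup>2\<close>, the weak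
      sums \<open>K\<^sup>2\<close>; this one dominates both.\<close>
    also have "\<dots> \<le> K\<^sup>2 * (K\<^sup>2 + 1)" by (simp add: algebra_simps)
    finally show "(\<Sum>\<gamma>\<in>F. (norm (fourier_coeff m f \<gamma>))\<^sup>2) \<le> K\<^sup>2 * (K\<^sup>2 + 1)" .
  next
    fix F :: "('g \<Rightarrow> complex) set" and x' :: "'x cdual" assume F: "finite F" "F \<subseteq> dual_group"
    define a where "a \<gamma> = x' (fourier_coeff m f \<gamma>)" for \<gamma>
    \<comment> \<open>Unimodular factors that make all terms nonnegative, so that no cancellation
      occurs; they leave the form at \<open>dens \<gamma>\<close> unchanged.\<close>
    define \<theta> where "\<theta> \<gamma> = (if a \<gamma> = 0 then 1 else cnj (sgn (a \<gamma>)))" for \<gamma>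
    have \<theta>: "cmod (\<theta> \<gamma>) = 1" "\<theta> \<gamma> * a \<gamma> = of_real (cmod (a \<gamma>))" for \<gamma>
    proof -
      show "cmod (\<theta> \<gamma>) = 1" by (simp add: \<theta>_def norm_sgn)
      show "\<theta> \<gamma> * a \<gamma> = of_real (cmod (a \<gamma>))"
        by (simp add: \<theta>_def sgn_div_norm scaleR_conv_of_real field_simps complex_norm_square[symmetric] power2_eq_square)
    qed
    define y where "y \<gamma> = \<theta> \<gamma> *\<^sub>C dens \<gamma>" for \<gamma>
    define w where "w s = (\<Sum>\<gamma>\<in>F. cnj (\<gamma> s) *\<^sub>C y \<gamma>)" for s
    define \<psi> where "\<psi> s = Re (S (w s) (w s))" for s
    have \<psi>_cont: "continuous_on UNIV \<psi>" and \<psi>_int: "(LINT s|m. \<psi> s) = (\<Sum>\<gamma>\<in>F. Re (S (y \<gamma>) (y \<gamma>)))"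
      using Hermitian_Parseval[OF S F(2), of y] by (simp_all add: \<psi>_def[abs_def] w_def)
    have "S (y \<gamma>) (y \<gamma>) = S (dens \<gamma>) (dens \<gamma>)" for \<gamma>
      using \<theta>(1)[of \<gamma>] complex_norm_square[of "\<theta> \<gamma>"]
      by (simp add: y_def S.scale_left S.scale_right mult.assoc[symmetric] mult.commute[of "cnj z" z for z])
    then have \<psi>_le: "(LINT s|m. \<psi> s) \<le> K\<^sup>2" using Hermitian_Bessel[OF S F] by (simp add: \<psi>_int)
    let ?A = "\<Sum>\<gamma>\<in>F. cmod (a \<gamma>)"
    \<comment> \<open>The left side does not depend on \<open>s\<close>. Only the mean of \<psi> is
      under control, so the bound is proved at every \<open>s\<close> and then averaged.\<close>
    have "?A\<^sup>2 \<le> (norm x')\<^sup>2 * K\<^sup>2 * \<psi> s" for s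
    proof -
      have "w s = (\<Sum>\<gamma>\<in>F. (cnj (\<gamma> s) * \<theta> \<gamma>) *\<^sub>C dens \<gamma>)" by (simp add: w_def y_def scaleC_scaleC)
      then have "convolution f (w s) s = (\<Sum>\<gamma>\<in>F. (cnj (\<gamma> s) * \<theta> \<gamma> * \<gamma> s) *\<^sub>C fourier_coeff m f \<gamma>)"
        using convolution_dens_sum[OF F(2), of f _ s] by simp
      also have "\<dots> = (\<Sum>\<gamma>\<in>F. \<theta> \<gamma> *\<^sub>C fourier_coeff m f \<gamma>)"
      proof (intro sum.cong refl)
        fix \<gamma> assume "\<gamma> \<in> F"
        have "cnj (\<gamma> s) * \<theta> \<gamma> * \<gamma> s = \<theta> \<gamma> * (\<gamma> s * cnj (\<gamma> s))" by simp
        then show "(cnj (\<gamma> s) * \<theta> \<gamma> * \<gamma> s) *\<^sub>C fourier_coeff m f \<gamma> = \<theta> \<gamma> *\<^sub>C fourier_coeff m f \<gamma>"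
          using dual_groupD(4)[OF subsetD[OF F(2) \<open>\<gamma> \<in> F\<close>], of s] by (simp only: mult_1_right)
      qed
      finally have "x' (convolution f (w s) s) = of_real ?A"
        by (simp add: cblinfun_sum_right cblinfun_scaleC_right scaleC_complex_def \<theta>(2) a_def[symmetric])
      then have "?A \<le> norm x' * norm (convolution f (w s) s)"
        using norm_cblinfun_apply[of x' "convolution f (w s) s"] by (simp add: sum_nonneg abs_of_nonneg del: of_real_sum)
      then have "?A\<^sup>2 \<le> (norm x' * norm (convolution f (w s) s))\<^sup>2"
        by (intro power_mono) (auto intro: sum_nonneg)
      also have "\<dots> \<le> (norm x')\<^sup>2 * (K\<^sup>2 * \<psi> s)"
        unfolding power_mult_distrib \<psi>_def by (intro mult_left_mono conv) auto
      finally show ?thesis by (simp add: mult.assoc)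
    qed
    then have "(LINT s|m. ?A\<^sup>2) \<le> (LINT s|m. (norm x')\<^sup>2 * K\<^sup>2 * \<psi> s)"
      by (intro integral_mono_continuous continuous_intros \<psi>_cont)
    then have "?A\<^sup>2 \<le> (norm x')\<^sup>2 * K\<^sup>2 * (LINT s|m. \<psi> s)" by simp
    also have "\<dots> \<le> (norm x')\<^sup>2 * K\<^sup>2 * K\<^sup>2" using \<psi>_le by (intro mult_left_mono) auto
    finally have "?A\<^sup>2 \<le> (norm x' * (K\<^sup>2))\<^sup>2" by (simp add: power_mult_distrib power2_eq_square mult_ac)
    then have "?A \<le> norm x' * K\<^sup>2" by (rule power2_le_imp_le) simp
    also have "\<dots> \<le> norm x' * (K\<^sup>2 * (K\<^sup>2 + 1))"
      by (intro mult_left_mono) (auto simp: algebra_simps)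
    finally show "(\<Sum>\<gamma>\<in>F. cmod (cblinfun_apply x' (fourier_coeff m f \<gamma>))) \<le> norm x' * (K\<^sup>2 * (K\<^sup>2 + 1))"
      by (simp add: a_def)
  qed
qed

theorem property_l_if_l1_weak_l2_to_l1:
  fixes T :: "('x::complex_banach, 'y::complex_banach) cblinfun"
  assumes T: "\<And>d. d \<in> l1_weak \<inter> l2_space \<Longrightarrow> (\<lambda>n. T (d n)) \<in> l1_space"
  shows "property_l m T"
  unfolding property_l_def
proof (intro allI impI)
  fix f :: "'g \<Rightarrow>\<^sub>C 'x" assume "factors_through_hilbert_space f"
  then obtain C where
    C2: "\<And>F. finite F \<Longrightarrow> F \<subseteq> dual_group \<Longrightarrow> (\<Sum>\<gamma>\<in>F. (norm (fourier_coeff m f \<gamma>))\<^sup>2) \<le> C" and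
    C1: "\<And>F x'. finite F \<Longrightarrow> F \<subseteq> dual_group \<Longrightarrow>
      (\<Sum>\<gamma>\<in>F. cmod (cblinfun_apply x' (fourier_coeff m f \<gamma>))) \<le> norm x' * C"
    using fourier_coeff_bounds by metis
  let ?x = "fourier_coeff m f"
  have s2: "(\<lambda>\<gamma>. (norm (?x \<gamma>))\<^sup>2) summable_on dual_group"
    using C2 by (intro nonneg_bdd_above_summable_on bdd_aboveI2[where M = C]) auto
  have s1: "(\<lambda>\<gamma>. cmod (cblinfun_apply x' (?x \<gamma>))) summable_on dual_group" for x'
    using C1 by (intro nonneg_bdd_above_summable_on bdd_aboveI2[where M = "norm x' * C"]) auto
  \<comment> \<open>The dual group may be uncountable, but square summability leaves only countably
    many nonzero coefficients.\<close>
  have "countable {\<gamma>\<in>dual_group. ?x \<gamma> \<noteq> 0}"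
    using summable_countable_real[OF s2] by simp
  then obtain d where d: "\<And>\<psi> :: 'x \<Rightarrow> real. \<psi> 0 = 0 \<Longrightarrow> (\<And>a. 0 \<le> \<psi> a) \<Longrightarrow>
      summable (\<lambda>n. \<psi> (d n)) \<longleftrightarrow> (\<lambda>\<gamma>. \<psi> (?x \<gamma>)) summable_on dual_group"
    by (rule countable_family_sequence) blast
  have "d \<in> l1_weak \<inter> l2_space"
    using d[of "\<lambda>a. (norm a)\<^sup>2"] s2 d[of "\<lambda>a. cmod (cblinfun_apply x' a)" for x'] s1
    by (simp add: l1_weak_def l2_space_def)
  then have "(\<lambda>n. T (d n)) \<in> l1_space" by (rule T)
  then show "(\<lambda>\<gamma>. norm (T (?x \<gamma>))) summable_on dual_group"
    using d[of "\<lambda>a. norm (T a)"] by (simp add: l1_space_def)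
qed

end

section \<open>Square summable sequences\<close>

definition ell2 :: "(nat \<Rightarrow> complex) hilbert_ops"
  where "ell2 = \<lparr>hcarrier = {c. summable (\<lambda>i. (cmod (c i))\<^sup>2)}, hzero = (\<lambda>_. 0),
    hadd = (\<lambda>c d i. c i + d i), hscale = (\<lambda>a c i. a * c i),
    hinner = (\<lambda>c d. \<Sum>i. c i * cnj (d i))\<rparr>"

lemma ell2_simps [simp]:
  "c \<in> hcarrier ell2 \<longleftrightarrow> summable (\<lambda>i. (cmod (c i))\<^sup>2)" "hzero ell2 = (\<lambda>_. 0)"
  "hadd ell2 c d = (\<lambda>i. c i + d i)" "hscale ell2 a c = (\<lambda>i. a * c i)"
  "hinner ell2 c d = (\<Sum>i. c i * cnj (d i))"
  by (simp_all add: ell2_def)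

lemma summable_ell2_add:
  assumes "summable (\<lambda>i. (cmod (c i))\<^sup>2)" "summable (\<lambda>i. (cmod (d i))\<^sup>2)"
  shows "summable (\<lambda>i. (cmod (c i + d i))\<^sup>2)"
proof (rule summable_comparison_test')
  show "summable (\<lambda>i. 2 * (cmod (c i))\<^sup>2 + 2 * (cmod (d i))\<^sup>2)"
    using assms by (intro summable_add summable_mult)
  fix i :: nat
  have "(cmod (c i + d i))\<^sup>2 \<le> (cmod (c i) + cmod (d i))\<^sup>2"
    by (intro power_mono norm_triangle_ineq) auto
  also have "\<dots> \<le> 2 * (cmod (c i))\<^sup>2 + 2 * (cmod (d i))\<^sup>2"
    using sum_squares_bound[of "cmod (c i)" "cmod (d i)"] by (simp add: power2_sum)
  finally show "norm ((cmod (c i + d i))\<^sup>2) \<le> 2 * (cmod (c i))\<^sup>2 + 2 * (cmod (d i))\<^sup>2" by simp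
qed

lemma summable_ell2_scale:
  "summable (\<lambda>i. (cmod (c i))\<^sup>2) \<Longrightarrow> summable (\<lambda>i. (cmod (a * c i))\<^sup>2)"
  by (simp add: norm_mult power_mult_distrib)

lemma summable_ell2_inner:
  assumes "summable (\<lambda>i. (cmod (c i))\<^sup>2)" "summable (\<lambda>i. (cmod (d i))\<^sup>2)"
  shows "summable (\<lambda>i. c i * cnj (d i))"
proof (rule summable_comparison_test')
  show "summable (\<lambda>i. (cmod (c i))\<^sup>2 + (cmod (d i))\<^sup>2)"
    using assms by (intro summable_add)
  fix i :: nat
  have "2 * (cmod (c i) * cmod (d i)) \<le> (cmod (c i))\<^sup>2 + (cmod (d i))\<^sup>2"
    using sum_squares_bound[of "cmod (c i)" "cmod (d i)"] by (simp add: mult.assoc)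
  moreover have "0 \<le> cmod (c i) * cmod (d i)" by simp
  ultimately show "norm (c i * cnj (d i)) \<le> (cmod (c i))\<^sup>2 + (cmod (d i))\<^sup>2"
    unfolding norm_mult complex_mod_cnj by linarith
qed

lemma hnorm_ell2: "summable (\<lambda>i. (cmod (c i))\<^sup>2) \<Longrightarrow> hnorm ell2 c = sqrt (\<Sum>i. (cmod (c i))\<^sup>2)"
proof -
  assume c: "summable (\<lambda>i. (cmod (c i))\<^sup>2)"
  have "(\<Sum>i. c i * cnj (c i)) = (\<Sum>i. of_real ((cmod (c i))\<^sup>2))"
    by (simp only: complex_norm_square)
  also have "\<dots> = of_real (\<Sum>i. (cmod (c i))\<^sup>2)" using c by (rule suminf_of_real[symmetric])
  finally show ?thesis by (simp add: hnorm_def)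
qed

lemma hdist_ell2:
  assumes "summable (\<lambda>i. (cmod (c i))\<^sup>2)" "summable (\<lambda>i. (cmod (d i))\<^sup>2)"
  shows "summable (\<lambda>i. (cmod (c i - d i))\<^sup>2)" "hdist ell2 c d = sqrt (\<Sum>i. (cmod (c i - d i))\<^sup>2)"
proof -
  show s: "summable (\<lambda>i. (cmod (c i - d i))\<^sup>2)"
    using summable_ell2_add[OF assms(1) summable_ell2_scale[OF assms(2), of "-1"]] by simp
  show "hdist ell2 c d = sqrt (\<Sum>i. (cmod (c i - d i))\<^sup>2)"
    using hnorm_ell2[of "\<lambda>i. c i - d i"] s by (simp add: hdist_def)
qed

lemma ell2_complete:
  assumes u: "\<And>n::nat. summable (\<lambda>i. (cmod (u n i))\<^sup>2)"
    and Cauchy: "\<And>e. 0 < e \<Longrightarrow> \<exists>N. \<forall>i\<ge>N. \<forall>j\<ge>N. hdist ell2 (u i) (u j) < e"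
  shows "\<exists>l. summable (\<lambda>i. (cmod (l i))\<^sup>2) \<and> (\<lambda>n. hdist ell2 (u n) l) \<longlonglongrightarrow> 0"
proof -
  note d = hdist_ell2[OF u u]
  have part: "(\<Sum>i<k. (cmod (u n i - u p i))\<^sup>2) \<le> (hdist ell2 (u n) (u p))\<^sup>2" for n p k
    using sum_le_suminf[OF d(1), of "{..<k}" n p] suminf_nonneg[OF d(1)] by (simp add: d(2))
  have coord: "cmod (u n i - u p i) \<le> hdist ell2 (u n) (u p)" for n p i
  proof (rule power2_le_imp_le)
    have "(cmod (u n i - u p i))\<^sup>2 \<le> (\<Sum>i<Suc i. (cmod (u n i - u p i))\<^sup>2)"
      by (rule member_le_sum) auto
    then show "(cmod (u n i - u p i))\<^sup>2 \<le> (hdist ell2 (u n) (u p))\<^sup>2" using part[of n p "Suc i"] by linarith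
    show "0 \<le> hdist ell2 (u n) (u p)" by (simp add: d suminf_nonneg)
  qed
  have "Cauchy (\<lambda>n. u n i)" for i
  proof (rule metric_CauchyI)
    fix e :: real assume "0 < e"
    then show "\<exists>M. \<forall>m\<ge>M. \<forall>n\<ge>M. dist (u m i) (u n i) < e"
      using Cauchy coord by (metis dist_norm le_less_trans)
  qed
  then have "\<exists>x. (\<lambda>n. u n i) \<longlonglongrightarrow> x" for i
    using Cauchy_convergent_iff convergent_def by blast
  then obtain l where l: "\<And>i. (\<lambda>n. u n i) \<longlonglongrightarrow> l i" by metis
  have lim: "\<exists>N. \<forall>n\<ge>N. summable (\<lambda>i. (cmod (u n i - l i))\<^sup>2) \<and> (\<Sum>i. (cmod (u n i - l i))\<^sup>2) \<le> e\<^sup>2"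
    if "0 < e" for e
  proof -
    obtain N where N: "\<And>n p. N \<le> n \<Longrightarrow> N \<le> p \<Longrightarrow> hdist ell2 (u n) (u p) < e"
      using Cauchy[OF \<open>0 < e\<close>] by blast
    \<comment> \<open>The number \<open>k\<close> of terms is fixed while \<open>p\<close> tends to
      infinity, and the bound does not depend on \<open>k\<close>.\<close>
    have "(\<Sum>i<k. (cmod (u n i - l i))\<^sup>2) \<le> e\<^sup>2" if "N \<le> n" for n k
    proof (rule LIMSEQ_le_const2)
      show "(\<lambda>p. \<Sum>i<k. (cmod (u n i - u p i))\<^sup>2) \<longlonglongrightarrow> (\<Sum>i<k. (cmod (u n i - l i))\<^sup>2)"
        by (intro tendsto_intros l)
      have "(\<Sum>i<k. (cmod (u n i - u p i))\<^sup>2) \<le> e\<^sup>2" if "N \<le> p" for p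
      proof -
        have "(hdist ell2 (u n) (u p))\<^sup>2 \<le> e\<^sup>2"
          using N[OF \<open>N \<le> n\<close> that] by (intro power_mono) (auto simp: d suminf_nonneg)
        then show ?thesis using part[of n p k] by linarith
      qed
      then show "\<exists>N. \<forall>p\<ge>N. (\<Sum>i<k. (cmod (u n i - u p i))\<^sup>2) \<le> e\<^sup>2" by blast
    qed
    moreover from this have "summable (\<lambda>i. (cmod (u n i - l i))\<^sup>2)" if "N \<le> n" for n
      using that by (intro summableI_nonneg_bounded) auto
    ultimately show ?thesis by (meson suminf_le_const)
  qed
  have ls: "summable (\<lambda>i. (cmod (l i))\<^sup>2)"
  proof -
    obtain n where "summable (\<lambda>i. (cmod (u n i - l i))\<^sup>2)" using lim[of 1] by auto
    from summable_ell2_add[OF u[of n] summable_ell2_scale[OF this, of "-1"]] show ?thesis by simp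
  qed
  have "(\<lambda>n. hdist ell2 (u n) l) \<longlonglongrightarrow> 0"
  proof (rule LIMSEQ_I)
    fix e :: real assume "0 < e"
    obtain N where N: "\<And>n. N \<le> n \<Longrightarrow> (\<Sum>i. (cmod (u n i - l i))\<^sup>2) \<le> (e / 2)\<^sup>2"
      using lim[of "e / 2"] \<open>0 < e\<close> by auto
    have "norm (hdist ell2 (u n) l - 0) < e" if "N \<le> n" for n
    proof -
      have "hdist ell2 (u n) l \<le> sqrt ((e / 2)\<^sup>2)"
        unfolding hdist_ell2(2)[OF u ls] using N[OF that] by (rule real_sqrt_le_mono)
      moreover have "0 \<le> hdist ell2 (u n) l"
        unfolding hdist_ell2(2)[OF u ls] using hdist_ell2(1)[OF u ls] by (simp add: suminf_nonneg)
      ultimately show ?thesis using \<open>0 < e\<close> by simp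
    qed
    then show "\<exists>N. \<forall>n\<ge>N. norm (hdist ell2 (u n) l - 0) < e" by blast
  qed
  with ls show ?thesis by blast
qed

lemma hilbert_space_ell2: "hilbert_space ell2"
proof (unfold_locales, goal_cases)
  \<comment> \<open>Cases 12 to 16 are the analytic axioms: conjugate symmetry, additivity and
    homogeneity of the inner product, its positivity, and completeness.\<close>
  case (12 c d)
  have "(\<lambda>i. d i * cnj (c i)) sums (\<Sum>i. d i * cnj (c i))"
    using 12 by (intro summable_sums summable_ell2_inner) auto
  then have "(\<lambda>i. cnj (d i * cnj (c i))) sums cnj (\<Sum>i. d i * cnj (c i))"
    by (simp only: sums_cnj)
  then show ?case by (simp add: sums_iff mult.commute)
next
  case (13 c d e)
  then show ?case
    by (simp add: distrib_right suminf_add summable_ell2_inner)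
next
  case (14 c d a)
  then show ?case by (simp add: mult.assoc suminf_mult summable_ell2_inner)
next
  case (15 c)
  then have s: "summable (\<lambda>i. (cmod (c i))\<^sup>2)" by simp
  obtain i where i: "c i \<noteq> 0" using 15 by auto
  have "0 < (\<Sum>i. (cmod (c i))\<^sup>2)" using i by (intro suminf_pos2[OF s, of i]) auto
  then have "0 < hnorm ell2 c" by (simp add: hnorm_ell2[OF s])
  then show ?case by (simp add: hnorm_def)
next
  case (16 u)
  then show ?case using ell2_complete[of u] by auto
qed (auto simp: summable_ell2_add summable_ell2_scale norm_mult power_mult_distrib algebra_simps)

lemma ell2_bound:
  assumes "\<And>n. (\<Sum>i<n. (cmod (c i))\<^sup>2) \<le> b\<^sup>2" "0 \<le> b"
  shows "summable (\<lambda>i. (cmod (c i))\<^sup>2)" "hnorm ell2 c \<le> b"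
proof -
  show s: "summable (\<lambda>i. (cmod (c i))\<^sup>2)" using assms(1) by (intro summableI_nonneg_bounded) auto
  have "(\<Sum>i. (cmod (c i))\<^sup>2) \<le> b\<^sup>2" using s assms(1) by (rule suminf_le_const)
  then show "hnorm ell2 c \<le> b" using assms(2) by (simp add: hnorm_ell2[OF s] real_le_lsqrt)
qed

section \<open>Lacunary functions\<close>

lemma cmeasure_integral_add:
  fixes \<mu> :: "'g::topological_space cmeasure"
  assumes "compact (UNIV :: 'g set)" "continuous_on UNIV \<phi>" "continuous_on UNIV \<psi>"
  shows "cmeasure_integral \<mu> (\<lambda>t. \<phi> t + \<psi> t) = cmeasure_integral \<mu> \<phi> + cmeasure_integral \<mu> \<psi>"
proof -
  have "Bcontfun (\<lambda>t. \<phi> t + \<psi> t) = Bcontfun \<phi> + Bcontfun \<psi>"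
    using assms by (intro bcontfun_eqI) (simp add: Bcontfun_apply continuous_on_add)
  then show ?thesis by (simp add: cmeasure_integral_def cblinfun_add_right)
qed

lemma cmeasure_integral_scale:
  fixes \<mu> :: "'g::topological_space cmeasure"
  assumes "compact (UNIV :: 'g set)" "continuous_on UNIV \<phi>"
  shows "cmeasure_integral \<mu> (\<lambda>t. c * \<phi> t) = c * cmeasure_integral \<mu> \<phi>"
proof -
  have "Bcontfun (\<lambda>t. c * \<phi> t) = c *\<^sub>C Bcontfun \<phi>"
    using assms by (intro bcontfun_eqI) (simp add: Bcontfun_apply continuous_on_mult_left scaleC_complex_def)
  then show ?thesis by (simp add: cmeasure_integral_def cblinfun_scaleC_right scaleC_complex_def)
qed

lemma not_two_summing:
  fixes T :: "('x::complex_banach, 'y::complex_banach) cblinfun"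
  assumes "\<not> two_summing T" "0 < C"
  obtains N :: nat and x :: "nat \<Rightarrow> 'x" where
    "\<And>x'. norm x' \<le> 1 \<Longrightarrow> (\<Sum>n=1..N. (cmod (cblinfun_apply x' (x n)))\<^sup>2) \<le> 1"
    "C\<^sup>2 < (\<Sum>n=1..N. (norm (T (x n)))\<^sup>2)"
proof -
  let ?s = "\<lambda>N (x :: nat \<Rightarrow> 'x) x'. \<Sum>n=1..N. (cmod (cblinfun_apply x' (x n)))\<^sup>2"
  obtain N and x :: "nat \<Rightarrow> 'x" where
    big: "C\<^sup>2 * (SUP x'\<in>{x'. norm x' \<le> 1}. ?s N x x') < (\<Sum>n=1..N. (norm (T (x n)))\<^sup>2)"
    using assms unfolding two_summing_def by (meson not_le)
  define w where "w = (SUP x'\<in>{x'. norm x' \<le> 1}. ?s N x x')"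
  have le: "cmod (cblinfun_apply x' (x n)) \<le> norm (x n)" if "norm x' \<le> 1" for x' n
    using norm_cblinfun_apply[of x' "x n"] mult_right_mono[OF that, of "norm (x n)"] by simp
  have bdd: "bdd_above (?s N x ` {x'. norm x' \<le> 1})"
    using le by (intro bdd_aboveI2[where M = "\<Sum>n=1..N. (norm (x n))\<^sup>2"] sum_mono power_mono) auto
  have w: "?s N x x' \<le> w" if "norm x' \<le> 1" for x'
    unfolding w_def using that by (intro cSUP_upper bdd) auto
  have "0 \<le> w" using w[of 0] by simp
  have "w \<noteq> 0"
  proof
    assume "w = 0"
    have "x n = 0" if "n \<in> {1..N}" for n
    proof -
      have "norm (x n) \<le> 0"
      proof (rule norm_le_cdual)
        fix x' :: "'x cdual" assume "norm x' \<le> 1"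
        then have "?s N x x' = 0" using w \<open>w = 0\<close> by (intro antisym sum_nonneg) auto
        then show "cmod (x' (x n)) \<le> 0" using that by (simp add: sum_nonneg_eq_0_iff)
      qed
      then show ?thesis by simp
    qed
    then have "(\<Sum>n=1..N. (norm (T (x n)))\<^sup>2) = 0" by simp
    moreover have "C\<^sup>2 * w < (\<Sum>n=1..N. (norm (T (x n)))\<^sup>2)" using big by (simp only: w_def)
    ultimately show False by (simp add: \<open>w = 0\<close>)
  qed
  with \<open>0 \<le> w\<close> have "0 < w" by simp
  \<comment> \<open>Rescaling makes the weak 2-norm of the family at most 1; the inequality to be
    kept is homogeneous.\<close>
  define r where "r = inverse (sqrt w)"
  have r: "r\<^sup>2 * w = 1" "0 \<le> r" using \<open>0 < w\<close> by (simp_all add: r_def power_inverse)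
  show ?thesis
  proof (rule that)
    fix x' :: "'x cdual" assume "norm x' \<le> 1"
    have "?s N (\<lambda>n. r *\<^sub>R x n) x' = r\<^sup>2 * ?s N x x'"
      by (simp add: cblinfun_scaleR_right power_mult_distrib sum_distrib_left)
    also have "\<dots> \<le> r\<^sup>2 * w" using w[OF \<open>norm x' \<le> 1\<close>] by (intro mult_left_mono) auto
    finally show "?s N (\<lambda>n. r *\<^sub>R x n) x' \<le> 1" by (simp add: r)
  next
    have "C\<^sup>2 = r\<^sup>2 * (C\<^sup>2 * w)" using r(1) by (simp add: mult.left_commute)
    also have "\<dots> < r\<^sup>2 * (\<Sum>n=1..N. (norm (T (x n)))\<^sup>2)"
      using big r(1) unfolding w_def[symmetric] by (intro mult_strict_left_mono) (auto simp: zero_less_power2)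
    also have "\<dots> = (\<Sum>n=1..N. (norm (T (r *\<^sub>R x n)))\<^sup>2)"
      by (simp add: cblinfun_scaleR_right power_mult_distrib sum_distrib_left)
    finally show "C\<^sup>2 < (\<Sum>n=1..N. (norm (T (r *\<^sub>R x n)))\<^sup>2)" .
  qed
qed

text \<open>The blocks are dominated by a geometric series with sum 4/3; 2 is a round number above
  it.\<close>

lemma sum_blocks_le:
  fixes g :: "nat \<times> nat \<Rightarrow> real"
  assumes "finite J" and nonneg: "\<And>p. 0 \<le> g p" and zero: "\<And>k n. n \<notin> {1..N k} \<Longrightarrow> g (k, n) = 0"
    and block: "\<And>k. (\<Sum>n=1..N k. g (k, n)) \<le> (1 / 4) ^ k"
  shows "(\<Sum>p\<in>J. g p) \<le> 2"
proof -
  obtain K where K: "fst ` J \<subseteq> {..<K}"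
    using finite_nat_iff_bounded[of "fst ` J"] \<open>finite J\<close> by auto
  have fin: "finite (SIGMA k:{..<K}. {1..N k})" by simp
  have geo: "(\<Sum>k<K. (1 / 4) ^ k) \<le> (2::real)"
  proof -
    have "(\<Sum>k<K. (1 / 4) ^ k) = 4 / 3 - 4 / 3 * (1 / 4 :: real) ^ K"
    proof (induction K)
      case (Suc K)
      then show ?case unfolding sum.lessThan_Suc power_Suc by linarith
    qed simp
    moreover have "0 \<le> (1 / 4 :: real) ^ K" by simp
    ultimately show ?thesis by linarith
  qed
  have "(\<Sum>p\<in>J. g p) = (\<Sum>p\<in>J \<inter> (SIGMA k:{..<K}. {1..N k}). g p)"
  proof (rule sum.mono_neutral_right[OF \<open>finite J\<close>])
    show "\<forall>p\<in>J - J \<inter> (SIGMA k:{..<K}. {1..N k}). g p = 0"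
    proof
      fix p assume "p \<in> J - J \<inter> (SIGMA k:{..<K}. {1..N k})"
      then show "g p = 0" using K zero by (cases p) auto
    qed
  qed simp
  also have "\<dots> \<le> (\<Sum>p\<in>(SIGMA k:{..<K}. {1..N k}). g p)"
    using fin nonneg by (intro sum_mono2) auto
  also have "\<dots> = (\<Sum>k<K. \<Sum>n=1..N k. g (k, n))"
    by (simp add: sum.Sigma)
  also have "\<dots> \<le> (\<Sum>k<K. (1 / 4) ^ k)" by (intro sum_mono block)
  finally show ?thesis using geo by linarith
qed

context compact_haar
begin

text \<open>For square summable \<open>\<alpha>\<close> and weakly square summable \<open>z\<close>, the convolution operator of
  \<open>\<Sum>\<^sub>i \<alpha>\<^sub>i \<gamma>\<^sub>i z\<^sub>i\<close> is the composition of \<open>\<mu> \<mapsto> (\<alpha>\<^sub>i \<integral> cnj \<gamma>\<^sub>i d\<mu>)\<^sub>i\<close> and \<open>c \<mapsto> \<Sum>\<^sub>i c\<^sub>i \<gamma>\<^sub>i z\<^sub>i\<close>.\<close>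

lemma ex_factoring_function:
  fixes z :: "nat \<Rightarrow> 'x::complex_banach" and \<alpha> :: "nat \<Rightarrow> real"
  assumes \<gamma>: "inj \<gamma>" "\<And>i. \<gamma> i \<in> dual_group"
    and z: "\<And>I x'. finite I \<Longrightarrow> norm x' \<le> 1 \<Longrightarrow> (\<Sum>i\<in>I. (cmod (cblinfun_apply x' (z i)))\<^sup>2) \<le> W\<^sup>2"
    and \<alpha>: "\<And>I. finite I \<Longrightarrow> (\<Sum>i\<in>I. (\<alpha> i)\<^sup>2) \<le> a\<^sup>2" and "0 \<le> W" "0 \<le> a"
  obtains f :: "'g \<Rightarrow>\<^sub>C 'x" where "factors_through_hilbert_space f"
    "\<And>i. fourier_coeff m f (\<gamma> i) = of_real (\<alpha> i) *\<^sub>C z i"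
proof -
  note g = dual_groupD[OF \<gamma>(2)]
  define E where "E i = Bcontfun (\<lambda>s. \<gamma> i s *\<^sub>C z i)" for i
  have E: "E i s = \<gamma> i s *\<^sub>C z i" for i s
    unfolding E_def by (subst Bcontfun_apply[OF cpt]) (auto intro!: continuous_intros g(1))
  \<comment> \<open>Cauchy-Schwarz over the indices, for each point \<open>s\<close> and each
    functional separately; the characters have modulus 1 and drop out.\<close>
  have E_bound: "norm (\<Sum>i\<in>I. c i *\<^sub>C E i) \<le> W * sqrt (\<Sum>i\<in>I. (cmod (c i))\<^sup>2)" if "finite I" for I c
  proof (rule norm_bound, rule norm_le_cdual)
    fix s and x' :: "'x cdual" assume x': "norm x' \<le> 1"
    have "cmod (x' ((\<Sum>i\<in>I. c i *\<^sub>C E i) s)) = cmod (\<Sum>i\<in>I. c i * \<gamma> i s * x' (z i))"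
      by (simp add: sum_bcontfun_apply E cblinfun_sum_right cblinfun_scaleC_right scaleC_complex_def mult.assoc)
    also have "\<dots> \<le> (\<Sum>i\<in>I. cmod (c i * \<gamma> i s * x' (z i)))" by (rule norm_sum)
    also have "\<dots> = (\<Sum>i\<in>I. \<bar>cmod (c i)\<bar> * \<bar>cmod (x' (z i))\<bar>)" by (simp add: norm_mult g(2))
    also have "\<dots> \<le> L2_set (\<lambda>i. cmod (c i)) I * L2_set (\<lambda>i. cmod (x' (z i))) I"
      by (rule L2_set_mult_ineq)
    also have "L2_set (\<lambda>i. cmod (x' (z i))) I \<le> W"
      unfolding L2_set_def using z[OF that x'] \<open>0 \<le> W\<close> by (intro real_le_lsqrt) (auto intro: sum_nonneg)
    finally show "cmod (x' ((\<Sum>i\<in>I. c i *\<^sub>C E i) s)) \<le> W * sqrt (\<Sum>i\<in>I. (cmod (c i))\<^sup>2)"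
      by (simp add: L2_set_def mult.commute mult_right_mono sum_nonneg)
  qed
  define B where "B c = (\<Sum>i. c i *\<^sub>C E i)" for c
  have B_summable: "summable (\<lambda>i. c i *\<^sub>C E i)" if c: "summable (\<lambda>i. (cmod (c i))\<^sup>2)" for c
    unfolding summable_Cauchy
  proof (intro allI impI)
    fix e :: real assume "0 < e"
    \<comment> \<open>\<open>W + 1\<close> instead of \<open>W\<close>, which may be 0.\<close>
    then have "0 < (e / (W + 1))\<^sup>2" using \<open>0 \<le> W\<close> by simp
    then obtain N where N: "\<And>p n. N \<le> p \<Longrightarrow> norm (\<Sum>i=p..<n. (cmod (c i))\<^sup>2) < (e / (W + 1))\<^sup>2"
      using c unfolding summable_Cauchy by blast
    show "\<exists>N. \<forall>p\<ge>N. \<forall>n. norm (\<Sum>i=p..<n. c i *\<^sub>C E i) < e"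
    proof (intro exI allI impI)
      fix p n assume "N \<le> p"
      have "sqrt (\<Sum>i=p..<n. (cmod (c i))\<^sup>2) < e / (W + 1)"
        using N[OF \<open>N \<le> p\<close>, of n] \<open>0 < e\<close> \<open>0 \<le> W\<close> by (intro real_less_lsqrt) (auto simp: sum_nonneg)
      then have "(W + 1) * sqrt (\<Sum>i=p..<n. (cmod (c i))\<^sup>2) < e"
        using \<open>0 \<le> W\<close> by (simp add: field_simps)
      moreover have "W * sqrt (\<Sum>i=p..<n. (cmod (c i))\<^sup>2) \<le> (W + 1) * sqrt (\<Sum>i=p..<n. (cmod (c i))\<^sup>2)"
        by (intro mult_right_mono) (auto simp: sum_nonneg)
      ultimately show "norm (\<Sum>i=p..<n. c i *\<^sub>C E i) < e"
        using E_bound[of "{p..<n}" c] by simp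
    qed
  qed
  have B_from: "bounded_from ell2 B"
    unfolding bounded_from_def
  proof (intro conjI ballI allI)
    fix c d assume cd: "c \<in> hcarrier ell2" "d \<in> hcarrier ell2"
    then show "B (hadd ell2 c d) = B c + B d"
      by (simp add: B_def scaleC_add_left suminf_add B_summable)
  next
    fix a c assume "c \<in> hcarrier ell2"
    then show "B (hscale ell2 a c) = a *\<^sub>C B c"
      using bounded_linear.suminf[OF bounded_linear_scaleC B_summable, of c a]
      by (simp add: B_def scaleC_scaleC)
  next
    have "norm (B c) \<le> W * hnorm ell2 c" if c: "summable (\<lambda>i. (cmod (c i))\<^sup>2)" for c
    proof (rule LIMSEQ_le_const2)
      show "(\<lambda>n. norm (\<Sum>i<n. c i *\<^sub>C E i)) \<longlonglongrightarrow> norm (B c)"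
        unfolding B_def by (intro tendsto_norm summable_LIMSEQ B_summable c)
      have "norm (\<Sum>i<n. c i *\<^sub>C E i) \<le> W * hnorm ell2 c" for n
      proof -
        have "sqrt (\<Sum>i<n. (cmod (c i))\<^sup>2) \<le> hnorm ell2 c"
          unfolding hnorm_ell2[OF c] using c by (intro real_sqrt_le_mono sum_le_suminf) auto
        then have "W * sqrt (\<Sum>i<n. (cmod (c i))\<^sup>2) \<le> W * hnorm ell2 c"
          using \<open>0 \<le> W\<close> by (rule mult_left_mono)
        then show ?thesis using E_bound[of "{..<n}" c] by simp
      qed
      then show "\<exists>N. \<forall>n\<ge>N. norm (\<Sum>i<n. c i *\<^sub>C E i) \<le> W * hnorm ell2 c" by blast
    qed
    then show "\<exists>K. \<forall>c\<in>hcarrier ell2. norm (B c) \<le> K * hnorm ell2 c"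
      by (intro exI[of _ W]) simp
  qed
  define b where "b i = Bcontfun (\<lambda>t. cnj (\<gamma> i t))" for i
  have b: "b i t = cnj (\<gamma> i t)" for i t
    unfolding b_def by (subst Bcontfun_apply[OF cpt]) (auto intro!: continuous_intros g(1))
  define A where "A \<mu> i = of_real (\<alpha> i) * cblinfun_apply \<mu> (b i)" for \<mu> :: "'g cmeasure" and i
  have A_bound: "summable (\<lambda>i. (cmod (A \<mu> i))\<^sup>2)" "hnorm ell2 (A \<mu>) \<le> a * norm \<mu>" for \<mu>
  proof -
    have "(\<Sum>i<n. (cmod (A \<mu> i))\<^sup>2) \<le> (a * norm \<mu>)\<^sup>2" for n
    proof -
      have "cmod (cblinfun_apply \<mu> (b i)) \<le> norm \<mu>" for i
      proof -
        have "norm (b i) \<le> 1" by (rule norm_bound) (simp add: b g(2))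
        then have "norm \<mu> * norm (b i) \<le> norm \<mu> * 1" by (intro mult_left_mono) auto
        then show ?thesis using norm_cblinfun_apply[of \<mu> "b i"] by simp
      qed
      then have "(\<Sum>i<n. (cmod (A \<mu> i))\<^sup>2) \<le> (\<Sum>i<n. (\<alpha> i)\<^sup>2 * (norm \<mu>)\<^sup>2)"
        by (intro sum_mono) (auto simp: A_def norm_mult power_mult_distrib intro!: mult_left_mono power_mono)
      also have "\<dots> \<le> a\<^sup>2 * (norm \<mu>)\<^sup>2"
        unfolding sum_distrib_right[symmetric] by (intro mult_right_mono \<alpha>) auto
      finally show ?thesis by (simp add: power_mult_distrib)
    qed
    then show "summable (\<lambda>i. (cmod (A \<mu> i))\<^sup>2)" "hnorm ell2 (A \<mu>) \<le> a * norm \<mu>"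
      using ell2_bound[of "A \<mu>" "a * norm \<mu>"] \<open>0 \<le> a\<close> by auto
  qed
  have A_into: "bounded_into ell2 A"
    unfolding bounded_into_def
    using A_bound by (auto simp: A_def cblinfun_add_right algebra_simps scaleC_complex_def)
  have \<alpha>_summable: "summable (\<lambda>i. (cmod (of_real (\<alpha> i)))\<^sup>2)"
    using \<alpha> by (intro ell2_bound(1)[of _ a] \<open>0 \<le> a\<close>) auto
  define f where "f = B (\<lambda>i. of_real (\<alpha> i))"
  have f_conv: "apply_bcontfun (B (A \<mu>)) = convolution f \<mu>" for \<mu>
  proof (rule ext, rule cdual_separates)
    fix s and x' :: "'x cdual"
    \<comment> \<open>The value of the functional on the convolution, as a bounded linear function
      of the convolved function. It can thus be applied to the series for \<open>f\<close> termwise,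
      and the factor \<open>\<gamma> i (s - t) = \<gamma> i s * cnj (\<gamma> i t)\<close> produces
      \<open>A \<mu> i\<close>.\<close>
    define \<Phi> where "\<Phi> h = cmeasure_integral \<mu> (\<lambda>t. x' (apply_bcontfun h (s - t)))" for h :: "'g \<Rightarrow>\<^sub>C 'x"
    have cont: "continuous_on UNIV (\<lambda>t. x' (apply_bcontfun h (s - t)))" for h :: "'g \<Rightarrow>\<^sub>C 'x"
      by (intro continuous_intros, rule continuous_on_compose2[OF continuous_on_apply_bcontfun[of UNIV h]])
        (auto intro!: continuous_intros)
    have "bounded_linear \<Phi>"
    proof (rule bounded_linear_intro)
      fix h k :: "'g \<Rightarrow>\<^sub>C 'x" and r :: real
      show "\<Phi> (h + k) = \<Phi> h + \<Phi> k"
        by (simp add: \<Phi>_def cblinfun_add_right cmeasure_integral_add cpt cont)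
      have "\<Phi> (r *\<^sub>R h) = cmeasure_integral \<mu> (\<lambda>t. of_real r * x' (h (s - t)))"
        by (simp add: \<Phi>_def cblinfun_scaleR_right scaleR_conv_of_real)
      then show "\<Phi> (r *\<^sub>R h) = r *\<^sub>R \<Phi> h"
        by (simp add: cmeasure_integral_scale cpt cont scaleR_conv_of_real \<Phi>_def)
      have "cmod (x' (h t)) \<le> norm x' * norm h" for t
        using norm_cblinfun_apply[of x' "h t"] mult_left_mono[OF norm_bounded[of h t], of "norm x'"] by simp
      then show "norm (\<Phi> h) \<le> norm h * (norm \<mu> * norm x')"
        using cmeasure_integral_bound[OF cpt cont, of h "norm x' * norm h" \<mu>] by (simp add: \<Phi>_def mult_ac)
    qed
    moreover have "\<Phi> (of_real (\<alpha> i) *\<^sub>C E i) = A \<mu> i * (\<gamma> i s * x' (z i))" for i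
    proof -
      have "\<Phi> (of_real (\<alpha> i) *\<^sub>C E i) = cmeasure_integral \<mu> (\<lambda>t. (of_real (\<alpha> i) * (\<gamma> i s * x' (z i))) * cnj (\<gamma> i t))"
        by (simp add: \<Phi>_def E g(7) cblinfun_scaleC_right scaleC_complex_def mult_ac)
      also have "\<dots> = (of_real (\<alpha> i) * (\<gamma> i s * x' (z i))) * \<mu> (b i)"
        by (subst cmeasure_integral_scale[OF cpt])
          (auto simp: cmeasure_integral_def b_def intro!: continuous_intros g(1))
      finally show ?thesis by (simp add: A_def)
    qed
    ultimately have "\<Phi> f = (\<Sum>i. A \<mu> i * (\<gamma> i s * x' (z i)))"
      unfolding f_def B_def using bounded_linear.suminf[OF _ B_summable[OF \<alpha>_summable], of \<Phi>] by simp
    moreover have "bounded_linear (\<lambda>h :: 'g \<Rightarrow>\<^sub>C 'x. x' (h s))"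
      by (rule bounded_linear_compose[OF bounded_linear_cblinfun_apply bounded_linear_bcontfun_apply])
    then have "x' (B (A \<mu>) s) = (\<Sum>i. A \<mu> i * (\<gamma> i s * x' (z i)))"
      unfolding B_def using bounded_linear.suminf[OF _ B_summable[OF A_bound(1)], of "\<lambda>h. x' (apply_bcontfun h s)"]
      by (simp add: E cblinfun_scaleC_right scaleC_complex_def)
    ultimately show "x' (B (A \<mu>) s) = x' (convolution f \<mu> s)"
      by (simp add: convolution_dual \<Phi>_def)
  qed
  have "factors_through_hilbert_space f"
    using A_into B_from f_conv
    by (intro factors_through_hilbert_spaceI[OF hilbert_space_ell2]) (auto simp: factors_through_def)
  moreover have "fourier_coeff m f (\<gamma> j) = of_real (\<alpha> j) *\<^sub>C z j" for j
  proof -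
    have one: "1 *\<^sub>C y = y" for y :: "'b::complex_normed_vector" using scaleC_of_real[of 1 y] by simp
    \<comment> \<open>The coefficient is the convolution with \<open>dens (\<gamma> j)\<close> at 0.
      By orthogonality \<open>A\<close> sends this measure to a multiple of one basis vector, so a
      single term of the series for \<open>B\<close> survives.\<close>
    have "fourier_coeff m f (\<gamma> j) = convolution f (dens (\<gamma> j)) 0"
      using convolution_dens_sum[of "{\<gamma> j}" f "\<lambda>_. 1" 0] \<gamma>(2)[of j] by (simp add: one g(5))
    also have "\<dots> = B (A (dens (\<gamma> j))) 0" by (simp add: f_conv)
    also have "B (A (dens (\<gamma> j))) = (\<Sum>i. if i = j then of_real (\<alpha> j) *\<^sub>C E j else 0)"
    proof -
      have "A (dens (\<gamma> j)) i = (if i = j then of_real (\<alpha> j) else 0)" for i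
        using integral_characters[OF \<gamma>(2)[of j] \<gamma>(2)[of i]] inj_eq[OF \<gamma>(1), of i j]
        by (auto simp: A_def dens_apply[OF g(1)] b)
      then show ?thesis unfolding B_def by (intro suminf_cong) (auto simp: scaleC_of_real[of 0, simplified])
    qed
    also have "\<dots> = of_real (\<alpha> j) *\<^sub>C E j" by (rule sums_unique[symmetric], rule sums_single)
    finally show ?thesis by (simp add: E g(5) one)
  qed
  ultimately show ?thesis using that by blast
qed

text \<open>Failing the \<open>2\<close>-summing inequality with constants \<open>4\<^sup>k\<close> gives finite families that are glued
  with weights \<open>2\<^sup>-\<^sup>k\<close>; each block contributes at least \<open>1\<close> to \<open>\<Sum>\<^sub>\<gamma> \<parallel>T f(\<gamma>)\<parallel>\<close>.\<close>

theorem two_summing_if_property_l: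
  fixes T :: "('x::complex_banach, 'y::complex_banach) cblinfun"
  assumes inf: "infinite (UNIV :: 'g set)" and l: "property_l m T"
  shows "two_summing T"
proof (rule ccontr)
  assume nts: "\<not> two_summing T"
  have "\<exists>N (x :: nat \<Rightarrow> 'x). (\<forall>x'. norm x' \<le> 1 \<longrightarrow> (\<Sum>n=1..N. (cmod (cblinfun_apply x' (x n)))\<^sup>2) \<le> 1) \<and>
      (4 ^ k)\<^sup>2 < (\<Sum>n=1..N. (norm (T (x n)))\<^sup>2)" for k :: nat
    by (rule not_two_summing[OF nts, of "4 ^ k"]) auto
  then obtain N and x :: "nat \<Rightarrow> nat \<Rightarrow> 'x" where
    x: "\<And>k x'. norm x' \<le> 1 \<Longrightarrow> (\<Sum>n=1..N k. (cmod (cblinfun_apply x' (x k n)))\<^sup>2) \<le> 1" and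
    big: "\<And>k. (4 ^ k)\<^sup>2 < (\<Sum>n=1..N k. (norm (T (x k n)))\<^sup>2)"
    by metis
  define S where "S k = (\<Sum>n=1..N k. (norm (T (x k n)))\<^sup>2)" for k
  have S: "(4 ^ k)\<^sup>2 < S k" "0 < S k" "4 ^ k \<le> sqrt (S k)" for k
  proof -
    show 1: "(4 ^ k)\<^sup>2 < S k" using big by (simp add: S_def)
    moreover have "0 \<le> (4 ^ k :: real)\<^sup>2" by simp
    ultimately show "0 < S k" by linarith
    show "4 ^ k \<le> sqrt (S k)" using 1 by (intro real_le_rsqrt) simp
  qed
  \<comment> \<open>Both \<open>z\<close> and \<alpha> carry a factor \<open>(1 / 2) ^ k\<close>,
    which makes their squares geometrically small. Within a block \<alpha> is proportional to the
    norms \<open>norm (T (x k n))\<close>, the equality case of Cauchy-Schwarz, so the block sum is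
    \<open>(1 / 4) ^ k * sqrt (S k)\<close>.\<close>
  define z where "z p = (case p of (k, n) \<Rightarrow> if n \<in> {1..N k} then (1 / 2) ^ k *\<^sub>R x k n else 0)" for p
  define \<alpha> where "\<alpha> p = (case p of (k, n) \<Rightarrow>
    if n \<in> {1..N k} then (1 / 2) ^ k * (norm (T (x k n)) / sqrt (S k)) else 0)" for p
  have quarter: "((1 / 2 :: real) ^ k)\<^sup>2 = (1 / 4) ^ k" for k
    by (simp add: power2_eq_square power_mult_distrib[symmetric])
  have z_bound: "(\<Sum>p\<in>J. (cmod (cblinfun_apply x' (z p)))\<^sup>2) \<le> 2" if "finite J" "norm x' \<le> 1" for J x'
  proof (rule sum_blocks_le[where N = N, OF \<open>finite J\<close>])
    fix k
    have "(\<Sum>n=1..N k. (cmod (cblinfun_apply x' (z (k, n))))\<^sup>2) = (\<Sum>n=1..N k. (1 / 4) ^ k * (cmod (cblinfun_apply x' (x k n)))\<^sup>2)"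
      by (intro sum.cong refl) (simp add: z_def cblinfun_scaleR_right power_mult_distrib quarter del: scaleR_conv_of_real)
    also have "\<dots> \<le> (1 / 4) ^ k * 1"
      unfolding sum_distrib_left[symmetric] by (intro mult_left_mono x that) simp
    finally show "(\<Sum>n=1..N k. (cmod (cblinfun_apply x' (z (k, n))))\<^sup>2) \<le> (1 / 4) ^ k" by simp
  qed (auto simp: z_def)
  have \<alpha>_bound: "(\<Sum>p\<in>J. (\<alpha> p)\<^sup>2) \<le> 2" if "finite J" for J
  proof (rule sum_blocks_le[where N = N, OF \<open>finite J\<close>])
    fix k
    have "(\<Sum>n=1..N k. (\<alpha> (k, n))\<^sup>2) = (\<Sum>n=1..N k. (1 / 4) ^ k / S k * (norm (T (x k n)))\<^sup>2)"
    proof (intro sum.cong refl)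
      fix n assume "n \<in> {1..N k}"
      then have "(\<alpha> (k, n))\<^sup>2 = ((1 / 2) ^ k)\<^sup>2 / S k * (norm (T (x k n)))\<^sup>2"
        using S(2)[of k] by (simp add: \<alpha>_def power_mult_distrib power_divide)
      then show "(\<alpha> (k, n))\<^sup>2 = (1 / 4) ^ k / S k * (norm (T (x k n)))\<^sup>2"
        by (simp only: quarter)
    qed
    also have "\<dots> = (1 / 4) ^ k / S k * S k" unfolding sum_distrib_left[symmetric] S_def ..
    finally show "(\<Sum>n=1..N k. (\<alpha> (k, n))\<^sup>2) \<le> (1 / 4) ^ k" using S(2)[of k] by simp
  qed (auto simp: \<alpha>_def)
  have block: "1 \<le> (\<Sum>n=1..N k. norm (T (\<alpha> (k, n) *\<^sub>R z (k, n))))" for k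
  proof -
    have "(\<Sum>n=1..N k. norm (T (\<alpha> (k, n) *\<^sub>R z (k, n)))) = (\<Sum>n=1..N k. (1 / 4) ^ k / sqrt (S k) * (norm (T (x k n)))\<^sup>2)"
    proof (intro sum.cong refl)
      fix n assume "n \<in> {1..N k}"
      then have "norm (T (\<alpha> (k, n) *\<^sub>R z (k, n))) = ((1 / 2) ^ k)\<^sup>2 / sqrt (S k) * (norm (T (x k n)))\<^sup>2"
        using S(2)[of k]
        by (simp add: \<alpha>_def z_def cblinfun_scaleR_right power2_eq_square abs_mult mult_ac)
      then show "norm (T (\<alpha> (k, n) *\<^sub>R z (k, n))) = (1 / 4) ^ k / sqrt (S k) * (norm (T (x k n)))\<^sup>2"
        by (simp only: quarter)
    qed
    also have "\<dots> = (1 / 4) ^ k / sqrt (S k) * S k" unfolding sum_distrib_left[symmetric] S_def ..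
    also have "\<dots> = (1 / 4) ^ k * sqrt (S k)" using S(2)[of k] real_div_sqrt[of "S k"]
      by (simp flip: times_divide_eq_right)
    finally have eq: "(\<Sum>n=1..N k. norm (T (\<alpha> (k, n) *\<^sub>R z (k, n)))) = (1 / 4) ^ k * sqrt (S k)" .
    have "(1 / 4) ^ k * 4 ^ k \<le> (1 / 4) ^ k * sqrt (S k)" using S(3) by (intro mult_left_mono) auto
    then show ?thesis unfolding eq by (simp add: power_mult_distrib[symmetric])
  qed
  obtain \<gamma> :: "nat \<Rightarrow> 'g \<Rightarrow> complex" where \<gamma>: "inj \<gamma>" "\<And>i. \<gamma> i \<in> dual_group"
    using infinite_countable_subset[OF infinite_dual_group[OF inf]] by blast
  have inj: "inj_on prod_decode I" for I by (rule inj_on_subset[OF inj_prod_decode subset_UNIV])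
  obtain f :: "'g \<Rightarrow>\<^sub>C 'x" where f: "factors_through_hilbert_space f"
    "\<And>i. fourier_coeff m f (\<gamma> i) = of_real (\<alpha> (prod_decode i)) *\<^sub>C z (prod_decode i)"
  \<comment> \<open>\<open>prod_decode\<close> lists the pairs (k, n) as one sequence; pairs beyond
    the length of their block contribute 0. The bounds enter squared, hence
    \<open>sqrt 2\<close>.\<close>
  proof (rule ex_factoring_function[OF \<gamma>, of "\<lambda>i. z (prod_decode i)" "sqrt 2" "\<lambda>i. \<alpha> (prod_decode i)" "sqrt 2"])
    fix I :: "nat set" and x' :: "'x cdual" assume I: "finite I"
    show "(\<Sum>i\<in>I. (\<alpha> (prod_decode i))\<^sup>2) \<le> (sqrt 2)\<^sup>2"
      using \<alpha>_bound[of "prod_decode ` I"] I by (simp add: sum.reindex[OF inj])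
    assume "norm x' \<le> 1"
    then show "(\<Sum>i\<in>I. (cmod (x' (z (prod_decode i))))\<^sup>2) \<le> (sqrt 2)\<^sup>2"
      using z_bound[of "prod_decode ` I" x'] I by (simp add: sum.reindex[OF inj])
  qed (use that in auto)
  have "(\<lambda>\<gamma>. norm (T (fourier_coeff m f \<gamma>))) summable_on dual_group"
    using l f(1) unfolding property_l_def by blast
  then have "(\<lambda>\<gamma>. norm (T (fourier_coeff m f \<gamma>))) summable_on range \<gamma>"
    by (rule summable_on_subset_banach) (use \<gamma>(2) in auto)
  then have "(\<lambda>i. norm (T (fourier_coeff m f (\<gamma> i)))) summable_on UNIV"
    using summable_on_reindex[OF \<gamma>(1), of "\<lambda>\<gamma>. norm (T (fourier_coeff m f \<gamma>))"] by (simp add: o_def)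
  then have "(\<lambda>i. norm (T (\<alpha> (prod_decode i) *\<^sub>R z (prod_decode i)))) summable_on UNIV"
    by (simp add: f(2) scaleC_of_real)
  then have "(\<lambda>p. norm (T (\<alpha> p *\<^sub>R z p))) summable_on UNIV"
    using summable_on_reindex[of prod_decode UNIV "\<lambda>p. norm (T (\<alpha> p *\<^sub>R z p))"] inj_prod_decode
    by (simp add: o_def surj_prod_decode)
  then obtain M where M: "\<And>J. finite J \<Longrightarrow> (\<Sum>p\<in>J. norm (T (\<alpha> p *\<^sub>R z p))) \<le> M"
    using finite_sum_le_infsum[of "\<lambda>p. norm (T (\<alpha> p *\<^sub>R z p))" UNIV] by auto
  have "real K \<le> M" for K :: nat
  proof -
    have "real K = (\<Sum>k<K. 1)" by simp
    also have "\<dots> \<le> (\<Sum>k<K. \<Sum>n=1..N k. norm (T (\<alpha> (k, n) *\<^sub>R z (k, n))))" by (intro sum_mono block)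
    also have "\<dots> = (\<Sum>p\<in>(SIGMA k:{..<K}. {1..N k}). norm (T (\<alpha> p *\<^sub>R z p)))"
      by (subst sum.Sigma) (auto simp: case_prod_unfold)
    also have "\<dots> \<le> M" by (intro M) simp
    finally show ?thesis .
  qed
  then show False using reals_Archimedean2[of M] by (meson not_le)
qed

end

theorem theorem4p2:
  fixes m :: "'g::{topological_ab_group_add, t2_space} measure"
    and T :: "('x::complex_banach, 'y::complex_banach) cblinfun"
  assumes "compact (UNIV :: 'g set)"
    and "normalized_haar_measure m"
  shows "(infinite (UNIV :: 'g set) \<longrightarrow> property_l m T \<longrightarrow> two_summing T) \<and>
    ((\<forall>d \<in> l1_weak \<inter> l2_space. (\<lambda>n. T (d n)) \<in> l1_space) \<longrightarrow> property_l m T)"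
proof -
  interpret compact_haar m using assms by unfold_locales
  show ?thesis using two_summing_if_property_l property_l_if_l1_weak_l2_to_l1 by blast
qed

end
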